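(* Let $R\in\operatorname{Ob}(\hat{\mathcal C})$ with residue field $k\ne\mathbb F_2$, $n=3$, $G=\mathrm{SL}_3(R)$, $\bar\rho:G\to\mathrm{GL}_3(k)$ induced by reduction, and $\iota:G\hookrightarrow\mathrm{GL}_3(R)$ the inclusion. Then $\iota$ is a universal lift of $\bar\rho$.
   Context: Let $k$ be a finite field of characteristic $p$. $\hat{\mathcal C}$ is the category of complete noetherian local commutative rings with residue field $k$, with local homomorphisms inducing the identity on $k$; $\mathfrak m_S$ is the maximal ideal of $S$. For a profinite group $G$ and continuous $\bar\rho:G\to\mathrm{GL}_n(k)$, a lift to $S$ is a continuous $\rho:G\to\mathrm{GL}_n(S)$ reducing to $\bar\rho$; lifts are strictly equivalent if conjugate by an element of $I+M_n(\mathfrak m_S)$; $\mathrm{Def}_{\bar\rho}(S)$ is the set of strict equivalence classes $[\rho]$, a functor via $[\rho]\mapsto[\mathrm{GL}_n(f)\circ\rho]$. A lift $\rho$ to $R$ is universal if $f\mapsto[\mathrm{GL}_n(f)\circ\rho]$ is a natural isomorphism $\mathrm{Hom}_{\hat{\mathcal C}}(R,-)\to\mathrm{Def}_{\bar\rho}$. $\mathrm{SL}_n(R)$ carries the profinite topology $\varprojlim_j\mathrm{SL}_n(R/\mathfrak m_R^j)$. *)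

theory Defs
  imports "HOL-Algebra.Algebra" "HOL-Combinatorics.Permutations"
begin

primrec ideal_pow :: "('a, 'b) ring_scheme \<Rightarrow> 'a set \<Rightarrow> nat \<Rightarrow> 'a set" where
  "ideal_pow R I 0 = carrier R"
| "ideal_pow R I (Suc j) = ideal_prod R I (ideal_pow R I j)"

text \<open>R is I-adically complete (and separated): the canonical map R \<rightarrow> lim R/I^j is bijective,
  i.e. every compatible family (x_j mod I^j) comes from a unique element of R.\<close>
definition adic_complete :: "('a, 'b) ring_scheme \<Rightarrow> 'a set \<Rightarrow> bool" where
  "adic_complete R I \<longleftrightarrow>
     (\<forall>x. (\<forall>j. x j \<in> carrier R \<and> x (Suc j) \<ominus>\<^bsub>R\<^esub> x j \<in> ideal_pow R I j) \<longrightarrow>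
          (\<exists>!y. y \<in> carrier R \<and> (\<forall>j. y \<ominus>\<^bsub>R\<^esub> x j \<in> ideal_pow R I j)))"

text \<open>An object of C-hat: a complete noetherian local commutative ring S together with the
  identification of its residue field with k, given by a surjective ring homomorphism
  piS : S \<rightarrow> k whose kernel is the (unique) maximal ideal m_S.\<close>
definition CObj :: "'k ring \<Rightarrow> 'a ring \<Rightarrow> ('a \<Rightarrow> 'k) \<Rightarrow> bool" where
  "CObj K S piS \<longleftrightarrow>
     cring S \<and> noetherian_ring S \<and>
     piS \<in> ring_hom S K \<and> piS ` carrier S = carrier K \<and>
     (\<forall>I. maximalideal I S \<longrightarrow> I = a_kernel S K piS) \<and>
     adic_complete S (a_kernel S K piS)"

definition CHom :: "'k ring \<Rightarrow> 'a ring \<Rightarrow> ('a \<Rightarrow> 'k) \<Rightarrow> 'b ring \<Rightarrow> ('b \<Rightarrow> 'k) \<Rightarrow> ('a \<Rightarrow> 'b) set" where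
  "CHom K R piR S piS =
     {f. f \<in> ring_hom R S \<and> f \<in> extensional (carrier R) \<and>
         f ` a_kernel R K piR \<subseteq> a_kernel S K piS \<and>
         (\<forall>x\<in>carrier R. piS (f x) = piR x)}"

definition mat_carrier :: "('a, 'b) ring_scheme \<Rightarrow> nat \<Rightarrow> (nat \<Rightarrow> nat \<Rightarrow> 'a) set" where
  "mat_carrier S n = {A. (\<forall>i<n. \<forall>j<n. A i j \<in> carrier S) \<and>
                         (\<forall>i j. \<not> (i < n \<and> j < n) \<longrightarrow> A i j = \<zero>\<^bsub>S\<^esub>)}"

definition mat_mult :: "('a, 'b) ring_scheme \<Rightarrow> nat \<Rightarrow> (nat \<Rightarrow> nat \<Rightarrow> 'a) \<Rightarrow> (nat \<Rightarrow> nat \<Rightarrow> 'a) \<Rightarrow> (nat \<Rightarrow> nat \<Rightarrow> 'a)" where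
  "mat_mult S n A B = (\<lambda>i j. if i < n \<and> j < n
       then finsum S (\<lambda>l. A i l \<otimes>\<^bsub>S\<^esub> B l j) {..<n} else \<zero>\<^bsub>S\<^esub>)"

definition mat_one :: "('a, 'b) ring_scheme \<Rightarrow> nat \<Rightarrow> (nat \<Rightarrow> nat \<Rightarrow> 'a)" where
  "mat_one S n = (\<lambda>i j. if i < n \<and> j < n then (if i = j then \<one>\<^bsub>S\<^esub> else \<zero>\<^bsub>S\<^esub>) else \<zero>\<^bsub>S\<^esub>)"

definition mat_map :: "('c, 'd) ring_scheme \<Rightarrow> nat \<Rightarrow> ('a \<Rightarrow> 'c) \<Rightarrow> (nat \<Rightarrow> nat \<Rightarrow> 'a) \<Rightarrow> (nat \<Rightarrow> nat \<Rightarrow> 'c)" where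
  "mat_map T n f A = (\<lambda>i j. if i < n \<and> j < n then f (A i j) else \<zero>\<^bsub>T\<^esub>)"

definition mat_det :: "('a, 'b) ring_scheme \<Rightarrow> nat \<Rightarrow> (nat \<Rightarrow> nat \<Rightarrow> 'a) \<Rightarrow> 'a" where
  "mat_det S n A = finsum S
     (\<lambda>\<sigma>. (if evenperm \<sigma> then (\<lambda>x. x) else a_inv S) (finprod S (\<lambda>i. A i (\<sigma> i)) {..<n}))
     {\<sigma>. \<sigma> permutes {..<n}}"

definition GLn :: "('a, 'b) ring_scheme \<Rightarrow> nat \<Rightarrow> (nat \<Rightarrow> nat \<Rightarrow> 'a) set" where
  "GLn S n = {A \<in> mat_carrier S n. \<exists>B \<in> mat_carrier S n.
                 mat_mult S n A B = mat_one S n \<and> mat_mult S n B A = mat_one S n}"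

definition SLn :: "('a, 'b) ring_scheme \<Rightarrow> nat \<Rightarrow> (nat \<Rightarrow> nat \<Rightarrow> 'a) set" where
  "SLn R n = {A \<in> mat_carrier R n. mat_det R n A = \<one>\<^bsub>R\<^esub>}"

definition mat_cong :: "('a, 'b) ring_scheme \<Rightarrow> nat \<Rightarrow> 'a set \<Rightarrow> (nat \<Rightarrow> nat \<Rightarrow> 'a) \<Rightarrow> (nat \<Rightarrow> nat \<Rightarrow> 'a) \<Rightarrow> bool" where
  "mat_cong S n I A B \<longleftrightarrow> (\<forall>i<n. \<forall>j<n. A i j \<ominus>\<^bsub>S\<^esub> B i j \<in> I)"

text \<open>Continuity of rho : SL_n(R) \<rightarrow> GL_n(S), where SL_n(R) carries the profinite topology
  lim SL_n(R/m_R^i) (basic neighbourhoods of g: {h. h \<equiv> g mod m_R^i}) and GL_n(S) the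
  m_S-adic topology (basic neighbourhoods of A: {B. B \<equiv> A mod m_S^j}).\<close>
definition lift_continuous :: "'k ring \<Rightarrow> 'a ring \<Rightarrow> ('a \<Rightarrow> 'k) \<Rightarrow> nat \<Rightarrow> 'b ring \<Rightarrow> ('b \<Rightarrow> 'k)
     \<Rightarrow> ((nat \<Rightarrow> nat \<Rightarrow> 'a) \<Rightarrow> (nat \<Rightarrow> nat \<Rightarrow> 'b)) \<Rightarrow> bool" where
  "lift_continuous K R piR n S piS rho \<longleftrightarrow>
     (\<forall>g\<in>SLn R n. \<forall>j. \<exists>i. \<forall>h\<in>SLn R n.
        mat_cong R n (ideal_pow R (a_kernel R K piR) i) h g \<longrightarrow>
        mat_cong S n (ideal_pow S (a_kernel S K piS) j) (rho h) (rho g))"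

definition lifts :: "'k ring \<Rightarrow> 'a ring \<Rightarrow> ('a \<Rightarrow> 'k) \<Rightarrow> nat \<Rightarrow> 'b ring \<Rightarrow> ('b \<Rightarrow> 'k)
     \<Rightarrow> ((nat \<Rightarrow> nat \<Rightarrow> 'a) \<Rightarrow> (nat \<Rightarrow> nat \<Rightarrow> 'b)) set" where
  "lifts K R piR n S piS =
     {rho. rho \<in> extensional (SLn R n) \<and>
           (\<forall>g\<in>SLn R n. rho g \<in> GLn S n) \<and>
           (\<forall>g\<in>SLn R n. \<forall>h\<in>SLn R n. rho (mat_mult R n g h) = mat_mult S n (rho g) (rho h)) \<and>
           lift_continuous K R piR n S piS rho \<and>
           (\<forall>g\<in>SLn R n. mat_map K n piS (rho g) = mat_map K n piR g)}"

definition strict_equiv :: "'k ring \<Rightarrow> 'a ring \<Rightarrow> ('a \<Rightarrow> 'k) \<Rightarrow> nat \<Rightarrow> 'b ring \<Rightarrow> ('b \<Rightarrow> 'k)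
     \<Rightarrow> (((nat \<Rightarrow> nat \<Rightarrow> 'a) \<Rightarrow> (nat \<Rightarrow> nat \<Rightarrow> 'b)) \<times> ((nat \<Rightarrow> nat \<Rightarrow> 'a) \<Rightarrow> (nat \<Rightarrow> nat \<Rightarrow> 'b))) set" where
  "strict_equiv K R piR n S piS =
     {(rho, rho'). rho \<in> lifts K R piR n S piS \<and> rho' \<in> lifts K R piR n S piS \<and>
        (\<exists>P\<in>mat_carrier S n. \<exists>Q\<in>mat_carrier S n.
            mat_cong S n (a_kernel S K piS) P (mat_one S n) \<and>
            mat_mult S n P Q = mat_one S n \<and> mat_mult S n Q P = mat_one S n \<and>
            (\<forall>g\<in>SLn R n. rho' g = mat_mult S n (mat_mult S n P (rho g)) Q))}"

definition Def :: "'k ring \<Rightarrow> 'a ring \<Rightarrow> ('a \<Rightarrow> 'k) \<Rightarrow> nat \<Rightarrow> 'b ring \<Rightarrow> ('b \<Rightarrow> 'k)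
     \<Rightarrow> ((nat \<Rightarrow> nat \<Rightarrow> 'a) \<Rightarrow> (nat \<Rightarrow> nat \<Rightarrow> 'b)) set set" where
  "Def K R piR n S piS = lifts K R piR n S piS // strict_equiv K R piR n S piS"

end

theory Submission
  imports Defs
begin

text \<open>Let \<open>\<theta>\<close> be a lift of the residual representation to \<open>S\<close>, and write \<open>E i j r\<close> for the elementary matrices.
  Teichmueller lifts give elements of finite order prime to \<open>p\<close> in the diagonal torus; averaging over the
  cyclic groups they generate, \<open>\<theta>\<close> can be conjugated by some \<open>P\<close> reducing to \<open>1\<close> so that their images are diagonal.

  If some unit \<open>a\<close> of \<open>k\<close> has \<open>a\<^sup>3 \<noteq> 1\<close>, then \<open>diag(a, a, a\<^sup>-\<^sup>2)\<close> commutes with \<open>E i j r\<close>, \<open>{i,j} = {0,1}\<close>, and makes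
  its image block diagonal; commuting with \<open>E i k 1\<close> and \<open>E k j 1\<close> forces the image to be a scalar matrix plus
  a multiple of the matrix unit \<open>(i,j)\<close>. Otherwise \<open>k\<close> has four elements; then the weight components of the images
  of \<open>E i k 1\<close> and \<open>E k j 1\<close> under \<open>diag(1, a, a\<^sup>2)\<close>, where \<open>a\<close> is a primitive cube root of unity, commute with
  the image of \<open>E i j r\<close> and force the same conclusion.

  The commutator relation \<open>[E i k r, E k j s] = E i j (r s)\<close> then shows that the scalars are \<open>1\<close> and, after a
  further diagonal conjugation, that all root subgroups are mapped by one and the same ring homomorphism
  \<open>R \<rightarrow> S\<close>. As \<open>R\<close> is local, elementary matrices generate \<open>SL(3, R)\<close>.\<close>

section \<open>Matrices over commutative rings\<close>

text \<open>Only conjugation by matrices reducing to 1 preserves strict equivalence. Averaging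
  provides such matrices because the number of terms, \<open>card (carrier K) - 1\<close>, is -1 in
  \<open>K\<close> and hence a unit of \<open>S\<close>. The torus must contribute an element that
  is not residually trivial, so \<open>K\<close> needs a unit other than 1; this is how the field
  with two elements is excluded.

  The obstacle is the field with four elements: there every unit a satisfies a^3 = 1, so diag(a, a,
  a^-2) is scalar and separates no coordinates. What remains is an element of order three, whose
  nontrivial eigenspaces on matrices each mix three roots; commutation with whole root subgroups has
  to replace the block structure.

  Commutation alone cannot tell an elementary matrix from a scalar multiple of it. A commutator is
  insensitive to scalars, and every root (i,j) is the sum of the roots (i,k) and (k,j), so all
  scalars can be removed.

  Uniqueness of the homomorphism: if P reduces to 1 and conjugates the lift of f into that of g,
  then P intertwines the elementary matrices of f r and g r, and a single entry, read for r and for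
  1, gives f r = g r.\<close>

definition mat_ring :: "('a, 'b) ring_scheme \<Rightarrow> nat \<Rightarrow> (nat \<Rightarrow> nat \<Rightarrow> 'a) ring" where
  "mat_ring R n = \<lparr>carrier = mat_carrier R n, monoid.mult = mat_mult R n, one = mat_one R n,
     ring.zero = (\<lambda>_ _. \<zero>\<^bsub>R\<^esub>), ring.add = (\<lambda>A B i j. A i j \<oplus>\<^bsub>R\<^esub> B i j)\<rparr>"

definition mat_diag :: "('a, 'b) ring_scheme \<Rightarrow> nat \<Rightarrow> (nat \<Rightarrow> 'a) \<Rightarrow> nat \<Rightarrow> nat \<Rightarrow> 'a" where
  "mat_diag R n d = (\<lambda>i j. if i < n \<and> j < n \<and> i = j then d i else \<zero>\<^bsub>R\<^esub>)"

text \<open>The diagonal is tested first, so \<open>i = j\<close> yields the identity matrix, not a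
  matrix with \<open>r\<close> on the diagonal.\<close>

definition mat_elem :: "('a, 'b) ring_scheme \<Rightarrow> nat \<Rightarrow> nat \<Rightarrow> nat \<Rightarrow> 'a \<Rightarrow> nat \<Rightarrow> nat \<Rightarrow> 'a" where
  "mat_elem R n i j r = (\<lambda>a b. if a < n \<and> b < n
     then (if a = b then \<one>\<^bsub>R\<^esub> else if a = i \<and> b = j then r else \<zero>\<^bsub>R\<^esub>) else \<zero>\<^bsub>R\<^esub>)"

lemma mat_ring_simps [simp]:
  "carrier (mat_ring R n) = mat_carrier R n"
  "monoid.mult (mat_ring R n) = mat_mult R n"
  "monoid.one (mat_ring R n) = mat_one R n"
  "ring.zero (mat_ring R n) = (\<lambda>_ _. \<zero>\<^bsub>R\<^esub>)"
  "ring.add (mat_ring R n) = (\<lambda>A B i j. A i j \<oplus>\<^bsub>R\<^esub> B i j)"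
  by (simp_all add: mat_ring_def)

lemma mat_carrierI:
  "(\<And>i j. i < n \<Longrightarrow> j < n \<Longrightarrow> A i j \<in> carrier R) \<Longrightarrow>
   (\<And>i j. \<not> (i < n \<and> j < n) \<Longrightarrow> A i j = \<zero>\<^bsub>R\<^esub>) \<Longrightarrow> A \<in> mat_carrier R n"
  by (auto simp: mat_carrier_def)

lemma mat_eqI:
  assumes "A \<in> mat_carrier R n" "B \<in> mat_carrier R n"
    and "\<And>i j. i < n \<Longrightarrow> j < n \<Longrightarrow> A i j = B i j"
  shows "A = B"
proof (intro ext)
  fix i j show "A i j = B i j"
    using assms by (cases "i < n \<and> j < n") (auto simp: mat_carrier_def)
qed

lemma lessThan_3: "{..<3} = {0, 1, 2::nat}" by auto

lemma less_3E:
  assumes "(i::nat) < 3"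
  obtains "i = 0" | "i = 1" | "i = 2"
  using assms by linarith

lemma third_index:
  assumes "i < 3" "j < 3" "(i::nat) \<noteq> j"
  obtains k where "k < 3" "k \<noteq> i" "k \<noteq> j" "{..<3} = {i, j, k}"
proof -
  \<comment> \<open>Distinct indices below 3 have sum at most 3, so the truncated subtraction is
    exact: the third index completes the sum 0 + 1 + 2.\<close>
  have "3 - i - j < 3" "3 - i - j \<noteq> i" "3 - i - j \<noteq> j"
    using assms by presburger+
  moreover from this have "{..<3} = {i, j, 3 - i - j}"
    using assms by auto
  ultimately show ?thesis using that by blast
qed

context cring
begin

lemma mat_entry_closed: "A \<in> mat_carrier R n \<Longrightarrow> A i j \<in> carrier R"
  by (cases "i < n \<and> j < n") (auto simp: mat_carrier_def)

lemma mat_mult_closed [simp, intro]: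
  "A \<in> mat_carrier R n \<Longrightarrow> B \<in> mat_carrier R n \<Longrightarrow> mat_mult R n A B \<in> mat_carrier R n"
  by (rule mat_carrierI) (auto simp: mat_mult_def mat_entry_closed intro!: finsum_closed)

lemma mat_one_closed [simp, intro]: "mat_one R n \<in> mat_carrier R n"
  by (rule mat_carrierI) (auto simp: mat_one_def)

lemma mat_diag_closed [simp, intro]:
  "(\<And>i. i < n \<Longrightarrow> d i \<in> carrier R) \<Longrightarrow> mat_diag R n d \<in> mat_carrier R n"
  by (rule mat_carrierI) (auto simp: mat_diag_def)

lemma mat_elem_closed [simp, intro]: "r \<in> carrier R \<Longrightarrow> mat_elem R n i j r \<in> mat_carrier R n"
  by (rule mat_carrierI) (auto simp: mat_elem_def)

text \<open>Expanding along any enumeration of the indices lets later entry computations treat a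
  root \<open>(i, j)\<close> with its third index \<open>k\<close> uniformly instead of going
  through six concrete pairs.\<close>

lemma mat_mult_entry_gen:
  assumes "A \<in> mat_carrier R 3" "B \<in> mat_carrier R 3" "a < 3" "b < 3"
    and "{..<3} = {i, j, k}" "i \<noteq> j" "i \<noteq> k" "j \<noteq> k"
  shows "mat_mult R 3 A B a b = A a i \<otimes> B i b \<oplus> (A a j \<otimes> B j b \<oplus> A a k \<otimes> B k b)"
proof -
  note [simp] = assms(1,2)[THEN mat_entry_closed]
  then show ?thesis
    unfolding mat_mult_def assms(5) using assms by (subst finsum_insert; simp)+
qed

lemma mat_mult_entry:
  assumes "A \<in> mat_carrier R 3" "B \<in> mat_carrier R 3" "a < 3" "b < 3"
  shows "mat_mult R 3 A B a b = A a 0 \<otimes> B 0 b \<oplus> (A a 1 \<otimes> B 1 b \<oplus> A a 2 \<otimes> B 2 b)"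
  by (rule mat_mult_entry_gen[OF assms lessThan_3]) auto

lemma mat_mult_assoc:
  assumes "A \<in> mat_carrier R 3" "B \<in> mat_carrier R 3" "C \<in> mat_carrier R 3"
  shows "mat_mult R 3 (mat_mult R 3 A B) C = mat_mult R 3 A (mat_mult R 3 B C)"
proof (rule mat_eqI)
  fix i j :: nat assume ij: "i < 3" "j < 3"
  note [simp] = assms[THEN mat_entry_closed]
  have distr: "(a\<^sub>0 \<otimes> b\<^sub>0 \<oplus> (a\<^sub>1 \<otimes> b\<^sub>1 \<oplus> a\<^sub>2 \<otimes> b\<^sub>2)) \<otimes> c =
      a\<^sub>0 \<otimes> (b\<^sub>0 \<otimes> c) \<oplus> (a\<^sub>1 \<otimes> (b\<^sub>1 \<otimes> c) \<oplus> a\<^sub>2 \<otimes> (b\<^sub>2 \<otimes> c))"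
    if "a\<^sub>0 \<in> carrier R" "a\<^sub>1 \<in> carrier R" "a\<^sub>2 \<in> carrier R"
      "b\<^sub>0 \<in> carrier R" "b\<^sub>1 \<in> carrier R" "b\<^sub>2 \<in> carrier R" "c \<in> carrier R"
    for a\<^sub>0 a\<^sub>1 a\<^sub>2 b\<^sub>0 b\<^sub>1 b\<^sub>2 c
    using that by (simp add: l_distr m_assoc)
  \<comment> \<open>This is the interchange of the two summations.\<close>
  have swap: "x\<^sub>0 \<oplus> (x\<^sub>1 \<oplus> x\<^sub>2) \<oplus> (y\<^sub>0 \<oplus> (y\<^sub>1 \<oplus> y\<^sub>2) \<oplus> (z\<^sub>0 \<oplus> (z\<^sub>1 \<oplus> z\<^sub>2))) =
      x\<^sub>0 \<oplus> (y\<^sub>0 \<oplus> z\<^sub>0) \<oplus> (x\<^sub>1 \<oplus> (y\<^sub>1 \<oplus> z\<^sub>1) \<oplus> (x\<^sub>2 \<oplus> (y\<^sub>2 \<oplus> z\<^sub>2)))"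
    if "x\<^sub>0 \<in> carrier R" "x\<^sub>1 \<in> carrier R" "x\<^sub>2 \<in> carrier R" "y\<^sub>0 \<in> carrier R" "y\<^sub>1 \<in> carrier R"
      "y\<^sub>2 \<in> carrier R" "z\<^sub>0 \<in> carrier R" "z\<^sub>1 \<in> carrier R" "z\<^sub>2 \<in> carrier R"
    for x\<^sub>0 x\<^sub>1 x\<^sub>2 y\<^sub>0 y\<^sub>1 y\<^sub>2 z\<^sub>0 z\<^sub>1 z\<^sub>2
    using that by (simp add: a_ac)
  show "mat_mult R 3 (mat_mult R 3 A B) C i j = mat_mult R 3 A (mat_mult R 3 B C) i j"
    using assms ij by (simp add: mat_mult_entry distr r_distr del: One_nat_def) (rule swap; simp)
qed (use assms in auto)

lemma mat_diag_mult_entry: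
  assumes "\<And>i. i < 3 \<Longrightarrow> d i \<in> carrier R" "A \<in> mat_carrier R 3" "i < 3" "j < 3"
  shows "mat_mult R 3 (mat_diag R 3 d) A i j = d i \<otimes> A i j"
    and "mat_mult R 3 A (mat_diag R 3 d) i j = A i j \<otimes> d j"
proof -
  note [simp] = mat_entry_closed[OF assms(2)]
  show "mat_mult R 3 (mat_diag R 3 d) A i j = d i \<otimes> A i j"
    using assms(3) by (rule less_3E; use assms in \<open>simp add: mat_mult_entry\<close>; simp add: mat_diag_def assms(1))
  show "mat_mult R 3 A (mat_diag R 3 d) i j = A i j \<otimes> d j"
    using assms(4) by (rule less_3E; use assms in \<open>simp add: mat_mult_entry\<close>; simp add: mat_diag_def assms(1))
qed

lemma ring_mat_ring: "ring (mat_ring R 3)"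
proof (rule ringI)
  show "abelian_group (mat_ring R 3)"
  proof (rule abelian_groupI)
    fix A assume A: "A \<in> carrier (mat_ring R 3)"
    show "\<exists>B\<in>carrier (mat_ring R 3). B \<oplus>\<^bsub>mat_ring R 3\<^esub> A = \<zero>\<^bsub>mat_ring R 3\<^esub>"
    proof (intro bexI[of _ "\<lambda>i j. \<ominus> A i j"])
      have "\<ominus> A i j \<oplus> A i j = \<zero>" for i j
        using A by (cases "i < 3 \<and> j < 3") (auto simp: l_neg mat_carrier_def)
      then show "(\<lambda>i j. \<ominus> A i j) \<oplus>\<^bsub>mat_ring R 3\<^esub> A = \<zero>\<^bsub>mat_ring R 3\<^esub>" by simp
    qed (use A in \<open>auto simp: mat_carrier_def\<close>)
  next
    fix A B C
    assume "A \<in> carrier (mat_ring R 3)" "B \<in> carrier (mat_ring R 3)" "C \<in> carrier (mat_ring R 3)"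
    then have *: "A i j \<in> carrier R" "B i j \<in> carrier R" "C i j \<in> carrier R" for i j
      by (cases "i < 3 \<and> j < 3"; auto simp: mat_carrier_def)+
    show "A \<oplus>\<^bsub>mat_ring R 3\<^esub> B \<oplus>\<^bsub>mat_ring R 3\<^esub> C = A \<oplus>\<^bsub>mat_ring R 3\<^esub> (B \<oplus>\<^bsub>mat_ring R 3\<^esub> C)"
      using * by (simp add: a_assoc)
    show "A \<oplus>\<^bsub>mat_ring R 3\<^esub> B = B \<oplus>\<^bsub>mat_ring R 3\<^esub> A"
      using * by (simp add: a_comm)
    show "\<zero>\<^bsub>mat_ring R 3\<^esub> \<oplus>\<^bsub>mat_ring R 3\<^esub> A = A"
      using * by simp
  qed (auto simp: mat_carrier_def)
  show "monoid (mat_ring R 3)"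
  proof (rule monoidI)
    fix A assume "A \<in> carrier (mat_ring R 3)"
    then have A: "A \<in> mat_carrier R 3" by simp
    note [simp] = mat_entry_closed[OF A]
    have one: "mat_one R 3 = mat_diag R 3 (\<lambda>_. \<one>)" by (auto simp: mat_one_def mat_diag_def fun_eq_iff)
    show "\<one>\<^bsub>mat_ring R 3\<^esub> \<otimes>\<^bsub>mat_ring R 3\<^esub> A = A" "A \<otimes>\<^bsub>mat_ring R 3\<^esub> \<one>\<^bsub>mat_ring R 3\<^esub> = A"
      unfolding mat_ring_simps one using A
      by (intro mat_eqI[of _ R 3]; simp add: mat_diag_mult_entry)+
  qed (simp_all add: mat_mult_assoc)
next
  fix A B C
  assume "A \<in> carrier (mat_ring R 3)" "B \<in> carrier (mat_ring R 3)" "C \<in> carrier (mat_ring R 3)"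
  then have *: "A \<in> mat_carrier R 3" "B \<in> mat_carrier R 3" "C \<in> mat_carrier R 3"
     "(\<lambda>i j. A i j \<oplus> B i j) \<in> mat_carrier R 3" by (auto simp: mat_carrier_def)
  note [simp] = *(1-3)[THEN mat_entry_closed]
  have **: "(\<lambda>i j. mat_mult R 3 A C i j \<oplus> mat_mult R 3 B C i j) \<in> mat_carrier R 3"
    "(\<lambda>i j. mat_mult R 3 C A i j \<oplus> mat_mult R 3 C B i j) \<in> mat_carrier R 3"
    using * mat_mult_closed by (auto simp: mat_carrier_def)
  show "(A \<oplus>\<^bsub>mat_ring R 3\<^esub> B) \<otimes>\<^bsub>mat_ring R 3\<^esub> C = A \<otimes>\<^bsub>mat_ring R 3\<^esub> C \<oplus>\<^bsub>mat_ring R 3\<^esub> B \<otimes>\<^bsub>mat_ring R 3\<^esub> C"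
    unfolding mat_ring_simps
    by (rule mat_eqI[OF mat_mult_closed[OF *(4,3)] **(1)])
      (simp add: mat_mult_entry * del: One_nat_def, simp add: * l_distr a_ac)
  show "C \<otimes>\<^bsub>mat_ring R 3\<^esub> (A \<oplus>\<^bsub>mat_ring R 3\<^esub> B) = C \<otimes>\<^bsub>mat_ring R 3\<^esub> A \<oplus>\<^bsub>mat_ring R 3\<^esub> C \<otimes>\<^bsub>mat_ring R 3\<^esub> B"
    unfolding mat_ring_simps
    by (rule mat_eqI[OF mat_mult_closed[OF *(3,4)] **(2)])
      (simp add: mat_mult_entry * del: One_nat_def, simp add: * r_distr a_ac)
qed

lemma add_pow_mat_entry:
  fixes m :: nat
  shows "add_pow (mat_ring R 3) m A i j = add_pow R m (A i j)"
  by (induct m) (simp_all add: add_pow_def)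

lemma mat_elem_mult_entry:
  assumes "r \<in> carrier R" "A \<in> mat_carrier R 3" "a < 3" "b < 3" "i < 3" "j < 3" "i \<noteq> j"
  shows "mat_mult R 3 (mat_elem R 3 i j r) A a b = (if a = i then A a b \<oplus> r \<otimes> A j b else A a b)"
    and "mat_mult R 3 A (mat_elem R 3 i j r) a b = (if b = j then A a b \<oplus> A a i \<otimes> r else A a b)"
proof -
  obtain k where k: "k < 3" "k \<noteq> i" "k \<noteq> j" "{..<3} = {i, j, k}"
    using third_index assms by metis
  have a: "a = i \<or> a = j \<or> a = k" and b: "b = i \<or> b = j \<or> b = k"
    using assms(3,4) k(4) by (metis insertE lessThan_iff singletonD)+
  note entry = mat_mult_entry_gen[OF _ _ _ _ k(4)] and [simp] = mat_entry_closed[OF assms(2)]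
  show "mat_mult R 3 (mat_elem R 3 i j r) A a b = (if a = i then A a b \<oplus> r \<otimes> A j b else A a b)"
    using a assms k by (elim disjE; simp add: entry; simp add: mat_elem_def)
  show "mat_mult R 3 A (mat_elem R 3 i j r) a b = (if b = j then A a b \<oplus> A a i \<otimes> r else A a b)"
    using b assms k by (elim disjE; simp add: entry; simp add: mat_elem_def a_comm)
qed

end

section \<open>Determinants of 3 by 3 matrices\<close>

text \<open>A permutation of \<open>insert a T\<close> is a transposition moving \<open>a\<close>
  after a permutation of \<open>T\<close>; adding 1 and then 0 to the set {2} produces the
  list.\<close>

lemma permutes_lessThan_3:
  "{\<sigma>. \<sigma> permutes {..<3::nat}} =
     {id, transpose 1 2, transpose 0 1, transpose 0 1 \<circ> transpose 1 2,
      transpose 0 2, transpose 0 2 \<circ> transpose 1 2}"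
proof -
  have perms: "{\<sigma>. \<sigma> permutes insert a T} =
      (\<Union>b\<in>insert a T. (\<lambda>p. transpose a b \<circ> p) ` {\<sigma>. \<sigma> permutes T})"
    for a :: nat and T
  proof -
    have "(\<lambda>(b, p). f b p) ` {(b, p). b \<in> A \<and> p \<in> B} = (\<Union>b\<in>A. f b ` B)"
      for f :: "nat \<Rightarrow> (nat \<Rightarrow> nat) \<Rightarrow> nat \<Rightarrow> nat" and A B by force
    then show ?thesis unfolding permutes_insert .
  qed
  have "{\<sigma>. \<sigma> permutes {2::nat}} = {id}" by auto
  then have "{\<sigma>. \<sigma> permutes {1, 2::nat}} = {id, transpose 1 2}"
    unfolding perms[of 1] by (simp add: insert_commute)
  then show ?thesis
    unfolding lessThan_3 perms[of 0] by (simp add: insert_commute)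
qed

context cring
begin

text \<open>The scalar triple product u . (v x w), that is, the determinant with rows
  \<open>u\<close>, \<open>v\<close>, \<open>w\<close>. Its cyclic symmetry replaces separate
  arguments for each row.\<close>

definition triple :: "(nat \<Rightarrow> 'a) \<Rightarrow> (nat \<Rightarrow> 'a) \<Rightarrow> (nat \<Rightarrow> 'a) \<Rightarrow> 'a" where
  "triple u v w = u 0 \<otimes> (v 1 \<otimes> w 2 \<ominus> v 2 \<otimes> w 1) \<oplus>
     (u 1 \<otimes> (v 2 \<otimes> w 0 \<ominus> v 0 \<otimes> w 2) \<oplus> u 2 \<otimes> (v 0 \<otimes> w 1 \<ominus> v 1 \<otimes> w 0))"

lemma triple_rules:
  assumes "\<And>i. u i \<in> carrier R" "\<And>i. v i \<in> carrier R" "\<And>i. w i \<in> carrier R"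
  shows "triple u v w \<in> carrier R"
    and "triple v w u = triple u v w"
    and "r \<in> carrier R \<Longrightarrow> triple (\<lambda>i. u i \<oplus> r \<otimes> v i) v w = triple u v w"
    and "r \<in> carrier R \<Longrightarrow> triple (\<lambda>i. u i \<oplus> r \<otimes> w i) v w = triple u v w"
proof -
  have cyc: "d \<otimes> (h \<otimes> c \<ominus> i \<otimes> b) \<oplus> (e \<otimes> (i \<otimes> a \<ominus> g \<otimes> c) \<oplus> f \<otimes> (g \<otimes> b \<ominus> h \<otimes> a))
      = a \<otimes> (e \<otimes> i \<ominus> f \<otimes> h) \<oplus> (b \<otimes> (f \<otimes> g \<ominus> d \<otimes> i) \<oplus> c \<otimes> (d \<otimes> h \<ominus> e \<otimes> g))"
    if "a \<in> carrier R" "b \<in> carrier R" "c \<in> carrier R" "d \<in> carrier R" "e \<in> carrier R"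
      "f \<in> carrier R" "g \<in> carrier R" "h \<in> carrier R" "i \<in> carrier R" for a b c d e f g h i
    using that by algebra+
  have row: "(a \<oplus> r \<otimes> d) \<otimes> (e \<otimes> i \<ominus> f \<otimes> h) \<oplus> ((b \<oplus> r \<otimes> e) \<otimes> (f \<otimes> g \<ominus> d \<otimes> i) \<oplus> (c \<oplus> r \<otimes> f) \<otimes> (d \<otimes> h \<ominus> e \<otimes> g))
      = a \<otimes> (e \<otimes> i \<ominus> f \<otimes> h) \<oplus> (b \<otimes> (f \<otimes> g \<ominus> d \<otimes> i) \<oplus> c \<otimes> (d \<otimes> h \<ominus> e \<otimes> g))"
    "(a \<oplus> r \<otimes> g) \<otimes> (e \<otimes> i \<ominus> f \<otimes> h) \<oplus> ((b \<oplus> r \<otimes> h) \<otimes> (f \<otimes> g \<ominus> d \<otimes> i) \<oplus> (c \<oplus> r \<otimes> i) \<otimes> (d \<otimes> h \<ominus> e \<otimes> g))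
      = a \<otimes> (e \<otimes> i \<ominus> f \<otimes> h) \<oplus> (b \<otimes> (f \<otimes> g \<ominus> d \<otimes> i) \<oplus> c \<otimes> (d \<otimes> h \<ominus> e \<otimes> g))"
    if "a \<in> carrier R" "b \<in> carrier R" "c \<in> carrier R" "d \<in> carrier R" "e \<in> carrier R"
      "f \<in> carrier R" "g \<in> carrier R" "h \<in> carrier R" "i \<in> carrier R" "r \<in> carrier R" for a b c d e f g h i
    using that by algebra+
  show "triple u v w \<in> carrier R" using assms by (simp add: triple_def)
  show "triple v w u = triple u v w"
    unfolding triple_def using assms by (intro cyc)
  show "triple (\<lambda>i. u i \<oplus> r \<otimes> v i) v w = triple u v w"
    "triple (\<lambda>i. u i \<oplus> r \<otimes> w i) v w = triple u v w" if "r \<in> carrier R"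
    unfolding triple_def using assms that row by simp_all
qed

text \<open>Cyclic symmetry moves the altered row to the front, where \<open>triple_rules\<close>
  applies.\<close>

lemma triple_add_row:
  assumes "\<And>i. u i \<in> carrier R" "\<And>i. v i \<in> carrier R" "\<And>i. w i \<in> carrier R" "r \<in> carrier R"
  shows "triple u (\<lambda>i. v i \<oplus> r \<otimes> u i) w = triple u v w"
    and "triple u (\<lambda>i. v i \<oplus> r \<otimes> w i) w = triple u v w"
    and "triple u v (\<lambda>i. w i \<oplus> r \<otimes> u i) = triple u v w"
    and "triple u v (\<lambda>i. w i \<oplus> r \<otimes> v i) = triple u v w"
proof -
  have rot: "triple x y z = triple y z x"
    if "\<And>i. x i \<in> carrier R" "\<And>i. y i \<in> carrier R" "\<And>i. z i \<in> carrier R" for x y z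
    by (rule triple_rules(2)[symmetric]) fact+
  have "triple u x w = triple x w u" if "\<And>i. x i \<in> carrier R" for x
    by (rule rot) fact+
  then show "triple u (\<lambda>i. v i \<oplus> r \<otimes> u i) w = triple u v w"
    "triple u (\<lambda>i. v i \<oplus> r \<otimes> w i) w = triple u v w"
    using assms by (simp_all add: triple_rules(3,4))
  have "triple u v x = triple x u v" if "\<And>i. x i \<in> carrier R" for x
    by (rule triple_rules(2)) fact+
  then show "triple u v (\<lambda>i. w i \<oplus> r \<otimes> u i) = triple u v w"
    "triple u v (\<lambda>i. w i \<oplus> r \<otimes> v i) = triple u v w"
    using assms by (simp_all add: triple_rules(3,4))
qed

lemma triple_zero:
  assumes "\<And>i. u i \<in> carrier R" "\<And>i. w i \<in> carrier R"
  shows "triple u u w = \<zero>" and "triple u w u = \<zero>"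
proof -
  have zero: "a \<otimes> (b \<otimes> f \<ominus> c \<otimes> e) \<oplus> (b \<otimes> (c \<otimes> d \<ominus> a \<otimes> f) \<oplus> c \<otimes> (a \<otimes> e \<ominus> b \<otimes> d)) = \<zero>"
    "a \<otimes> (e \<otimes> c \<ominus> f \<otimes> b) \<oplus> (b \<otimes> (f \<otimes> a \<ominus> d \<otimes> c) \<oplus> c \<otimes> (d \<otimes> b \<ominus> e \<otimes> a)) = \<zero>"
    if "a \<in> carrier R" "b \<in> carrier R" "c \<in> carrier R" "d \<in> carrier R" "e \<in> carrier R"
      "f \<in> carrier R" for a b c d e f
    using that by algebra+
  show "triple u u w = \<zero>" "triple u w u = \<zero>"
    unfolding triple_def using assms by (intro zero; simp)+
qed

text \<open>Gives access to columns: it serves the left adjugate identity and the search for a unit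
  in the first column.\<close>

lemma triple_transpose:
  assumes "\<And>i j. B i j \<in> carrier R"
  shows "triple (\<lambda>j. B j 0) (\<lambda>j. B j 1) (\<lambda>j. B j 2) = triple (B 0) (B 1) (B 2)"
proof -
  have transp: "a \<otimes> (e \<otimes> i \<ominus> h \<otimes> f) \<oplus> (d \<otimes> (h \<otimes> c \<ominus> b \<otimes> i) \<oplus> g \<otimes> (b \<otimes> f \<ominus> e \<otimes> c))
      = a \<otimes> (e \<otimes> i \<ominus> f \<otimes> h) \<oplus> (b \<otimes> (f \<otimes> g \<ominus> d \<otimes> i) \<oplus> c \<otimes> (d \<otimes> h \<ominus> e \<otimes> g))"
    if "a \<in> carrier R" "b \<in> carrier R" "c \<in> carrier R" "d \<in> carrier R" "e \<in> carrier R"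
      "f \<in> carrier R" "g \<in> carrier R" "h \<in> carrier R" "i \<in> carrier R" for a b c d e f g h i
    using that by algebra
  show ?thesis
    unfolding triple_def by (rule transp) (rule assms)+
qed

lemma mat_det_3:
  assumes A: "A \<in> mat_carrier R 3"
  shows "mat_det R 3 A =
triple (A 0) (A 1) (A 2)"
proof -
  note [simp] = mat_entry_closed[OF A]
  have prod: "finprod R (\<lambda>i. A i (\<sigma> i)) {..<3} = A 0 (\<sigma> 0) \<otimes> (A 1 (\<sigma> 1) \<otimes> A 2 (\<sigma> 2))" for \<sigma>
    unfolding lessThan_3 by simp
  have neq: "id \<noteq> transpose 1 (2::nat)" "id \<noteq> transpose 0 (1::nat)" "id \<noteq> transpose 0 (2::nat)"
    "id \<noteq> transpose 0 1 \<circ> transpose 1 (2::nat)" "id \<noteq> transpose 0 2 \<circ> transpose 1 (2::nat)"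
    "transpose 1 (2::nat) \<noteq> transpose 0 1" "transpose 1 (2::nat) \<noteq> transpose 0 1 \<circ> transpose 1 2"
    "transpose 1 (2::nat) \<noteq> transpose 0 2" "transpose 1 (2::nat) \<noteq> transpose 0 2 \<circ> transpose 1 2"
    "transpose 0 (1::nat) \<noteq> transpose 0 1 \<circ> transpose 1 2" "transpose 0 (1::nat) \<noteq> transpose 0 2"
    "transpose 0 (1::nat) \<noteq> transpose 0 2 \<circ> transpose 1 2"
    "transpose 0 1 \<circ> transpose 1 (2::nat) \<noteq> transpose 0 2"
    "transpose 0 1 \<circ> transpose 1 (2::nat) \<noteq> transpose 0 2 \<circ> transpose 1 2"
    "transpose 0 (2::nat) \<noteq> transpose 0 2 \<circ> transpose 1 2"
    by (auto simp: fun_eq_iff transpose_def intro: exI[of _ 0] exI[of _ 1] exI[of _ 2])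
  have even: "\<not> evenperm (transpose 1 (2::nat))" "\<not> evenperm (transpose 0 (1::nat))"
    "\<not> evenperm (transpose 0 (2::nat))" "evenperm (transpose 0 1 \<circ> transpose 1 (2::nat))"
    "evenperm (transpose 0 2 \<circ> transpose 1 (2::nat))"
    by (simp_all add: evenperm_comp evenperm_swap permutation_swap_id)
  show ?thesis
    unfolding triple_def mat_det_def permutes_lessThan_3 prod using neq even
    by (simp add: transpose_def r_distr minus_eq r_minus a_ac m_ac del: One_nat_def)
qed

lemma mat_det_elem_mult:
  assumes "r \<in> carrier R" "A \<in> mat_carrier R 3" "i < 3" "j < 3" "i \<noteq> j"
  shows "mat_det R 3 (mat_mult R 3 (mat_elem R 3 i j r) A) = mat_det R 3 A"
proof -
  note [simp] = mat_entry_closed[OF assms(2)]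
  have closed: "mat_mult R 3 (mat_elem R 3 i j r) A \<in> mat_carrier R 3" using assms by blast
  \<comment> \<open>Rows are functions on all natural numbers, so the columns beyond 2 have to be
    compared as well; there everything is zero.\<close>
  have row: "mat_mult R 3 (mat_elem R 3 i j r) A a = (if a = i then (\<lambda>b. A i b \<oplus> r \<otimes> A j b) else A a)"
    if "a < 3" for a
  proof
    fix b show "mat_mult R 3 (mat_elem R 3 i j r) A a b = (if a = i then (\<lambda>b. A i b \<oplus> r \<otimes> A j b) else A a) b"
    proof (cases "b < 3")
      case True then show ?thesis using that assms by (simp add: mat_elem_mult_entry)
    next
      case False
      then have "A a b = \<zero>" for a using assms(2) by (simp add: mat_carrier_def)
      then show ?thesis using False assms(1) by (simp add: mat_mult_def)
    qed
  qed
  show ?thesis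
    unfolding mat_det_3[OF closed] mat_det_3[OF assms(2)]
    using assms(3-5) assms(1)
    unfolding One_nat_def row[of 0, simplified] row[of 1, simplified] row[of 2, simplified]
    by (elim less_3E) (simp_all add: triple_rules(3,4) triple_add_row)
qed

lemma mat_det_diag:
  assumes "\<And>i. i < 3 \<Longrightarrow> d i \<in> carrier R"
  shows "mat_det R 3 (mat_diag R 3 d) = d 0 \<otimes> (d 1 \<otimes> d 2)"
  using assms by (simp add: mat_det_3) (simp add: triple_def mat_diag_def minus_eq)

lemma mat_elem_in_SLn:
  assumes "r \<in> carrier R" "i < 3" "j < 3" "i \<noteq> j"
  shows "mat_elem R 3 i j r \<in> SLn R 3"
proof -
  have one: "mat_one R 3 = mat_diag R 3 (\<lambda>_. \<one>)"
    by (auto simp: mat_one_def mat_diag_def fun_eq_iff)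
  interpret M: ring "mat_ring R 3" by (rule ring_mat_ring)
  have "mat_mult R 3 (mat_elem R 3 i j r) (mat_one R 3) = mat_elem R 3 i j r"
    using M.r_one assms(1) by simp
  moreover have "mat_det R 3 (mat_one R 3) = \<one>"
    unfolding one by (simp add: mat_det_diag)
  ultimately show ?thesis
    using mat_det_elem_mult[of r "mat_one R 3" i j] assms by (simp add: SLn_def)
qed

text \<open>The adjugate. In size three, reading the indices cyclically absorbs the signs of the
  cofactors; the order \<open>j i\<close> of the arguments is the transposition.\<close>

definition mat_adj :: "(nat \<Rightarrow> nat \<Rightarrow> 'a) \<Rightarrow> nat \<Rightarrow> nat \<Rightarrow> 'a" where
  "mat_adj A = (\<lambda>j i. if i < 3 \<and> j < 3
     then A ((i + 1) mod 3) ((j + 1) mod 3) \<otimes> A ((i + 2) mod 3) ((j + 2) mod 3)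
        \<ominus> A ((i + 1) mod 3) ((j + 2) mod 3) \<otimes> A ((i + 2) mod 3) ((j + 1) mod 3)
     else \<zero>)"

text \<open>An entry of the product is a triple product of one row with the two rows cyclically
  following another. On the diagonal this is the determinant up to rotation, off the diagonal two
  rows coincide. The other product is treated in the same way by columns.\<close>

lemma mat_adj:
  assumes "A \<in> mat_carrier R 3"
  shows "mat_adj A \<in> mat_carrier R 3"
    and "mat_mult R 3 A (mat_adj A) = mat_diag R 3 (\<lambda>_. mat_det R 3 A)"
    and "mat_mult R 3 (mat_adj A) A = mat_diag R 3 (\<lambda>_. mat_det R 3 A)"
proof -
  note [simp] = mat_entry_closed[OF assms]
  show adj: "mat_adj A \<in> mat_carrier R 3"
    by (rule mat_carrierI) (auto simp: mat_adj_def)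
  define p q :: "nat \<Rightarrow> nat" where "p j = (j + 1) mod 3" and "q j = (j + 2) mod 3" for j
  have md: "p 0 = 1" "p 1 = 2" "p 2 = 0" "q 0 = 2" "q 1 = 0" "q 2 = 1" by (simp_all add: p_def q_def)
  have entry: "mat_adj A l j = A (p j) (p l) \<otimes> A (q j) (q l) \<ominus> A (p j) (q l) \<otimes> A (q j) (p l)"
    if "l < 3" "j < 3" for l j
    using that by (simp add: mat_adj_def p_def q_def)
  have det: "mat_det R 3 A \<in> carrier R" by (simp add: mat_det_3 assms triple_rules(1))
  show "mat_mult R 3 A (mat_adj A) = mat_diag R 3 (\<lambda>_. mat_det R 3 A)"
  proof (rule mat_eqI)
    fix i j :: nat assume ij: "i < 3" "j < 3"
    have "mat_mult R 3 A (mat_adj A) i j = triple (A i) (A (p j)) (A (q j))"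
      using ij by (simp add: mat_mult_entry assms adj triple_def entry md del: One_nat_def)
    also have "\<dots> = mat_diag R 3 (\<lambda>_. mat_det R 3 A) i j"
      using ij by (elim less_3E; (simp only: md)?) (simp_all add: mat_det_3 assms mat_diag_def triple_zero
        triple_rules(2)[of "A 0"] triple_rules(2)[of "A (Suc 0)"])
    finally show "mat_mult R 3 A (mat_adj A) i j = mat_diag R 3 (\<lambda>_. mat_det R 3 A) i j" .
  qed (use assms adj det in auto)
  show "mat_mult R 3 (mat_adj A) A = mat_diag R 3 (\<lambda>_. mat_det R 3 A)"
  proof (rule mat_eqI)
    fix i j :: nat assume ij: "i < 3" "j < 3"
    let ?c = "\<lambda>j l. A l j"
    have "mat_mult R 3 (mat_adj A) A i j = triple (?c j) (?c (p i)) (?c (q i))"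
      using ij by (simp add: mat_mult_entry assms adj triple_def entry md m_comm del: One_nat_def)
    also have "\<dots> = (if i = j then triple (?c 0) (?c 1) (?c 2) else \<zero>)"
      using ij by (elim less_3E; (simp only: md)?) (simp_all add: triple_zero
        triple_rules(2)[of "?c 0"] triple_rules(2)[of "?c (Suc 0)"])
    also have "\<dots> = mat_diag R 3 (\<lambda>_. mat_det R 3 A) i j"
      using ij triple_transpose[of A] by (simp add: mat_diag_def mat_det_3 assms del: One_nat_def)
    finally show "mat_mult R 3 (mat_adj A) A i j = mat_diag R 3 (\<lambda>_. mat_det R 3 A) i j" .
  qed (use assms adj det in auto)
qed

lemma GLn_eq_Units: "GLn R 3 = Units (mat_ring R 3)"
  by (auto simp: GLn_def Units_def)

text \<open>Scaling the adjugate on the left gives a left inverse and on the right a right inverse;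
  the two agree by uniqueness of inverses.\<close>

lemma det_Unit_imp_Unit:
  assumes "A \<in> mat_carrier R 3" "mat_det R 3 A \<in> Units R"
  shows "A \<in> Units (mat_ring R 3)"
proof -
  interpret M: ring "mat_ring R 3" by (rule ring_mat_ring)
  define c where "c = inv (mat_det R 3 A)"
  have c: "c \<in> carrier R" "c \<otimes> mat_det R 3 A = \<one>" "mat_det R 3 A \<otimes> c = \<one>"
    using assms(2) by (simp_all add: c_def)
  have det: "mat_det R 3 A \<in> carrier R" using assms(2) by blast
  let ?C = "mat_diag R 3 (\<lambda>_. c)"
  have C: "?C \<in> mat_carrier R 3" using c by blast
  have "mat_mult R 3 ?C (mat_diag R 3 (\<lambda>_. mat_det R 3 A)) = mat_one R 3"
    "mat_mult R 3 (mat_diag R 3 (\<lambda>_. mat_det R 3 A)) ?C = mat_one R 3"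
    using c det
    by (auto intro!: mat_eqI[of _ R 3] simp: mat_diag_mult_entry) 
       (auto simp: mat_one_def mat_diag_def)
  then have "mat_mult R 3 (mat_mult R 3 ?C (mat_adj A)) A = mat_one R 3"
    "mat_mult R 3 A (mat_mult R 3 (mat_adj A) ?C) = mat_one R 3"
    using mat_adj[OF assms(1)] C assms(1) by (simp_all add: mat_mult_assoc flip: mat_mult_assoc[of A])
  then show ?thesis
    using M.inv_unique[of "mat_mult R 3 ?C (mat_adj A)" A "mat_mult R 3 (mat_adj A) ?C"]
      mat_adj(1)[OF assms(1)] C assms(1)
    by (force simp: Units_def)
qed

lemma SLn_closed: "A \<in> SLn R n \<Longrightarrow> A \<in> mat_carrier R n"
  by (simp add: SLn_def)

lemma mat_elem_zero: "mat_elem R n i j \<zero> = mat_one R n"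
  by (auto simp: mat_elem_def mat_one_def fun_eq_iff)

lemma mat_elem_add:
  assumes "r \<in> carrier R" "s \<in> carrier R" "i < 3" "j < 3" "i \<noteq> j"
  shows "mat_mult R 3 (mat_elem R 3 i j r) (mat_elem R 3 i j s) = mat_elem R 3 i j (r \<oplus> s)"
proof (rule mat_eqI)
  fix a b :: nat assume "a < 3" "b < 3"
  then show "mat_mult R 3 (mat_elem R 3 i j r) (mat_elem R 3 i j s) a b = mat_elem R 3 i j (r \<oplus> s) a b"
    using assms by (simp add: mat_elem_mult_entry) (auto simp: mat_elem_def a_comm)
qed (use assms in auto)

lemma mat_elem_inverse:
  assumes "r \<in> carrier R" "i < 3" "j < 3" "i \<noteq> j"
  shows "mat_mult R 3 (mat_elem R 3 i j (\<ominus> r)) (mat_elem R 3 i j r) = mat_one R 3"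
    "mat_mult R 3 (mat_elem R 3 i j r) (mat_elem R 3 i j (\<ominus> r)) = mat_one R 3"
  using assms by (simp_all add: mat_elem_add l_neg r_neg mat_elem_zero)

lemma mat_elem_mult_in_SLn:
  assumes "r \<in> carrier R" "i < 3" "j < 3" "i \<noteq> j" "g \<in> SLn R 3"
  shows "mat_mult R 3 (mat_elem R 3 i j r) g \<in> SLn R 3"
  using assms by (auto simp: SLn_def mat_det_elem_mult)

lemma mat_one_eq_diag: "mat_one R n = mat_diag R n (\<lambda>_. \<one>)"
  by (auto simp: mat_one_def mat_diag_def fun_eq_iff)

lemma SLn_subset_Units: "SLn R 3 \<subseteq> Units (mat_ring R 3)"
  by (auto simp: SLn_def intro: det_Unit_imp_Unit)

lemma mat_one_in_SLn: "mat_one R 3 \<in> SLn R 3"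
  using mat_elem_in_SLn[of \<zero> 0 1] by (simp add: mat_elem_zero)

lemma unit_of_mult_unit:
  "x \<in> carrier R \<Longrightarrow> y \<in> carrier R \<Longrightarrow> x \<otimes> y \<in> Units R \<Longrightarrow> x \<in> Units R"
  using unit_factor by blast

end

section \<open>Generation of SL(3) by elementary matrices\<close>

text \<open>Locality in the elementwise form that is applied to determinants: when an expansion sums
  to 1, one of its terms is a unit, and so are the factors of that term.\<close>

locale local_cring = cring +
  assumes unit_of_add_unit: "x \<in> carrier R \<Longrightarrow> y \<in> carrier R \<Longrightarrow> x \<oplus> y \<in> Units R \<Longrightarrow> x \<in> Units R \<or> y \<in> Units R"
begin

text \<open>Gaussian elimination by row operations: over a local ring the first column contains a unit,
  from which the pivot 1 can be produced without swapping rows.\<close>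
lemma SL3_induct [consumes 1, case_names one elem]:
  assumes g: "g \<in> SLn R 3"
    and one: "P (mat_one R 3)"
    and elem: "\<And>g r i j. g \<in> SLn R 3 \<Longrightarrow> P g \<Longrightarrow> r \<in> carrier R \<Longrightarrow> i < 3 \<Longrightarrow> j < 3 \<Longrightarrow> i \<noteq> j \<Longrightarrow>
      P (mat_mult R 3 (mat_elem R 3 i j r) g)"
  shows "P g"
proof -
  let ?E = "\<lambda>i j r g. mat_mult R 3 (mat_elem R 3 i j r) g"
  \<comment> \<open>The induction step run backwards, by the inverse elementary matrix: it suffices
    to prove \<open>P\<close> after a row operation. Each of the following cases reduces
    \<open>g\<close> to the one before it.\<close>
  have cancel: "P g" if "P (?E i j r g)" "g \<in> SLn R 3" "r \<in> carrier R" "i < 3" "j < 3" "i \<noteq> j" for g r i j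
  proof -
    interpret M: ring "mat_ring R 3" by (rule ring_mat_ring)
    have gc: "g \<in> mat_carrier R 3" using that(2) by (rule SLn_closed)
    have "?E i j (\<ominus> r) (?E i j r g) = g"
      using that gc M.l_one[of g] by (simp add: mat_elem_inverse flip: mat_mult_assoc)
    then show ?thesis
      using elem[OF mat_elem_mult_in_SLn[OF that(3-6,2)] that(1), of "\<ominus> r" i j] that by simp
  qed
  note SL = mat_elem_mult_in_SLn
  note entry = mat_elem_mult_entry(1)[OF _ SLn_closed]
  have cl: "g a b \<in> carrier R" if "g \<in> SLn R 3" for g a b
    using mat_entry_closed SLn_closed that by blast
  have det: "triple (g 0) (g 1) (g 2) = \<one>" if "g \<in> SLn R 3" for g
    using that mat_det_3[OF SLn_closed[OF that]] by (simp add: SLn_def)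
  have pivot: "\<exists>r\<in>carrier R. x \<oplus> r \<otimes> u = \<one>" if "u \<in> Units R" "x \<in> carrier R" for x u
  proof (rule bexI)
    have "(\<one> \<ominus> x) \<otimes> inv u \<otimes> u = \<one> \<ominus> x"
      using that by (simp add: m_assoc Units_closed)
    moreover have "x \<oplus> (\<one> \<ominus> x) = \<one>"
      using that(2) by algebra
    ultimately show "x \<oplus> (\<one> \<ominus> x) \<otimes> inv u \<otimes> u = \<one>" by simp
  qed (use that in auto)
  have kill: "x \<oplus> (\<ominus> x) \<otimes> \<one> = \<zero>" if "x \<in> carrier R" for x
    using that by (simp add: r_neg)
  have A: "P g" if g: "g \<in> SLn R 3" and "g 0 0 = \<one>" "g 1 0 = \<zero>" "g 2 0 = \<zero>" "g 1 1 = \<one>" "g 2 1 = \<zero>" for g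
  proof -
    \<comment> \<open>The matrix is upper triangular with two diagonal entries 1, so determinant 1
      forces the third.\<close>
    have g22: "g 2 2 = \<one>"
      using det[OF g] that cl[OF g] by (simp add: triple_def minus_eq)
    define g1 where "g1 = ?E 0 1 (\<ominus> g 0 1) g"
    define g2 where "g2 = ?E 0 2 (\<ominus> g1 0 2) g1"
    define g3 where "g3 = ?E 1 2 (\<ominus> g2 1 2) g2"
    have g1: "g1 \<in> SLn R 3" unfolding g1_def by (rule SL) (use cl[OF g] g in auto)
    have g2: "g2 \<in> SLn R 3" unfolding g2_def by (rule SL) (use cl[OF g1] g1 in auto)
    have g3: "g3 \<in> SLn R 3" unfolding g3_def by (rule SL) (use cl[OF g2] g2 in auto)
    have e1: "g1 a b = (if a = 0 then g 0 b \<oplus> (\<ominus> g 0 1) \<otimes> g 1 b else g a b)" if "a < 3" "b < 3" for a b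
      unfolding g1_def using that cl[OF g] by (simp add: entry[OF _ g])
    have e2: "g2 a b = (if a = 0 then g1 0 b \<oplus> (\<ominus> g1 0 2) \<otimes> g1 2 b else g1 a b)" if "a < 3" "b < 3" for a b
      unfolding g2_def using that cl[OF g1] by (simp add: entry[OF _ g1])
    have e3: "g3 a b = (if a = 1 then g2 1 b \<oplus> (\<ominus> g2 1 2) \<otimes> g2 2 b else g2 a b)" if "a < 3" "b < 3" for a b
      unfolding g3_def using that cl[OF g2] by (simp add: entry[OF _ g2])
    note c = cl[OF g] cl[OF g1] cl[OF g2] kill
    have "g1 0 0 = \<one>" "g1 1 0 = \<zero>" "g1 2 0 = \<zero>" "g1 0 1 = \<zero>" "g1 1 1 = \<one>" "g1 2 1 = \<zero>" "g1 2 2 = \<one>"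
      using that(2-) g22 c by (simp_all add: e1 r_neg)
    then have "g2 0 0 = \<one>" "g2 1 0 = \<zero>" "g2 2 0 = \<zero>" "g2 0 1 = \<zero>" "g2 1 1 = \<one>" "g2 2 1 = \<zero>" "g2 2 2 = \<one>" "g2 0 2 = \<zero>"
      using c by (simp_all add: e2 r_neg)
    then have "g3 0 0 = \<one>" "g3 1 0 = \<zero>" "g3 2 0 = \<zero>" "g3 0 1 = \<zero>" "g3 1 1 = \<one>" "g3 2 1 = \<zero>" "g3 2 2 = \<one>"
      "g3 0 2 = \<zero>" "g3 1 2 = \<zero>"
      using c by (simp_all add: e3 r_neg)
    then have "g3 = mat_one R 3"
      by (intro mat_eqI[OF SLn_closed[OF g3] mat_one_closed]) (auto simp: mat_one_def elim!: less_3E)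
    then have "P g3" using one by simp
    then have "P g2" unfolding g3_def by (rule cancel) (use g2 c in auto)
    then have "P g1" unfolding g2_def by (rule cancel) (use g1 c in auto)
    then show "P g" unfolding g1_def by (rule cancel) (use g c in auto)
  qed
  have B1: "P g" if g: "g \<in> SLn R 3" and "g 0 0 = \<one>" "g 1 0 = \<zero>" "g 2 0 = \<zero>" "g 1 1 = \<one>" for g
  proof -
    have "P (?E 2 1 (\<ominus> g 2 1) g)"
      by (rule A) (use that cl[OF g] in \<open>auto simp: entry[OF _ g] r_neg intro: SL\<close>)
    then show "P g" by (rule cancel) (use g cl[OF g] in auto)
  qed
  have B2: "P g" if g: "g \<in> SLn R 3" and "g 0 0 = \<one>" "g 1 0 = \<zero>" "g 2 0 = \<zero>" "g 2 1 \<in> Units R" for g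
  proof -
    note h = that
    obtain r where "r \<in> carrier R" "g 1 1 \<oplus> r \<otimes> g 2 1 = \<one>"
      using pivot h(5) cl[OF g] by blast
    then have "P (?E 1 2 r g)"
      by (intro B1) (use that cl[OF g] in \<open>auto simp: entry[OF _ g] intro: SL\<close>)
    then show "P g" by (rule cancel) (use g \<open>r \<in> carrier R\<close> in auto)
  qed
  \<comment> \<open>A row operation cannot turn a unit pivot into 1 by means of its own row. The
    unit is first used to create a 1 below it, and that entry then normalizes the pivot.
    \<open>C3\<close> makes the same detour in the first column.\<close>
  have B3: "P g" if g: "g \<in> SLn R 3" and "g 0 0 = \<one>" "g 1 0 = \<zero>" "g 2 0 = \<zero>" "g 1 1 \<in> Units R" for g
  proof -
    note h = that
    obtain r where "r \<in> carrier R" "g 2 1 \<oplus> r \<otimes> g 1 1 = \<one>"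
      using pivot h(5) cl[OF g] by blast
    then have "P (?E 2 1 r g)"
      by (intro B2) (use that cl[OF g] in \<open>auto simp: entry[OF _ g] intro: SL\<close>)
    then show "P g" by (rule cancel) (use g \<open>r \<in> carrier R\<close> in auto)
  qed
  have B: "P g" if g: "g \<in> SLn R 3" and "g 0 0 = \<one>" "g 1 0 = \<zero>" "g 2 0 = \<zero>" for g
  proof -
    \<comment> \<open>With the first column cleared, the determinant is the lower right 2 by 2
      minor.\<close>
    have "g 1 1 \<otimes> g 2 2 \<oplus> g 2 1 \<otimes> (\<ominus> g 1 2) = \<one>"
      using det[OF g] that cl[OF g] by (simp add: triple_def minus_eq r_minus m_comm)
    then have "g 1 1 \<otimes> g 2 2 \<in> Units R \<or> g 2 1 \<otimes> (\<ominus> g 1 2) \<in> Units R"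
      using unit_of_add_unit cl[OF g] by (metis Units_one_closed a_inv_closed m_closed)
    then show "P g"
      using unit_of_mult_unit cl[OF g] B2[OF that] B3[OF that] by (meson a_inv_closed)
  qed
  have C1: "P g" if g: "g \<in> SLn R 3" and "g 0 0 = \<one>" for g
  proof -
    define g1 where "g1 = ?E 1 0 (\<ominus> g 1 0) g"
    have g1: "g1 \<in> SLn R 3" unfolding g1_def by (rule SL) (use cl[OF g] g in auto)
    have e1: "g1 a b = (if a = 1 then g 1 b \<oplus> (\<ominus> g 1 0) \<otimes> g 0 b else g a b)" if "a < 3" "b < 3" for a b
      unfolding g1_def using that cl[OF g] by (simp add: entry[OF _ g])
    have "P (?E 2 0 (\<ominus> g1 2 0) g1)"
      by (rule B) (use that(2) cl[OF g] cl[OF g1] g1 in \<open>auto simp: entry[OF _ g1] e1 r_neg intro: SL\<close>)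
    then have "P g1" by (rule cancel) (use g1 cl[OF g1] in auto)
    then show "P g" unfolding g1_def by (rule cancel) (use g cl[OF g] in auto)
  qed
  have C2: "P g" if g: "g \<in> SLn R 3" and "g i 0 \<in> Units R" "i < 3" "i \<noteq> 0" for g i
  proof -
    note h = that
    obtain r where "r \<in> carrier R" "g 0 0 \<oplus> r \<otimes> g i 0 = \<one>"
      using pivot h(2) cl[OF g] by blast
    then have "P (?E 0 i r g)"
      by (intro C1) (use that cl[OF g] in \<open>auto simp: entry[OF _ g] intro: SL\<close>)
    then show "P g" by (rule cancel) (use that g \<open>r \<in> carrier R\<close> in auto)
  qed
  have C3: "P g" if g: "g \<in> SLn R 3" and "g 0 0 \<in> Units R" for g
  proof -
    note h = that
    obtain r where "r \<in> carrier R" "g 1 0 \<oplus> r \<otimes> g 0 0 = \<one>"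
      using pivot h(2) cl[OF g] by blast
    then have "P (?E 1 0 r g)"
      by (intro C2[of _ 1]) (use that cl[OF g] in \<open>auto simp: entry[OF _ g] intro: SL\<close>)
    then show "P g" by (rule cancel) (use that g \<open>r \<in> carrier R\<close> in auto)
  qed
  \<comment> \<open>Expanding the determinant along the first column shows that not all three of its
    entries are non-units.\<close>
  have unit: "triple (\<lambda>j. g j 0) (\<lambda>j. g j 1) (\<lambda>j. g j 2) \<in> Units R"
    using triple_transpose[of g] det[OF g] cl[OF g] by simp
  have sum: "x \<in> Units R \<or> y \<in> Units R \<or> z \<in> Units R"
    if "x \<otimes> x' \<oplus> (y \<otimes> y' \<oplus> z \<otimes> z') \<in> Units R"
      and "x \<in> carrier R" "y \<in> carrier R" "z \<in> carrier R" "x' \<in> carrier R" "y' \<in> carrier R" "z' \<in> carrier R"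
    for x y z x' y' z'
  proof -
    have "x \<otimes> x' \<in> Units R \<or> y \<otimes> y' \<oplus> z \<otimes> z' \<in> Units R"
      by (rule unit_of_add_unit) (use that in simp_all)
    moreover have "y \<otimes> y' \<in> Units R \<or> z \<otimes> z' \<in> Units R" if "y \<otimes> y' \<oplus> z \<otimes> z' \<in> Units R"
      by (rule unit_of_add_unit[OF _ _ that]) (use \<open>y \<in> carrier R\<close> \<open>z \<in> carrier R\<close> \<open>y' \<in> carrier R\<close> \<open>z' \<in> carrier R\<close> in simp_all)
    ultimately show ?thesis
      using that(2-) unit_of_mult_unit by blast
  qed
  from unit have "g 0 0 \<in> Units R \<or> g 1 0 \<in> Units R \<or> g 2 0 \<in> Units R"
    unfolding triple_def by (rule sum) (use cl[OF g] in simp_all)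
  then show "P g" using C2[OF g] C3[OF g] by fastforce
qed

text \<open>Instead of multiplicativity of the determinant, the left factor is built up from
  elementary matrices, and each of them acts by a row addition that keeps the determinant.\<close>

lemma SLn_mult_closed:
  assumes "g \<in> SLn R 3" "h \<in> SLn R 3"
  shows "mat_mult R 3 g h \<in> SLn R 3"
  using assms(1)
proof (induct rule: SL3_induct)
  case one
  interpret M: ring "mat_ring R 3" by (rule ring_mat_ring)
  show ?case using M.l_one[of h] assms(2) by (simp add: SLn_closed)
next
  case (elem g r i j)
  then show ?case
    using mat_elem_mult_in_SLn[of r i j "mat_mult R 3 g h"] assms(2)
    by (simp add: mat_mult_assoc SLn_closed)
qed

end

section \<open>Functoriality of matrices in the coefficient ring\<close>

context ring_hom_cring
begin

lemma mat_map_closed [simp]: "A \<in> mat_carrier R n \<Longrightarrow> mat_map S n h A \<in> mat_carrier S n"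
  by (auto simp: mat_map_def mat_carrier_def)

lemma mat_map_entry: "i < n \<Longrightarrow> j < n \<Longrightarrow> mat_map S n h A i j = h (A i j)"
  by (simp add: mat_map_def)

lemma mat_map_mult:
  assumes "A \<in> mat_carrier R 3" "B \<in> mat_carrier R 3"
  shows "mat_map S 3 h (mat_mult R 3 A B) = mat_mult S 3 (mat_map S 3 h A) (mat_map S 3 h B)"
proof (rule mat_eqI)
  note [simp] = assms[THEN R.mat_entry_closed]
  fix i j :: nat assume "i < 3" "j < 3"
  then show "mat_map S 3 h (mat_mult R 3 A B) i j = mat_mult S 3 (mat_map S 3 h A) (mat_map S 3 h B) i j"
    using assms by (simp add: mat_map_entry R.mat_mult_entry S.mat_mult_entry)
qed (use assms in auto)

lemma mat_map_diag: "mat_map S n h (mat_diag R n d) = mat_diag S n (\<lambda>i. h (d i))"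
  by (auto simp: mat_map_def mat_diag_def fun_eq_iff)

lemma mat_map_elem: "mat_map S n h (mat_elem R n i j r) = mat_elem S n i j (h r)"
  by (auto simp: mat_map_def mat_elem_def fun_eq_iff)

lemma mat_map_one: "mat_map S n h (mat_one R n) = mat_one S n"
  by (auto simp: mat_map_def mat_one_def fun_eq_iff)

lemma mat_det_map:
  assumes "A \<in> mat_carrier R 3"
  shows "mat_det S 3 (mat_map S 3 h A) = h (mat_det R 3 A)"
  using assms assms[THEN R.mat_entry_closed]
  by (simp add: R.mat_det_3 S.mat_det_3 R.triple_def S.triple_def mat_map_entry R.minus_eq S.minus_eq)

lemma mat_map_SLn: "A \<in> SLn R 3 \<Longrightarrow> mat_map S 3 h A \<in> SLn S 3"
  by (auto simp: SLn_def mat_det_map)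

lemma mat_map_ring_hom: "mat_map S 3 h \<in> ring_hom (mat_ring R 3) (mat_ring S 3)"
proof (rule ring_hom_memI)
  fix A B assume *: "A \<in> carrier (mat_ring R 3)" "B \<in> carrier (mat_ring R 3)"
  then show "mat_map S 3 h (A \<otimes>\<^bsub>mat_ring R 3\<^esub> B) = mat_map S 3 h A \<otimes>\<^bsub>mat_ring S 3\<^esub> mat_map S 3 h B"
    by (simp add: mat_map_mult)
  show "mat_map S 3 h (A \<oplus>\<^bsub>mat_ring R 3\<^esub> B) = mat_map S 3 h A \<oplus>\<^bsub>mat_ring S 3\<^esub> mat_map S 3 h B"
    using * by (auto simp: mat_map_def fun_eq_iff R.mat_entry_closed)
qed (auto simp: mat_map_one)

end

section \<open>Coefficient rings\<close>

text \<open>The sum of x^(n-1-i) y^i over i < n, with the powers of \<open>x\<close> kept on the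
  left because it is also used for matrices that do not commute.\<close>

primrec geo_sum :: "('a, 'b) ring_scheme \<Rightarrow> 'a \<Rightarrow> 'a \<Rightarrow> nat \<Rightarrow> 'a" where
  "geo_sum R x y 0 = \<zero>\<^bsub>R\<^esub>"
| "geo_sum R x y (Suc n) = x \<otimes>\<^bsub>R\<^esub> geo_sum R x y n \<oplus>\<^bsub>R\<^esub> y [^]\<^bsub>R\<^esub> n"

context ring
begin

lemma geo_sum_closed [simp]: "x \<in> carrier R \<Longrightarrow> y \<in> carrier R \<Longrightarrow> geo_sum R x y n \<in> carrier R"
  by (induct n) auto

text \<open>Both sides are the geometric sum of length n + 1, split off at its two ends. In a
  commutative ring this is the factorization of x^n - y^n; for matrices it says that the sum almost
  intertwines \<open>x\<close> and \<open>y\<close>.\<close>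

lemma geo_sum_telescope:
  assumes "x \<in> carrier R" "y \<in> carrier R"
  shows "x \<otimes> geo_sum R x y n \<oplus> y [^] n = geo_sum R x y n \<otimes> y \<oplus> x [^] n"
proof (induct n)
  case (Suc n)
  have "x \<otimes> geo_sum R x y (Suc n) \<oplus> y [^] Suc n =
      x \<otimes> (geo_sum R x y n \<otimes> y \<oplus> x [^] n) \<oplus> y [^] n \<otimes> y"
    using Suc by simp
  also have "\<dots> = (x \<otimes> geo_sum R x y n \<oplus> y [^] n) \<otimes> y \<oplus> x \<otimes> x [^] n"
    using assms by (simp add: r_distr l_distr m_assoc a_ac)
  also have "x \<otimes> x [^] n = x [^] Suc n"
    using assms nat_pow_Suc2 by simp
  finally show ?case by simp
qed (use assms in simp)

text \<open>The geometric sum is n x^(n-1) here; the extra factor \<open>x\<close> avoids the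
  exponent n - 1.\<close>

lemma geo_sum_same:
  assumes "x \<in> carrier R"
  shows "geo_sum R x x n \<otimes> x = add_pow R n (x [^] n)"
proof (induct n)
  case (Suc n)
  have "geo_sum R x x (Suc n) \<otimes> x = x \<otimes> (geo_sum R x x n \<otimes> x) \<oplus> x [^] Suc n"
    using assms by (simp add: l_distr m_assoc)
  also have "\<dots> = add_pow R n (x [^] Suc n) \<oplus> x [^] Suc n"
    unfolding Suc using assms by (simp add: add_pow_rdistr flip: nat_pow_Suc2)
  finally show ?case using assms by (simp del: nat_pow_Suc)
qed (use assms in simp)

lemma nat_pow_commute:
  fixes n :: nat
  assumes "x \<in> carrier R" "z \<in> carrier R" "z \<otimes> x = x \<otimes> z"
  shows "z \<otimes> x [^] n = x [^] n \<otimes> z"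
proof (induct n)
  case (Suc n)
  have "z \<otimes> (x [^] n \<otimes> x) = x [^] n \<otimes> (z \<otimes> x)"
    using assms Suc by (metis m_assoc nat_pow_closed)
  then show ?case using assms by (simp add: m_assoc)
qed (use assms in simp)

lemma geo_sum_commute:
  assumes "x \<in> carrier R" "y \<in> carrier R" "z \<in> carrier R" "z \<otimes> x = x \<otimes> z" "z \<otimes> y = y \<otimes> z"
  shows "z \<otimes> geo_sum R x y n = geo_sum R x y n \<otimes> z"
proof (induct n)
  case (Suc n)
  have "z \<otimes> (x \<otimes> geo_sum R x y n) = x \<otimes> geo_sum R x y n \<otimes> z"
    using assms Suc by (metis m_assoc geo_sum_closed)
  then show ?case
    using assms nat_pow_commute[of y z n] by (simp add: r_distr l_distr)
qed (use assms in simp)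

end

lemma geo_sum_hom:
  assumes "ring R" "ring S" "h \<in> ring_hom R S" "x \<in> carrier R" "y \<in> carrier R"
  shows "h (geo_sum R x y n) = geo_sum S (h x) (h y) n"
proof -
  interpret ring_hom_ring R S h
    using assms by (intro ring_hom_ringI2) auto
  show ?thesis using assms by (induct n) (simp_all add: hom_nat_pow)
qed

text \<open>Lagrange's theorem for the multiplicative and the additive group. By the latter, card -
  1 copies of 1 add up to -1, so the order of the multiplicative group is invertible in the
  field.\<close>

lemma (in field) finite_field_facts:
  assumes "finite (carrier R)"
  shows "1 < card (carrier R)"
    and "x \<in> carrier R \<Longrightarrow> x \<noteq> \<zero> \<Longrightarrow> x [^] (card (carrier R) - 1) = \<one>"
    and "x \<in> carrier R \<Longrightarrow> add_pow R (card (carrier R)) x = \<zero>"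
    and "add_pow R (card (carrier R) - 1) \<one> \<noteq> \<zero>"
proof -
  show gt: "1 < card (carrier R)"
    using card_mono[OF assms, of "{\<zero>, \<one>}"] by simp
  interpret U: group "units_of R" by (rule units_group)
  have "order (units_of R) = card (carrier R) - 1"
    using assms by (simp add: order_def units_of_carrier field_Units)
  then show "x [^] (card (carrier R) - 1) = \<one>" if "x \<in> carrier R" "x \<noteq> \<zero>"
    using U.pow_order_eq_1[of x] that by (simp add: units_of_carrier field_Units units_of_pow units_of_one)
  show q: "add_pow R (card (carrier R)) x = \<zero>" if "x \<in> carrier R" for x
    using add.pow_order_eq_1[of x] that by (simp add: order_def)
  show "add_pow R (card (carrier R) - 1) \<one> \<noteq> \<zero>"
  proof
    assume "add_pow R (card (carrier R) - 1) \<one> = \<zero>"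
    then have "add_pow R (Suc (card (carrier R) - 1)) \<one> = \<one>" by simp
    then show False using q[of \<one>] gt by simp
  qed
qed

locale coeff_ring =
  fixes K :: "'k ring" (structure) and S :: "'s ring" (structure) and \<pi> :: "'s \<Rightarrow> 'k"
  assumes field_K: "field K" and finite_K: "finite (carrier K)" and CObj: "CObj K S \<pi>"

sublocale coeff_ring \<subseteq> K: field K
  by (rule field_K)

sublocale coeff_ring \<subseteq> red: ring_hom_cring S K \<pi>
proof -
  have "cring S" "\<pi> \<in> ring_hom S K" using CObj unfolding CObj_def by blast+
  then show "ring_hom_cring S K \<pi>"
    using K.is_cring by (intro ring_hom_cring.intro ring_hom_cring_axioms.intro)
qed

context coeff_ring
begin

abbreviation maxid :: "'s set" (\<open>\<mm>\<close>) where "\<mm> \<equiv> a_kernel S K \<pi>"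

lemma maxid_eq: "\<mm> = {x \<in> carrier S. \<pi> x = \<zero>\<^bsub>K\<^esub>}"
  by (rule a_kernel_def')

lemma red_surj: "a \<in> carrier K \<Longrightarrow> \<exists>x\<in>carrier S. \<pi> x = a"
proof -
  assume "a \<in> carrier K"
  moreover have "\<pi> ` carrier S = carrier K" using CObj unfolding CObj_def by blast
  ultimately show ?thesis by (metis imageE)
qed

lemma ideal_maxid: "ideal \<mm> S"
  by (rule red.ring.kernel_is_ideal)

lemma ideal_ideal_pow: "ideal (ideal_pow S \<mm> j) S"
  by (induct j) (auto intro: ideal_maxid red.R.oneideal red.R.ideal_prod_is_ideal)

lemma ideal_pow_closed: "x \<in> ideal_pow S \<mm> j \<Longrightarrow> x \<in> carrier S"
  using ideal.Icarr[OF ideal_ideal_pow] .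

lemma ideal_pow_add: "x \<in> ideal_pow S \<mm> j \<Longrightarrow> y \<in> ideal_pow S \<mm> j \<Longrightarrow> x \<oplus>\<^bsub>S\<^esub> y \<in> ideal_pow S \<mm> j"
  using additive_subgroup.a_closed[OF ideal.axioms(1)[OF ideal_ideal_pow]] .

lemma ideal_pow_minus: "x \<in> ideal_pow S \<mm> j \<Longrightarrow> y \<in> ideal_pow S \<mm> j \<Longrightarrow> x \<ominus>\<^bsub>S\<^esub> y \<in> ideal_pow S \<mm> j"
  unfolding red.R.minus_eq
  using additive_subgroup.a_inv_closed[OF ideal.axioms(1)[OF ideal_ideal_pow]]
  by (auto intro: ideal_pow_add)

lemma ideal_pow_SucI: "x \<in> \<mm> \<Longrightarrow> y \<in> ideal_pow S \<mm> j \<Longrightarrow> x \<otimes>\<^bsub>S\<^esub> y \<in> ideal_pow S \<mm> (Suc j)"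
  by (simp add: ideal_prod.prod)

lemma adic_limit:
  assumes "\<And>j. x j \<in> carrier S" "\<And>j. x (Suc j) \<ominus>\<^bsub>S\<^esub> x j \<in> ideal_pow S \<mm> j"
  obtains y where "y \<in> carrier S" "\<And>j. y \<ominus>\<^bsub>S\<^esub> x j \<in> ideal_pow S \<mm> j"
  using CObj assms unfolding CObj_def adic_complete_def by metis

text \<open>Both \<open>x\<close> and zero are limits of the constant zero family, and limits are
  unique.\<close>

lemma adic_separated:
  assumes "\<And>j. x \<in> ideal_pow S \<mm> j"
  shows "x = \<zero>\<^bsub>S\<^esub>"
proof -
  have x: "x \<in> carrier S" using assms ideal_pow_closed by blast
  have "\<zero>\<^bsub>S\<^esub> \<in> ideal_pow S \<mm> j" for j
    using additive_subgroup.zero_closed[OF ideal.axioms(1)[OF ideal_ideal_pow]] .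
  then have "\<exists>!y. y \<in> carrier S \<and> (\<forall>j. y \<ominus>\<^bsub>S\<^esub> \<zero>\<^bsub>S\<^esub> \<in> ideal_pow S \<mm> j)"
    using CObj unfolding CObj_def adic_complete_def
    by (elim conjE allE[of _ "\<lambda>_. \<zero>\<^bsub>S\<^esub>"]) (simp add: red.R.minus_eq)
  moreover have "y \<ominus>\<^bsub>S\<^esub> \<zero>\<^bsub>S\<^esub> = y" if "y \<in> carrier S" for y
    using that by (simp add: red.R.minus_eq)
  ultimately show ?thesis
    using assms x \<open>\<And>j. \<zero>\<^bsub>S\<^esub> \<in> ideal_pow S \<mm> j\<close> by (metis red.R.zero_closed)
qed

text \<open>The inverse is the adic limit of the geometric series 1 + z + z^2 + ...\<close>

lemma one_minus_maxid_Unit: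
  assumes z: "z \<in> \<mm>"
  shows "\<one>\<^bsub>S\<^esub> \<ominus>\<^bsub>S\<^esub> z \<in> Units S"
proof -
  note [simp] = red.R.minus_eq
  have zc: "z \<in> carrier S" using z by (simp add: maxid_eq)
  \<comment> \<open>\<open>x j\<close> is the partial sum with j terms. The Horner recursion makes
    each difference \<open>z\<close> times the previous one, hence one ideal power deeper.\<close>
  define x where "x = rec_nat \<zero>\<^bsub>S\<^esub> (\<lambda>_ y. \<one>\<^bsub>S\<^esub> \<oplus>\<^bsub>S\<^esub> z \<otimes>\<^bsub>S\<^esub> y)"
  have x0: "x 0 = \<zero>\<^bsub>S\<^esub>" and xS: "x (Suc j) = \<one>\<^bsub>S\<^esub> \<oplus>\<^bsub>S\<^esub> z \<otimes>\<^bsub>S\<^esub> x j" for j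
    by (simp_all add: x_def)
  have xc: "x j \<in> carrier S" for j by (induct j) (simp_all add: x0 xS zc)
  have step: "x (Suc j) \<ominus>\<^bsub>S\<^esub> x j \<in> ideal_pow S \<mm> j" for j
  proof (induct j)
    case (Suc j)
    have "x (Suc (Suc j)) \<ominus>\<^bsub>S\<^esub> x (Suc j) = z \<otimes>\<^bsub>S\<^esub> (x (Suc j) \<ominus>\<^bsub>S\<^esub> x j)"
      unfolding xS[of "Suc j"] using xS[of j] xc[of j] xc[of "Suc j"] zc by algebra
    then show ?case using ideal_pow_SucI[OF z Suc] by simp
  qed (simp add: xc)
  obtain y where y: "y \<in> carrier S" "\<And>j. y \<ominus>\<^bsub>S\<^esub> x j \<in> ideal_pow S \<mm> j"
    using adic_limit xc step by blast
  have "(\<one>\<^bsub>S\<^esub> \<ominus>\<^bsub>S\<^esub> z) \<otimes>\<^bsub>S\<^esub> y \<ominus>\<^bsub>S\<^esub> \<one>\<^bsub>S\<^esub> \<in> ideal_pow S \<mm> j" for j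
  proof (cases j)
    case 0 then show ?thesis using y zc by simp
  next
    case (Suc i)
    \<comment> \<open>Substituting x (i+1) - z x i for 1 expresses the error through two
      approximation errors of \<open>y\<close>, both small.\<close>
    have "(\<one>\<^bsub>S\<^esub> \<ominus>\<^bsub>S\<^esub> z) \<otimes>\<^bsub>S\<^esub> y \<ominus>\<^bsub>S\<^esub> \<one>\<^bsub>S\<^esub> = (y \<ominus>\<^bsub>S\<^esub> x (Suc i)) \<ominus>\<^bsub>S\<^esub> z \<otimes>\<^bsub>S\<^esub> (y \<ominus>\<^bsub>S\<^esub> x i)"
      unfolding xS using xc[of i] zc y(1) by algebra
    then show ?thesis
      unfolding Suc using ideal_pow_minus[OF y(2) ideal_pow_SucI[OF z y(2)]] by (simp del: ideal_pow.simps)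
  qed
  then have "(\<one>\<^bsub>S\<^esub> \<ominus>\<^bsub>S\<^esub> z) \<otimes>\<^bsub>S\<^esub> y \<ominus>\<^bsub>S\<^esub> \<one>\<^bsub>S\<^esub> = \<zero>\<^bsub>S\<^esub>"
    by (rule adic_separated)
  then have "(\<one>\<^bsub>S\<^esub> \<ominus>\<^bsub>S\<^esub> z) \<otimes>\<^bsub>S\<^esub> y = \<one>\<^bsub>S\<^esub>"
    using y zc by (simp add: red.R.r_right_minus_eq del: red.R.minus_eq)
  then show ?thesis
    using y zc red.R.unit_of_mult_unit[of "\<one>\<^bsub>S\<^esub> \<ominus>\<^bsub>S\<^esub> z" y] by simp
qed

text \<open>If \<open>y\<close> lifts the inverse of \<open>\<pi> x\<close>, then the product of
  \<open>x\<close> and \<open>y\<close> is 1 minus an element of the maximal ideal, hence a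
  unit.\<close>

lemma Units_iff: "x \<in> Units S \<longleftrightarrow> x \<in> carrier S \<and> \<pi> x \<noteq> \<zero>\<^bsub>K\<^esub>"
proof safe
  assume x: "x \<in> Units S" "\<pi> x = \<zero>\<^bsub>K\<^esub>"
  then have "\<pi> (x \<otimes>\<^bsub>S\<^esub> inv\<^bsub>S\<^esub> x) = \<zero>\<^bsub>K\<^esub>"
    by (subst red.hom_mult) (auto simp: red.R.Units_closed)
  then show False using x by simp
next
  assume x: "x \<in> carrier S" "\<pi> x \<noteq> \<zero>\<^bsub>K\<^esub>"
  then have u: "\<pi> x \<in> Units K" by (simp add: K.field_Units)
  then obtain y where y: "y \<in> carrier S" "\<pi> y = inv\<^bsub>K\<^esub> (\<pi> x)"
    using red_surj by blast
  have "\<one>\<^bsub>S\<^esub> \<ominus>\<^bsub>S\<^esub> x \<otimes>\<^bsub>S\<^esub> y \<in> \<mm>"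
    using x y u by (simp add: maxid_eq red.R.minus_eq K.r_neg)
  then have "\<one>\<^bsub>S\<^esub> \<ominus>\<^bsub>S\<^esub> (\<one>\<^bsub>S\<^esub> \<ominus>\<^bsub>S\<^esub> x \<otimes>\<^bsub>S\<^esub> y) \<in> Units S" by (rule one_minus_maxid_Unit)
  also have "\<one>\<^bsub>S\<^esub> \<ominus>\<^bsub>S\<^esub> (\<one>\<^bsub>S\<^esub> \<ominus>\<^bsub>S\<^esub> x \<otimes>\<^bsub>S\<^esub> y) = x \<otimes>\<^bsub>S\<^esub> y"
    using x y by algebra
  finally show "x \<in> Units S" using x y red.R.unit_of_mult_unit by blast
qed blast

end

sublocale coeff_ring \<subseteq> loc: local_cring S
proof
  fix x y assume "x \<in> carrier S" "y \<in> carrier S" "x \<oplus>\<^bsub>S\<^esub> y \<in> Units S"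
  then show "x \<in> Units S \<or> y \<in> Units S"
    by (auto simp: Units_iff)
qed

context cring
begin

lemma mat_diag_mult:
  assumes "\<And>i. i < 3 \<Longrightarrow> d i \<in> carrier R" "\<And>i. i < 3 \<Longrightarrow> e i \<in> carrier R"
  shows "mat_mult R 3 (mat_diag R 3 d) (mat_diag R 3 e) = mat_diag R 3 (\<lambda>i. d i \<otimes> e i)"
  using assms by (intro mat_eqI[of _ R 3]) (auto simp: mat_diag_mult_entry, auto simp: mat_diag_def)

lemma mat_diag_cong: "(\<And>i. i < n \<Longrightarrow> d i = e i) \<Longrightarrow> mat_diag R n d = mat_diag R n e"
  by (auto simp: mat_diag_def fun_eq_iff)

lemma mat_diag_pow:
  fixes m :: nat
  assumes "\<And>i. i < 3 \<Longrightarrow> d i \<in> carrier R"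
  shows "mat_diag R 3 d [^]\<^bsub>mat_ring R 3\<^esub> m = mat_diag R 3 (\<lambda>i. d i [^] m)"
proof (induct m)
  case 0 show ?case by (simp add: mat_one_eq_diag)
next
  case (Suc m) then show ?case using assms by (simp add: mat_diag_mult)
qed

lemma mat_diag_const_commute:
  assumes "c \<in> carrier R" "A \<in> mat_carrier R 3"
  shows "mat_mult R 3 (mat_diag R 3 (\<lambda>_. c)) A = mat_mult R 3 A (mat_diag R 3 (\<lambda>_. c))"
  using assms by (intro mat_eqI[of _ R 3]) (auto simp: mat_diag_mult_entry mat_entry_closed m_comm)

end

section \<open>Roots of unity: Teichmueller lifts and averaging\<close>

context coeff_ring
begin

text \<open>The order of the unit group of \<open>K\<close>: it is the exponent that kills
  Teichmueller lifts and also the number of terms in the averages.\<close>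

definition ord_mult :: nat where "ord_mult = card (carrier K) - 1"

lemma card_K: "card (carrier K) = Suc ord_mult"
  using K.finite_field_facts(1)[OF finite_K] by (simp add: ord_mult_def)

lemma pow_ord_mult: "a \<in> carrier K \<Longrightarrow> a \<noteq> \<zero>\<^bsub>K\<^esub> \<Longrightarrow> a [^]\<^bsub>K\<^esub> ord_mult = \<one>\<^bsub>K\<^esub>"
  unfolding ord_mult_def by (rule K.finite_field_facts(2)[OF finite_K])

lemma red_add_pow: "x \<in> carrier S \<Longrightarrow> \<pi> (add_pow S (n::nat) x) = add_pow K n (\<pi> x)"
  by (induct n) simp_all

lemma red_pow: "x \<in> carrier S \<Longrightarrow> \<pi> (x [^]\<^bsub>S\<^esub> (n::nat)) = \<pi> x [^]\<^bsub>K\<^esub> n"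
  by (induct n) simp_all

lemma ord_mult_Unit: "add_pow S ord_mult \<one>\<^bsub>S\<^esub> \<in> Units S"
  unfolding Units_iff using K.finite_field_facts(4)[OF finite_K]
  by (simp add: red_add_pow ord_mult_def)

lemma pow_diff_factor:
  fixes n :: nat
  assumes "x \<in> carrier S" "y \<in> carrier S"
  shows "x [^]\<^bsub>S\<^esub> n \<ominus>\<^bsub>S\<^esub> y [^]\<^bsub>S\<^esub> n = geo_sum S x y n \<otimes>\<^bsub>S\<^esub> (x \<ominus>\<^bsub>S\<^esub> y)"
proof -
  have "g \<otimes>\<^bsub>S\<^esub> (x \<ominus>\<^bsub>S\<^esub> y) = u \<ominus>\<^bsub>S\<^esub> v"
    if "x \<otimes>\<^bsub>S\<^esub> g \<oplus>\<^bsub>S\<^esub> v = g \<otimes>\<^bsub>S\<^esub> y \<oplus>\<^bsub>S\<^esub> u" "g \<in> carrier S" "u \<in> carrier S" "v \<in> carrier S" for g u v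
  proof -
    have "g \<otimes>\<^bsub>S\<^esub> (x \<ominus>\<^bsub>S\<^esub> y) = (x \<otimes>\<^bsub>S\<^esub> g \<oplus>\<^bsub>S\<^esub> v) \<ominus>\<^bsub>S\<^esub> v \<ominus>\<^bsub>S\<^esub> g \<otimes>\<^bsub>S\<^esub> y"
      using that(2-) assms by algebra
    also have "\<dots> = u \<ominus>\<^bsub>S\<^esub> v"
      unfolding that(1) using that(2-) assms by algebra
    finally show ?thesis .
  qed
  from this[OF red.R.geo_sum_telescope] show ?thesis using assms by simp
qed

lemma red_geo_sum: "x \<in> carrier S \<Longrightarrow> y \<in> carrier S \<Longrightarrow> \<pi> (geo_sum S x y n) = geo_sum K (\<pi> x) (\<pi> y) n"
  by (rule geo_sum_hom[OF red.R.ring_axioms K.ring_axioms red.homh])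

text \<open>With \<open>q = card k\<close>, the lift is the limit of iterated \<open>q\<close>-th powers of any lift \<open>u\<close> of \<open>a\<close>; they converge since
  \<open>x\<^sup>q - y\<^sup>q\<close> is \<open>x - y\<close> times an element that reduces to \<open>q a\<^sup>q\<^sup>-\<^sup>1 = 0\<close>.\<close>
lemma teichmueller_lift:
  assumes a: "a \<in> carrier K" "a \<noteq> \<zero>\<^bsub>K\<^esub>"
  shows "\<exists>x\<in>carrier S. x [^]\<^bsub>S\<^esub> ord_mult = \<one>\<^bsub>S\<^esub> \<and> \<pi> x = a"
proof -
  define q where "q = Suc ord_mult"
  have aq: "a [^]\<^bsub>K\<^esub> q = a" using a pow_ord_mult by (simp add: q_def)
  have geo_mem: "geo_sum S x y q \<in> \<mm>" if "x \<in> carrier S" "y \<in> carrier S" "\<pi> x = a" "\<pi> y = a" for x y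
  proof -
    have "geo_sum K a a q \<otimes>\<^bsub>K\<^esub> a = \<zero>\<^bsub>K\<^esub>"
      using K.geo_sum_same[of a q] K.finite_field_facts(3)[OF finite_K, of a] a aq
      by (simp add: card_K q_def)
    then have "geo_sum K a a q = \<zero>\<^bsub>K\<^esub>"
      using a K.geo_sum_closed[of a a q] K.integral by blast
    then show ?thesis using that by (simp add: maxid_eq red_geo_sum del: geo_sum.simps)
  qed
  obtain u where u: "u \<in> carrier S" "\<pi> u = a" using red_surj a by blast
  define x where "x = rec_nat u (\<lambda>_ y. y [^]\<^bsub>S\<^esub> q)"
  have x0: "x 0 = u" and xS: "x (Suc j) = x j [^]\<^bsub>S\<^esub> q" for j
    by (simp_all add: x_def)
  have xc: "x j \<in> carrier S \<and> \<pi> (x j) = a" for j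
    by (induct j) (simp_all add: x0 xS u red_pow aq)
  have pow_diff: "v [^]\<^bsub>S\<^esub> q \<ominus>\<^bsub>S\<^esub> w [^]\<^bsub>S\<^esub> q \<in> ideal_pow S \<mm> (Suc j)"
    if "v \<ominus>\<^bsub>S\<^esub> w \<in> ideal_pow S \<mm> j" "v \<in> carrier S" "w \<in> carrier S" "\<pi> v = a" "\<pi> w = a" for v w j
    unfolding pow_diff_factor[OF that(2,3)] using that by (intro ideal_pow_SucI geo_mem)
  have step: "x (Suc j) \<ominus>\<^bsub>S\<^esub> x j \<in> ideal_pow S \<mm> j" for j
  proof (induct j)
    case 0 show ?case using xc[of 0] xc[of 1] by simp
  next
    case (Suc j) then show ?case
      unfolding xS[of "Suc j"] xS[of j] using xc[of "Suc j"] xc[of j]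
      by (intro pow_diff) (simp_all add: xS)
  qed
  obtain y where y: "y \<in> carrier S" "\<And>j. y \<ominus>\<^bsub>S\<^esub> x j \<in> ideal_pow S \<mm> j"
    using adic_limit xc step by (metis (no_types, lifting))
  \<comment> \<open>The zeroth ideal power is the whole ring, so index 1 is the first that carries
    information about the reduction of \<open>y\<close>.\<close>
  have "y \<ominus>\<^bsub>S\<^esub> x 1 \<in> \<mm>"
  proof -
    interpret I: ideal \<mm> S by (rule ideal_maxid)
    have "s \<in> \<mm>" if "s \<in> ideal_prod S \<mm> (carrier S)" for s
      using that by (induct rule: ideal_prod.induct) (auto intro: I.I_r_closed I.a_closed)
    then show ?thesis using y(2)[of 1] by simp
  qed
  then have "\<pi> (y \<ominus>\<^bsub>S\<^esub> x 1) = \<zero>\<^bsub>K\<^esub>" by (simp add: maxid_eq)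
  then have ya: "\<pi> y = a"
    using y(1) xc[of 1] K.r_right_minus_eq[of "\<pi> y" a] a by (simp add: red.R.minus_eq K.minus_eq)
  \<comment> \<open>Modulo the ideal power j + 1, both y^q and y agree with x (j+1): the former
    because x (j+1) is the q-th power of x j, and q-th powers gain one step of precision.\<close>
  have "y [^]\<^bsub>S\<^esub> q \<ominus>\<^bsub>S\<^esub> y \<in> ideal_pow S \<mm> j" for j
  proof -
    have "y [^]\<^bsub>S\<^esub> q \<ominus>\<^bsub>S\<^esub> x (Suc j) \<in> ideal_pow S \<mm> (Suc j)"
      unfolding xS using y xc ya by (intro pow_diff) auto
    then have "(y [^]\<^bsub>S\<^esub> q \<ominus>\<^bsub>S\<^esub> x (Suc j)) \<ominus>\<^bsub>S\<^esub> (y \<ominus>\<^bsub>S\<^esub> x (Suc j)) \<in> ideal_pow S \<mm> (Suc j)"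
      by (rule ideal_pow_minus[OF _ y(2)])
    also have "(y [^]\<^bsub>S\<^esub> q \<ominus>\<^bsub>S\<^esub> x (Suc j)) \<ominus>\<^bsub>S\<^esub> (y \<ominus>\<^bsub>S\<^esub> x (Suc j)) = y [^]\<^bsub>S\<^esub> q \<ominus>\<^bsub>S\<^esub> y"
    proof -
      have "(v \<ominus>\<^bsub>S\<^esub> w) \<ominus>\<^bsub>S\<^esub> (z \<ominus>\<^bsub>S\<^esub> w) = v \<ominus>\<^bsub>S\<^esub> z" if "v \<in> carrier S" "w \<in> carrier S" "z \<in> carrier S" for v w z
        using that by algebra
      then show ?thesis using y(1) xc by blast
    qed
    finally have "y [^]\<^bsub>S\<^esub> q \<ominus>\<^bsub>S\<^esub> y \<in> ideal_pow S \<mm> (Suc j)" .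
    moreover have "s \<in> ideal_pow S \<mm> j" if "s \<in> ideal_prod S \<mm> (ideal_pow S \<mm> j)" for s
      using that
    proof (induct rule: ideal_prod.induct)
      case (prod a b)
      then show ?case
        using ideal.I_l_closed[OF ideal_ideal_pow] by (simp add: maxid_eq)
    qed (auto intro: ideal_pow_add)
    ultimately show ?thesis by simp
  qed
  then have "y [^]\<^bsub>S\<^esub> q \<ominus>\<^bsub>S\<^esub> y = \<zero>\<^bsub>S\<^esub>" by (rule adic_separated)
  then have "y [^]\<^bsub>S\<^esub> ord_mult \<otimes>\<^bsub>S\<^esub> y = \<one>\<^bsub>S\<^esub> \<otimes>\<^bsub>S\<^esub> y"
    using y(1) by (simp add: q_def red.R.r_right_minus_eq)
  moreover have "y \<in> Units S" using y(1) ya a by (simp add: Units_iff)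
  ultimately have "y [^]\<^bsub>S\<^esub> ord_mult = \<one>\<^bsub>S\<^esub>"
    using y(1) by (metis red.R.Units_r_inv red.R.Units_inv_closed red.R.m_assoc red.R.nat_pow_closed
        red.R.one_closed red.R.r_one)
  then show ?thesis using y(1) ya by blast
qed

text \<open>In the factorization of x^N - 1 the cofactor of x - 1 reduces to N, which is nonzero in
  \<open>K\<close>, so it is a unit and can be cancelled. This transports multiplicative relations
  between Teichmueller lifts from \<open>K\<close> to the coefficient ring.\<close>

lemma root_of_unity_eq_one:
  assumes "x \<in> carrier S" "\<pi> x = \<one>\<^bsub>K\<^esub>" "x [^]\<^bsub>S\<^esub> ord_mult = \<one>\<^bsub>S\<^esub>"
  shows "x = \<one>\<^bsub>S\<^esub>"
proof -
  let ?g = "geo_sum S x \<one>\<^bsub>S\<^esub> ord_mult"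
  have "\<pi> ?g = add_pow K ord_mult \<one>\<^bsub>K\<^esub>"
    using assms K.geo_sum_same[of "\<one>\<^bsub>K\<^esub>" ord_mult] by (simp add: red_geo_sum)
  then have "?g \<in> Units S"
    using assms K.finite_field_facts(4)[OF finite_K] by (simp add: Units_iff ord_mult_def)
  moreover have "?g \<otimes>\<^bsub>S\<^esub> (x \<ominus>\<^bsub>S\<^esub> \<one>\<^bsub>S\<^esub>) = \<zero>\<^bsub>S\<^esub>"
    using pow_diff_factor[of x "\<one>\<^bsub>S\<^esub>" ord_mult] assms by (simp add: red.R.minus_eq red.R.r_neg)
  ultimately have "x \<ominus>\<^bsub>S\<^esub> \<one>\<^bsub>S\<^esub> = \<zero>\<^bsub>S\<^esub>"
    using assms(1) by (metis red.R.Units_l_inv red.R.Units_inv_closed red.R.Units_closed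
        red.R.m_assoc red.R.minus_closed red.R.one_closed red.R.l_one red.R.r_null)
  then show ?thesis using assms(1) by simp
qed

abbreviation Red :: "(nat \<Rightarrow> nat \<Rightarrow> 's) \<Rightarrow> nat \<Rightarrow> nat \<Rightarrow> 'k" where
  "Red \<equiv> mat_map K 3 \<pi>"

lemma Red_one_Unit:
  assumes "P \<in> mat_carrier S 3" "Red P = mat_one K 3"
  shows "P \<in> Units (mat_ring S 3)"
proof (rule red.R.det_Unit_imp_Unit[OF assms(1)])
  have "\<pi> (mat_det S 3 P) = \<one>\<^bsub>K\<^esub>"
    using red.mat_det_map[OF assms(1)] K.mat_one_in_SLn by (simp add: assms(2) SLn_def)
  moreover have "mat_det S 3 P \<in> carrier S"
    using assms(1) by (simp add: red.R.mat_det_3 red.R.triple_rules(1) red.R.mat_entry_closed)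
  ultimately show "mat_det S 3 P \<in> Units S" by (simp add: Units_iff)
qed

text \<open>With \<open>N = q - 1\<close>, \<open>P\<close> is the average of \<open>D\<^sup>i M\<^sup>N\<^sup>-\<^sup>i\<close> for \<open>i = 1, ..., N\<close>.\<close>
lemma conj_average:
  assumes D: "D \<in> mat_carrier S 3" and M: "M \<in> mat_carrier S 3" and red: "Red D = Red M"
    and DN: "D [^]\<^bsub>mat_ring S 3\<^esub> ord_mult = mat_one S 3"
    and MN: "M [^]\<^bsub>mat_ring S 3\<^esub> ord_mult = mat_one S 3"
  obtains P where "P \<in> mat_carrier S 3" "Red P = mat_one K 3" "mat_mult S 3 D P = mat_mult S 3 P M"
    "\<And>Z. Z \<in> mat_carrier S 3 \<Longrightarrow> mat_mult S 3 Z D = mat_mult S 3 D Z \<Longrightarrow>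
      mat_mult S 3 Z M = mat_mult S 3 M Z \<Longrightarrow> mat_mult S 3 Z P = mat_mult S 3 P Z"
proof -
  interpret MS: ring "mat_ring S 3" by (rule red.R.ring_mat_ring)
  interpret MK: ring "mat_ring K 3" by (rule K.ring_mat_ring)
  interpret H: ring_hom_ring "mat_ring S 3" "mat_ring K 3" Red
    by (intro ring_hom_ringI2 MS.ring_axioms MK.ring_axioms red.mat_map_ring_hom)
  let ?N = "add_pow S ord_mult \<one>\<^bsub>S\<^esub>"
  define c where "c = inv\<^bsub>S\<^esub> ?N"
  have c: "c \<in> carrier S" "c \<otimes>\<^bsub>S\<^esub> ?N = \<one>\<^bsub>S\<^esub>"
    using ord_mult_Unit by (simp_all add: c_def)
  define C where "C = mat_diag S 3 (\<lambda>_. c)"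
  define G where "G = geo_sum (mat_ring S 3) D M ord_mult"
  have C: "C \<in> mat_carrier S 3" using c by (auto simp: C_def)
  have G: "G \<in> mat_carrier S 3" unfolding G_def using MS.geo_sum_closed[of D M] D M by simp
  have C_comm: "mat_mult S 3 C Z = mat_mult S 3 Z C" if "Z \<in> mat_carrier S 3" for Z
    unfolding C_def using c that by (simp add: red.R.mat_diag_const_commute)
  note assoc = red.R.mat_mult_assoc and cl = red.R.mat_mult_closed
  \<comment> \<open>\<open>G\<close> reduces to N D^(N-1). The additional factor \<open>D\<close>
    completes the power to D^N = 1, and \<open>C\<close> removes the remaining scalar N.\<close>
  define P where "P = mat_mult S 3 C (mat_mult S 3 D G)"
  have "(\<lambda>i j. mat_mult S 3 D G i j \<oplus>\<^bsub>S\<^esub> mat_one S 3 i j) = (\<lambda>i j. mat_mult S 3 G M i j \<oplus>\<^bsub>S\<^esub> mat_one S 3 i j)"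
    using MS.geo_sum_telescope[of D M ord_mult] D M DN MN by (simp add: G_def)
  \<comment> \<open>The N-th powers of \<open>D\<close> and \<open>M\<close> are both 1 and cancel
    from the telescoping identity.\<close>
  then have DG: "mat_mult S 3 D G = mat_mult S 3 G M"
    using MS.add.r_cancel[of "mat_mult S 3 D G" "mat_one S 3" "mat_mult S 3 G M"] D G M by simp
  show thesis
  proof (rule that)
    show P: "P \<in> mat_carrier S 3" unfolding P_def using C D G by (intro cl)
    show "mat_mult S 3 D P = mat_mult S 3 P M"
      using C D G M DG C_comm[OF D] unfolding P_def
      by (metis assoc cl)
    have "Red (mat_mult S 3 D G) = mat_mult K 3 (Red D) (geo_sum (mat_ring K 3) (Red D) (Red D) ord_mult)"
      using D G M geo_sum_hom[OF MS.ring_axioms MK.ring_axioms red.mat_map_ring_hom, of D M]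
      by (simp add: red.mat_map_mult G_def red)
    also have "\<dots> = mat_mult K 3 (geo_sum (mat_ring K 3) (Red D) (Red D) ord_mult) (Red D)"
      using MK.geo_sum_commute[of "Red D" "Red D" "Red D"] D by simp
    also have "\<dots> = add_pow (mat_ring K 3) ord_mult (Red D [^]\<^bsub>mat_ring K 3\<^esub> ord_mult)"
      using MK.geo_sum_same[of "Red D"] D by simp
    also have "Red D [^]\<^bsub>mat_ring K 3\<^esub> ord_mult = mat_one K 3"
      using H.hom_nat_pow[of D ord_mult] D DN by (simp add: red.mat_map_one)
    also have "add_pow (mat_ring K 3) ord_mult (mat_one K 3) = mat_diag K 3 (\<lambda>_. add_pow K ord_mult \<one>\<^bsub>K\<^esub>)"
      by (auto simp: fun_eq_iff K.add_pow_mat_entry mat_one_def mat_diag_def K.add.nat_pow_one)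
    finally have "Red P = mat_diag K 3 (\<lambda>_. \<pi> c \<otimes>\<^bsub>K\<^esub> \<pi> ?N)"
      using C D G c unfolding P_def
      by (simp add: red.mat_map_mult C_def red.mat_map_diag K.mat_diag_mult red_add_pow)
    also have "\<pi> c \<otimes>\<^bsub>K\<^esub> \<pi> ?N = \<one>\<^bsub>K\<^esub>"
      using c by (metis red.hom_mult red.hom_one red.R.one_closed red.R.add.nat_pow_closed)
    finally show "Red P = mat_one K 3" by (simp add: K.mat_one_eq_diag)
    \<comment> \<open>\<open>P\<close> is a scalar times a polynomial in \<open>D\<close> and
      \<open>M\<close>, so it commutes with whatever commutes with both. This allows a second torus
      element to be diagonalized without disturbing a first one.\<close>
    fix Z assume Z: "Z \<in> mat_carrier S 3" "mat_mult S 3 Z D = mat_mult S 3 D Z"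
      "mat_mult S 3 Z M = mat_mult S 3 M Z"
    then have "mat_mult S 3 Z G = mat_mult S 3 G Z"
      using MS.geo_sum_commute[of D M Z] D M by (simp add: G_def)
    then show "mat_mult S 3 Z P = mat_mult S 3 P Z"
      unfolding P_def using Z C D G C_comm[OF Z(1)] by (metis assoc cl)
  qed
qed

end

section \<open>Relations between diagonal and elementary matrices\<close>

context cring
begin

text \<open>Conjugation by a diagonal matrix scales the root (i,j) by d i / d j. The inverse-free
  form covers at once commutation (\<open>s = r\<close>), the torus action on a root subgroup, and
  the final rescaling.\<close>

lemma mat_diag_elem:
  assumes "\<And>i. i < 3 \<Longrightarrow> d i \<in> carrier R" "r \<in> carrier R" "s \<in> carrier R" "d i \<otimes> r = s \<otimes> d j"
    and "i < 3" "j < 3" "i \<noteq> j"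
  shows "mat_mult R 3 (mat_diag R 3 d) (mat_elem R 3 i j r) = mat_mult R 3 (mat_elem R 3 i j s) (mat_diag R 3 d)"
  using assms
  by (intro mat_eqI[of _ R 3]) (auto simp: mat_diag_mult_entry, auto simp: mat_elem_def)

lemma mat_elem_commute:
  assumes "r \<in> carrier R" "s \<in> carrier R" "i < 3" "j < 3" "k < 3" "i \<noteq> j" "i \<noteq> k" "j \<noteq> k"
  shows "mat_mult R 3 (mat_elem R 3 i j r) (mat_elem R 3 i k s) = mat_mult R 3 (mat_elem R 3 i k s) (mat_elem R 3 i j r)"
    and "mat_mult R 3 (mat_elem R 3 i j r) (mat_elem R 3 k j s) = mat_mult R 3 (mat_elem R 3 k j s) (mat_elem R 3 i j r)"
  using assms
  by (intro mat_eqI[of _ R 3]; auto simp: mat_elem_mult_entry; auto simp: mat_elem_def a_comm)+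

text \<open>The commutator relation with the inverses cleared, so that it can be compared entry by
  entry.\<close>

lemma mat_elem_commutator:
  assumes "r \<in> carrier R" "s \<in> carrier R" "i < 3" "j < 3" "k < 3" "i \<noteq> j" "i \<noteq> k" "j \<noteq> k"
  shows "mat_mult R 3 (mat_elem R 3 i k r) (mat_elem R 3 k j s) =
    mat_mult R 3 (mat_elem R 3 i j (r \<otimes> s)) (mat_mult R 3 (mat_elem R 3 k j s) (mat_elem R 3 i k r))"
  using assms
  by (intro mat_eqI[of _ R 3]; auto simp: mat_elem_mult_entry; auto simp: mat_elem_def a_comm)

lemma mat_diag_in_SLn:
  assumes "\<And>i. i < 3 \<Longrightarrow> d i \<in> carrier R" "d 0 \<otimes> (d 1 \<otimes> d 2) = \<one>"
  shows "mat_diag R 3 d \<in> SLn R 3"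
  using assms mat_det_diag[of d] by (auto simp: SLn_def)

end

section \<open>Residual representations\<close>

locale coeff_pair = R: coeff_ring K R \<rho> + S: coeff_ring K S \<sigma>
  for K :: "'k ring" and R :: "'r ring" and \<rho> and S :: "'s ring" and \<sigma>

sublocale coeff_pair \<subseteq> MS: ring "mat_ring S 3"
  by (rule S.red.R.ring_mat_ring)

context coeff_pair
begin

abbreviation multR (infixl \<open>\<star>\<^sub>R\<close> 70) where "A \<star>\<^sub>R B \<equiv> mat_mult R 3 A B"
abbreviation multS (infixl \<open>\<star>\<^sub>S\<close> 70) where "A \<star>\<^sub>S B \<equiv> mat_mult S 3 A B"
abbreviation E where "E \<equiv> mat_elem R 3"

text \<open>The algebraic content of a lift. It is stable under conjugation by matrices reducing to
  1, and only such conjugations are made.\<close>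

definition residual_rep :: "((nat \<Rightarrow> nat \<Rightarrow> 'r) \<Rightarrow> nat \<Rightarrow> nat \<Rightarrow> 's) \<Rightarrow> bool" where
  "residual_rep \<theta> \<longleftrightarrow> (\<forall>g\<in>SLn R 3. \<theta> g \<in> Units (mat_ring S 3)) \<and>
     (\<forall>g\<in>SLn R 3. \<forall>h\<in>SLn R 3. \<theta> (g \<star>\<^sub>R h) = \<theta> g \<star>\<^sub>S \<theta> h) \<and>
     (\<forall>g\<in>SLn R 3. S.Red (\<theta> g) = R.Red g)"

definition conj_rep :: "(nat \<Rightarrow> nat \<Rightarrow> 's) \<Rightarrow> ((nat \<Rightarrow> nat \<Rightarrow> 'r) \<Rightarrow> nat \<Rightarrow> nat \<Rightarrow> 's) \<Rightarrow>
    (nat \<Rightarrow> nat \<Rightarrow> 'r) \<Rightarrow> nat \<Rightarrow> nat \<Rightarrow> 's" where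
  "conj_rep P \<theta> = (\<lambda>g. P \<star>\<^sub>S \<theta> g \<star>\<^sub>S inv\<^bsub>mat_ring S 3\<^esub> P)"

lemma rep_mult: "residual_rep \<theta> \<Longrightarrow> g \<in> SLn R 3 \<Longrightarrow> h \<in> SLn R 3 \<Longrightarrow> \<theta> (g \<star>\<^sub>R h) = \<theta> g \<star>\<^sub>S \<theta> h"
  unfolding residual_rep_def by blast

lemma rep_Unit: "residual_rep \<theta> \<Longrightarrow> g \<in> SLn R 3 \<Longrightarrow> \<theta> g \<in> Units (mat_ring S 3)"
  unfolding residual_rep_def by blast

lemma rep_closed: "residual_rep \<theta> \<Longrightarrow> g \<in> SLn R 3 \<Longrightarrow> \<theta> g \<in> mat_carrier S 3"
  using MS.Units_closed[OF rep_Unit] by simp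

lemma rep_entry_closed: "residual_rep \<theta> \<Longrightarrow> g \<in> SLn R 3 \<Longrightarrow> \<theta> g i j \<in> carrier S"
  using S.red.R.mat_entry_closed[OF rep_closed] .

lemma rep_Red: "residual_rep \<theta> \<Longrightarrow> g \<in> SLn R 3 \<Longrightarrow> S.Red (\<theta> g) = R.Red g"
  unfolding residual_rep_def by blast

lemma rep_entry_red:
  "residual_rep \<theta> \<Longrightarrow> g \<in> SLn R 3 \<Longrightarrow> i < 3 \<Longrightarrow> j < 3 \<Longrightarrow> \<sigma> (\<theta> g i j) = \<rho> (g i j)"
  using rep_Red[of \<theta> g] S.red.mat_map_entry[of i 3 j "\<theta> g"] R.red.mat_map_entry[of i 3 j g] by simp

lemma rep_commute:
  "residual_rep \<theta> \<Longrightarrow> g \<in> SLn R 3 \<Longrightarrow> h \<in> SLn R 3 \<Longrightarrow> g \<star>\<^sub>R h = h \<star>\<^sub>R g \<Longrightarrow> \<theta> g \<star>\<^sub>S \<theta> h = \<theta> h \<star>\<^sub>S \<theta> g"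
  by (metis rep_mult)

lemma rep_one:
  assumes "residual_rep \<theta>"
  shows "\<theta> (mat_one R 3) = mat_one S 3"
proof -
  have one: "mat_one R 3 \<in> SLn R 3" by (rule R.red.R.mat_one_in_SLn)
  interpret MR: ring "mat_ring R 3" by (rule R.red.R.ring_mat_ring)
  have "mat_one R 3 \<star>\<^sub>R mat_one R 3 = mat_one R 3" using MR.l_one[of "mat_one R 3"] by simp
  then have "\<theta> (mat_one R 3) \<star>\<^sub>S \<theta> (mat_one R 3) = \<theta> (mat_one R 3) \<star>\<^sub>S mat_one S 3"
    using rep_mult[OF assms one one] MS.r_one[of "\<theta> (mat_one R 3)"] rep_closed[OF assms one] by simp
  then show ?thesis
    using MS.Units_l_cancel[of "\<theta> (mat_one R 3)" "\<theta> (mat_one R 3)" "mat_one S 3"]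
      rep_Unit[OF assms one] rep_closed[OF assms one] by simp
qed

lemma diag_pow_in_SLn:
  fixes n :: nat
  assumes "\<And>i. i < 3 \<Longrightarrow> d i \<in> carrier R" "d 0 \<otimes>\<^bsub>R\<^esub> (d 1 \<otimes>\<^bsub>R\<^esub> d 2) = \<one>\<^bsub>R\<^esub>"
  shows "mat_diag R 3 (\<lambda>i. d i [^]\<^bsub>R\<^esub> n) \<in> SLn R 3"
proof (rule R.red.R.mat_diag_in_SLn)
  show "d 0 [^]\<^bsub>R\<^esub> n \<otimes>\<^bsub>R\<^esub> (d 1 [^]\<^bsub>R\<^esub> n \<otimes>\<^bsub>R\<^esub> d 2 [^]\<^bsub>R\<^esub> n) = \<one>\<^bsub>R\<^esub>"
    using assms by (simp flip: R.red.R.nat_pow_distrib)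
qed (use assms in auto)

lemma rep_diag_pow:
  fixes n :: nat
  assumes "residual_rep \<theta>" "\<And>i. i < 3 \<Longrightarrow> d i \<in> carrier R" "d 0 \<otimes>\<^bsub>R\<^esub> (d 1 \<otimes>\<^bsub>R\<^esub> d 2) = \<one>\<^bsub>R\<^esub>"
  shows "\<theta> (mat_diag R 3 d) [^]\<^bsub>mat_ring S 3\<^esub> n = \<theta> (mat_diag R 3 (\<lambda>i. d i [^]\<^bsub>R\<^esub> n))"
proof (induct n)
  case 0 then show ?case using rep_one[OF assms(1)] by (simp add: R.red.R.mat_one_eq_diag)
next
  case (Suc n)
  have "mat_diag R 3 (\<lambda>i. d i [^]\<^bsub>R\<^esub> Suc n) = mat_diag R 3 (\<lambda>i. d i [^]\<^bsub>R\<^esub> n) \<star>\<^sub>R mat_diag R 3 d"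
    using assms(2) by (simp add: R.red.R.mat_diag_mult)
  then show ?case
    using Suc rep_mult[OF assms(1) diag_pow_in_SLn[OF assms(2,3)] R.red.R.mat_diag_in_SLn[OF assms(2,3)]]
    by simp
qed

lemma conj_rep:
  assumes "residual_rep \<theta>" "P \<in> mat_carrier S 3" "S.Red P = mat_one K 3"
  shows "residual_rep (conj_rep P \<theta>)"
proof -
  have U: "P \<in> Units (mat_ring S 3)" by (rule S.Red_one_Unit) fact+
  define Q where "Q = inv\<^bsub>mat_ring S 3\<^esub> P"
  have Q: "Q \<in> mat_carrier S 3" "Q \<star>\<^sub>S P = mat_one S 3" "P \<star>\<^sub>S Q = mat_one S 3"
    "Q \<in> Units (mat_ring S 3)"
    using U MS.Units_inv_closed[OF U] MS.Units_l_inv[OF U] MS.Units_r_inv[OF U] by (simp_all add: Q_def)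
  interpret MK: ring "mat_ring K 3" by (rule R.K.ring_mat_ring)
  have RQ: "S.Red Q = mat_one K 3"
    using S.red.mat_map_mult[OF Q(1) assms(2)] MK.r_one[of "S.Red Q"] Q(1)
    by (simp add: Q(2) assms(3) S.red.mat_map_one)
  note assoc = S.red.R.mat_mult_assoc and cl = S.red.R.mat_mult_closed
  show ?thesis
    unfolding residual_rep_def conj_rep_def Q_def[symmetric]
  proof (intro conjI ballI)
    fix g assume g: "g \<in> SLn R 3"
    note gc = rep_closed[OF assms(1) g]
    show "P \<star>\<^sub>S \<theta> g \<star>\<^sub>S Q \<in> Units (mat_ring S 3)"
      using MS.Units_m_closed[OF MS.Units_m_closed[OF U rep_Unit[OF assms(1) g]] Q(4)] by simp
    show "S.Red (P \<star>\<^sub>S \<theta> g \<star>\<^sub>S Q) = R.Red g"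
      using gc assms(2) Q(1) RQ assms(3) rep_Red[OF assms(1) g]
        MK.r_one[of "S.Red (\<theta> g)"] MK.l_one[of "S.Red (\<theta> g)"]
        R.red.mat_map_closed[OF R.red.R.SLn_closed[OF g]]
      by (simp add: S.red.mat_map_mult)
    fix h assume h: "h \<in> SLn R 3"
    note hc = rep_closed[OF assms(1) h]
    have "P \<star>\<^sub>S \<theta> g \<star>\<^sub>S Q \<star>\<^sub>S (P \<star>\<^sub>S \<theta> h \<star>\<^sub>S Q) = P \<star>\<^sub>S \<theta> g \<star>\<^sub>S ((Q \<star>\<^sub>S P) \<star>\<^sub>S (\<theta> h \<star>\<^sub>S Q))"
      using gc hc assms(2) Q(1) by (simp add: assoc)
    also have "(Q \<star>\<^sub>S P) \<star>\<^sub>S (\<theta> h \<star>\<^sub>S Q) = \<theta> h \<star>\<^sub>S Q"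
      using MS.l_one[of "\<theta> h \<star>\<^sub>S Q"] hc Q by simp
    finally show "P \<star>\<^sub>S \<theta> (g \<star>\<^sub>R h) \<star>\<^sub>S Q = P \<star>\<^sub>S \<theta> g \<star>\<^sub>S Q \<star>\<^sub>S (P \<star>\<^sub>S \<theta> h \<star>\<^sub>S Q)"
      using gc hc assms(2) Q(1) by (simp add: rep_mult[OF assms(1) g h] assoc)
  qed
qed

text \<open>Conjugates are identified through an intertwining relation, which is the form in which
  averaging delivers them.\<close>

lemma conj_rep_eq:
  assumes "residual_rep \<theta>" "P \<in> mat_carrier S 3" "S.Red P = mat_one K 3" "g \<in> SLn R 3"
    and "D \<in> mat_carrier S 3" "D \<star>\<^sub>S P = P \<star>\<^sub>S \<theta> g"
  shows "conj_rep P \<theta> g = D"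
proof -
  have U: "P \<in> Units (mat_ring S 3)" by (rule S.Red_one_Unit) fact+
  show ?thesis
    unfolding conj_rep_def assms(6)[symmetric]
    using MS.Units_inv_closed[OF U] MS.Units_r_inv[OF U] MS.r_one[of D] assms(1-5)
    by (simp add: S.red.R.mat_mult_assoc)
qed

definition conjugate :: "((nat \<Rightarrow> nat \<Rightarrow> 'r) \<Rightarrow> nat \<Rightarrow> nat \<Rightarrow> 's) \<Rightarrow>
    ((nat \<Rightarrow> nat \<Rightarrow> 'r) \<Rightarrow> nat \<Rightarrow> nat \<Rightarrow> 's) \<Rightarrow> bool" where
  "conjugate \<theta> \<theta>' \<longleftrightarrow> (\<exists>P\<in>mat_carrier S 3. \<exists>Q\<in>mat_carrier S 3.
     S.Red P = mat_one K 3 \<and> P \<star>\<^sub>S Q = mat_one S 3 \<and> Q \<star>\<^sub>S P = mat_one S 3 \<and>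
     (\<forall>g\<in>SLn R 3. \<theta>' g = P \<star>\<^sub>S \<theta> g \<star>\<^sub>S Q))"

lemma conjugate_conj_rep:
  assumes "P \<in> mat_carrier S 3" "S.Red P = mat_one K 3"
  shows "conjugate \<theta> (conj_rep P \<theta>)"
proof -
  have U: "P \<in> Units (mat_ring S 3)" by (rule S.Red_one_Unit) fact+
  show ?thesis
    unfolding conjugate_def conj_rep_def
    using assms MS.Units_inv_closed[OF U] MS.Units_r_inv[OF U] MS.Units_l_inv[OF U]
    by (intro bexI[of _ P] bexI[of _ "inv\<^bsub>mat_ring S 3\<^esub> P"]) simp_all
qed

lemma conjugate_trans:
  assumes "conjugate \<theta> \<theta>'" "conjugate \<theta>' \<theta>''" "\<And>g. g \<in> SLn R 3 \<Longrightarrow> \<theta> g \<in> mat_carrier S 3"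
  shows "conjugate \<theta> \<theta>''"
proof -
  interpret MK: ring "mat_ring K 3" by (rule R.K.ring_mat_ring)
  obtain P Q where P: "P \<in> mat_carrier S 3" "Q \<in> mat_carrier S 3" "S.Red P = mat_one K 3"
    "P \<star>\<^sub>S Q = mat_one S 3" "Q \<star>\<^sub>S P = mat_one S 3" "\<And>g. g \<in> SLn R 3 \<Longrightarrow> \<theta>' g = P \<star>\<^sub>S \<theta> g \<star>\<^sub>S Q"
    using assms(1) unfolding conjugate_def by blast
  obtain P' Q' where P': "P' \<in> mat_carrier S 3" "Q' \<in> mat_carrier S 3" "S.Red P' = mat_one K 3"
    "P' \<star>\<^sub>S Q' = mat_one S 3" "Q' \<star>\<^sub>S P' = mat_one S 3" "\<And>g. g \<in> SLn R 3 \<Longrightarrow> \<theta>'' g = P' \<star>\<^sub>S \<theta>' g \<star>\<^sub>S Q'"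
    using assms(2) unfolding conjugate_def by blast
  note assoc = S.red.R.mat_mult_assoc and cl = S.red.R.mat_mult_closed
  have "P' \<star>\<^sub>S P \<star>\<^sub>S (Q \<star>\<^sub>S Q') = P' \<star>\<^sub>S (P \<star>\<^sub>S Q) \<star>\<^sub>S Q'"
    "Q \<star>\<^sub>S Q' \<star>\<^sub>S (P' \<star>\<^sub>S P) = Q \<star>\<^sub>S (Q' \<star>\<^sub>S P') \<star>\<^sub>S P"
    using P(1,2) P'(1,2) by (simp_all add: assoc)
  then have "P' \<star>\<^sub>S P \<star>\<^sub>S (Q \<star>\<^sub>S Q') = mat_one S 3" "Q \<star>\<^sub>S Q' \<star>\<^sub>S (P' \<star>\<^sub>S P) = mat_one S 3"
    using P P' MS.r_one[of P'] MS.r_one[of Q] by simp_all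
  moreover have "S.Red (P' \<star>\<^sub>S P) = mat_one K 3"
    using P P' MK.r_one[of "mat_one K 3"] by (simp add: S.red.mat_map_mult)
  moreover have "\<theta>'' g = P' \<star>\<^sub>S P \<star>\<^sub>S \<theta> g \<star>\<^sub>S (Q \<star>\<^sub>S Q')" if "g \<in> SLn R 3" for g
    using P(1,2) P'(1,2) assms(3)[OF that] by (simp add: P(6) P'(6) that assoc)
  ultimately show ?thesis
    unfolding conjugate_def using P P' cl by (intro bexI[of _ "P' \<star>\<^sub>S P"] bexI[of _ "Q \<star>\<^sub>S Q'"]) auto
qed

lemma conjugate_sym:
  assumes "conjugate \<theta> \<theta>'" "\<And>g. g \<in> SLn R 3 \<Longrightarrow> \<theta> g \<in> mat_carrier S 3"
  shows "conjugate \<theta>' \<theta>"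
proof -
  interpret MK: ring "mat_ring K 3" by (rule R.K.ring_mat_ring)
  obtain P Q where P: "P \<in> mat_carrier S 3" "Q \<in> mat_carrier S 3" "S.Red P = mat_one K 3"
    "P \<star>\<^sub>S Q = mat_one S 3" "Q \<star>\<^sub>S P = mat_one S 3" "\<And>g. g \<in> SLn R 3 \<Longrightarrow> \<theta>' g = P \<star>\<^sub>S \<theta> g \<star>\<^sub>S Q"
    using assms(1) unfolding conjugate_def by blast
  note assoc = S.red.R.mat_mult_assoc and cl = S.red.R.mat_mult_closed
  have "S.Red Q = mat_one K 3"
    using S.red.mat_map_mult[OF P(2,1)] MK.r_one[of "S.Red Q"] P by (simp add: S.red.mat_map_one)
  moreover have "\<theta> g = Q \<star>\<^sub>S \<theta>' g \<star>\<^sub>S P" if "g \<in> SLn R 3" for g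
  proof -
    have "Q \<star>\<^sub>S \<theta>' g \<star>\<^sub>S P = (Q \<star>\<^sub>S P) \<star>\<^sub>S \<theta> g \<star>\<^sub>S (Q \<star>\<^sub>S P)"
      using P(1,2) assms(2)[OF that] by (simp add: P(6) that assoc)
    then show ?thesis
      using P(5) assms(2)[OF that] MS.l_one[of "\<theta> g"] MS.r_one[of "\<theta> g"] by simp
  qed
  ultimately show ?thesis
    unfolding conjugate_def using P by (intro bexI[of _ Q] bexI[of _ P]) auto
qed

text \<open>The image of the torus element and the diagonal matrix of roots of unity have the same
  reduction, and their N-th powers are 1, so \<open>conj_average\<close> intertwines them.\<close>

lemma diagonalize:
  assumes \<theta>: "residual_rep \<theta>"
    and d: "\<And>i. i < 3 \<Longrightarrow> d i \<in> carrier R" "d 0 \<otimes>\<^bsub>R\<^esub> (d 1 \<otimes>\<^bsub>R\<^esub> d 2) = \<one>\<^bsub>R\<^esub>"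
      "\<And>i. i < 3 \<Longrightarrow> d i [^]\<^bsub>R\<^esub> R.ord_mult = \<one>\<^bsub>R\<^esub>"
    and e: "\<And>i. i < 3 \<Longrightarrow> e i \<in> carrier S" "\<And>i. i < 3 \<Longrightarrow> e i [^]\<^bsub>S\<^esub> R.ord_mult = \<one>\<^bsub>S\<^esub>"
      "\<And>i. i < 3 \<Longrightarrow> \<sigma> (e i) = \<rho> (d i)"
  obtains P where "P \<in> mat_carrier S 3" "S.Red P = mat_one K 3"
    "conj_rep P \<theta> (mat_diag R 3 d) = mat_diag S 3 e"
    "\<And>Z. Z \<in> mat_carrier S 3 \<Longrightarrow> Z \<star>\<^sub>S mat_diag S 3 e = mat_diag S 3 e \<star>\<^sub>S Z \<Longrightarrow>
      Z \<star>\<^sub>S \<theta> (mat_diag R 3 d) = \<theta> (mat_diag R 3 d) \<star>\<^sub>S Z \<Longrightarrow> Z \<star>\<^sub>S P = P \<star>\<^sub>S Z"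
proof -
  let ?D = "mat_diag S 3 e" and ?M = "\<theta> (mat_diag R 3 d)"
  have t: "mat_diag R 3 d \<in> SLn R 3" using d by (intro R.red.R.mat_diag_in_SLn)
  have D: "?D \<in> mat_carrier S 3" using e by auto
  have M: "?M \<in> mat_carrier S 3" using \<theta> t by (rule rep_closed)
  have red: "S.Red ?D = S.Red ?M"
    unfolding rep_Red[OF \<theta> t] S.red.mat_map_diag R.red.mat_map_diag
    using e by (intro R.K.mat_diag_cong)
  have DN: "?D [^]\<^bsub>mat_ring S 3\<^esub> R.ord_mult = mat_one S 3"
  proof -
    have "?D [^]\<^bsub>mat_ring S 3\<^esub> R.ord_mult = mat_diag S 3 (\<lambda>i. e i [^]\<^bsub>S\<^esub> R.ord_mult)"
      using e(1) by (rule S.red.R.mat_diag_pow)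
    also have "\<dots> = mat_one S 3"
      unfolding S.red.R.mat_one_eq_diag using e by (intro S.red.R.mat_diag_cong)
    finally show ?thesis .
  qed
  have "mat_diag R 3 (\<lambda>i. d i [^]\<^bsub>R\<^esub> R.ord_mult) = mat_one R 3"
    unfolding R.red.R.mat_one_eq_diag using d by (intro R.red.R.mat_diag_cong)
  then have MN: "?M [^]\<^bsub>mat_ring S 3\<^esub> R.ord_mult = mat_one S 3"
    using rep_diag_pow[OF \<theta> d(1,2)] rep_one[OF \<theta>] by simp
  obtain P where P: "P \<in> mat_carrier S 3" "S.Red P = mat_one K 3" "?D \<star>\<^sub>S P = P \<star>\<^sub>S ?M"
    "\<And>Z. Z \<in> mat_carrier S 3 \<Longrightarrow> Z \<star>\<^sub>S ?D = ?D \<star>\<^sub>S Z \<Longrightarrow> Z \<star>\<^sub>S ?M = ?M \<star>\<^sub>S Z \<Longrightarrow> Z \<star>\<^sub>S P = P \<star>\<^sub>S Z"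
    using S.conj_average[OF D M red DN MN] by blast
  show thesis
    by (rule that[OF P(1,2) conj_rep_eq[OF \<theta> P(1,2) t D P(3)] P(4)])
qed

end

lemma (in cring) Unit_mult_zeroD:
  assumes "u \<in> Units R" "x \<in> carrier R" "u \<otimes> x = \<zero>"
  shows "x = \<zero>"
  using Units_l_cancel[of u x \<zero>] assms by (simp add: Units_closed)

text \<open>Meant for an entry of a matrix that commutes with a diagonal matrix: it vanishes when
  the two eigenvalues concerned differ by a unit.\<close>

lemma (in cring) mult_eq_mult_comm_imp_zero:
  assumes "x \<in> carrier R" "a \<in> carrier R" "b \<in> carrier R" "x \<otimes> b = a \<otimes> x" "b \<ominus> a \<in> Units R"
  shows "x = \<zero>"
proof (rule Unit_mult_zeroD[OF assms(5,1)])
  have "(b \<ominus> a) \<otimes> x = x \<otimes> b \<ominus> a \<otimes> x" using assms(1-3) by algebra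
  then show "(b \<ominus> a) \<otimes> x = \<zero>" using assms(1-4) by (simp add: minus_eq r_neg)
qed

lemma (in cring) Unit_cancel_comm:
  assumes "u \<in> Units R" "x \<in> carrier R" "y \<in> carrier R" "x \<otimes> u = u \<otimes> y"
  shows "x = y"
  using Units_l_cancel[of u x y] assms by (simp add: Units_closed m_comm)

section \<open>Images of elementary matrices\<close>

text \<open>The span of the identity and the matrix unit (i,j); the scalar \<open>A i i\<close> is
  left open at this stage.\<close>

definition elem_shape :: "('a, 'b) ring_scheme \<Rightarrow> nat \<Rightarrow> nat \<Rightarrow> (nat \<Rightarrow> nat \<Rightarrow> 'a) \<Rightarrow> bool" where
  "elem_shape R i j A \<longleftrightarrow> (\<forall>a<3. A a a = A i i) \<and>
     (\<forall>a<3. \<forall>b<3. a \<noteq> b \<longrightarrow> (a, b) \<noteq> (i, j) \<longrightarrow> A a b = \<zero>\<^bsub>R\<^esub>)"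

lemma elem_shapeI:
  assumes "{..<3} = {i, j, k}" "A j j = A i i" "A k k = A i i"
    "A i k = \<zero>\<^bsub>R\<^esub>" "A j i = \<zero>\<^bsub>R\<^esub>" "A j k = \<zero>\<^bsub>R\<^esub>" "A k i = \<zero>\<^bsub>R\<^esub>" "A k j = \<zero>\<^bsub>R\<^esub>"
  shows "elem_shape R i j A"
proof -
  have "a = i \<or> a = j \<or> a = k" if "a < 3" for a :: nat
    using that assms(1) by (metis insertE lessThan_iff singletonD)
  then show ?thesis unfolding elem_shape_def using assms(2-) by metis
qed

context coeff_pair
begin

lemma E_in_SLn: "r \<in> carrier R \<Longrightarrow> i < 3 \<Longrightarrow> j < 3 \<Longrightarrow> i \<noteq> j \<Longrightarrow> E i j r \<in> SLn R 3"
  by (rule R.red.R.mat_elem_in_SLn)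

lemma rep_elem_red:
  assumes "residual_rep \<theta>" "r \<in> carrier R" "i < 3" "j < 3" "i \<noteq> j" "a < 3" "b < 3"
  shows "\<sigma> (\<theta> (E i j r) a b) = (if a = b then \<one>\<^bsub>K\<^esub> else if a = i \<and> b = j then \<rho> r else \<zero>\<^bsub>K\<^esub>)"
  unfolding rep_entry_red[OF assms(1) E_in_SLn[OF assms(2-5)] assms(6,7)]
  using assms by (simp add: mat_elem_def)

text \<open>Commuting with a diagonal matrix that separates coordinate \<open>k\<close> makes the
  image of each \<open>E i j r\<close> avoiding \<open>k\<close> block diagonal. This applies to all
  three roots involved. The unit entry (i,k) of \<open>?B\<close> then forces the entry (j,i) of
  \<open>?M\<close> to vanish and its diagonal entries at \<open>i\<close> and \<open>k\<close> to
  agree; the unit entry (k,j) of \<open>?C\<close> identifies those at \<open>k\<close> and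
  \<open>j\<close>.\<close>

lemma block_rep_elem_shape:
  assumes \<theta>: "residual_rep \<theta>"
    and ex: "\<And>k. k < 3 \<Longrightarrow> \<exists>D. (\<forall>l<3. D l \<in> carrier S) \<and> (\<forall>l<3. l \<noteq> k \<longrightarrow> D l \<ominus>\<^bsub>S\<^esub> D k \<in> Units S \<and> D k \<ominus>\<^bsub>S\<^esub> D l \<in> Units S) \<and>
      (\<forall>i<3. \<forall>j<3. \<forall>r\<in>carrier R. i \<noteq> j \<longrightarrow> i \<noteq> k \<longrightarrow> j \<noteq> k \<longrightarrow>
        \<theta> (E i j r) \<star>\<^sub>S mat_diag S 3 D = mat_diag S 3 D \<star>\<^sub>S \<theta> (E i j r))"
    and ij: "i < 3" "j < 3" "i \<noteq> j" and r: "r \<in> carrier R"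
  shows "elem_shape S i j (\<theta> (E i j r))"
proof -
  have vanish: "\<theta> (E i j r) a k = \<zero>\<^bsub>S\<^esub> \<and> \<theta> (E i j r) k a = \<zero>\<^bsub>S\<^esub>"
    if *: "i < 3" "j < 3" "k < 3" "i \<noteq> j" "i \<noteq> k" "j \<noteq> k" "r \<in> carrier R" "a < 3" "a \<noteq> k" for i j k r a
  proof -
    obtain D where D: "\<And>l. l < 3 \<Longrightarrow> D l \<in> carrier S"
      "\<And>l. l < 3 \<Longrightarrow> l \<noteq> k \<Longrightarrow> D l \<ominus>\<^bsub>S\<^esub> D k \<in> Units S \<and> D k \<ominus>\<^bsub>S\<^esub> D l \<in> Units S"
      "\<theta> (E i j r) \<star>\<^sub>S mat_diag S 3 D = mat_diag S 3 D \<star>\<^sub>S \<theta> (E i j r)"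
      using ex[OF *(3)] * by metis
    have M: "\<theta> (E i j r) \<in> mat_carrier S 3" using * \<theta> by (intro rep_closed E_in_SLn)
    have eq: "\<theta> (E i j r) x y \<otimes>\<^bsub>S\<^esub> D y = D x \<otimes>\<^bsub>S\<^esub> \<theta> (E i j r) x y" if "x < 3" "y < 3" for x y
      using S.red.R.mat_diag_mult_entry[of D, OF D(1) M that] D(3) by simp
    note cl = S.red.R.mat_entry_closed[OF M]
    show ?thesis
      using S.red.R.mult_eq_mult_comm_imp_zero[OF cl D(1) D(1) eq] D(2) * by blast
  qed
  obtain k where k: "k < 3" "k \<noteq> i" "k \<noteq> j" "{..<3} = {i, j, k}"
    using third_index[OF ij] by blast
  note entry = S.red.R.mat_mult_entry_gen[OF _ _ _ _ k(4) ij(3) k(2)[symmetric] k(3)[symmetric]]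
  let ?M = "\<theta> (E i j r)" and ?B = "\<theta> (E i k \<one>\<^bsub>R\<^esub>)" and ?C = "\<theta> (E k j \<one>\<^bsub>R\<^esub>)"
  have SL: "E i j r \<in> SLn R 3" "E i k \<one>\<^bsub>R\<^esub> \<in> SLn R 3" "E k j \<one>\<^bsub>R\<^esub> \<in> SLn R 3"
    using ij k r by (auto intro: E_in_SLn)
  note closed = SL[THEN rep_closed[OF \<theta>]]
  note [simp] = closed[THEN S.red.R.mat_entry_closed]
  have MB: "?M \<star>\<^sub>S ?B = ?B \<star>\<^sub>S ?M" and MC: "?M \<star>\<^sub>S ?C = ?C \<star>\<^sub>S ?M"
    using SL ij k r by (auto intro!: rep_commute[OF \<theta>] R.red.R.mat_elem_commute)
  have BU: "?B i k \<in> Units S" and CU: "?C k j \<in> Units S"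
    using ij k by (simp_all add: S.Units_iff rep_elem_red[OF \<theta>])
  have M0: "?M i k = \<zero>\<^bsub>S\<^esub>" "?M k i = \<zero>\<^bsub>S\<^esub>" "?M j k = \<zero>\<^bsub>S\<^esub>" "?M k j = \<zero>\<^bsub>S\<^esub>"
    using vanish[OF ij(1,2) k(1) ij(3) k(2,3)[symmetric] r] ij k by auto
  have B0: "?B i j = \<zero>\<^bsub>S\<^esub>" "?B j i = \<zero>\<^bsub>S\<^esub>" "?B j k = \<zero>\<^bsub>S\<^esub>" "?B k j = \<zero>\<^bsub>S\<^esub>"
    using vanish[of i k j "\<one>\<^bsub>R\<^esub>"] ij k by auto
  have C0: "?C i j = \<zero>\<^bsub>S\<^esub>" "?C j i = \<zero>\<^bsub>S\<^esub>" "?C i k = \<zero>\<^bsub>S\<^esub>" "?C k i = \<zero>\<^bsub>S\<^esub>"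
    using vanish[of k j i "\<one>\<^bsub>R\<^esub>"] ij k by auto
  have "?M j i \<otimes>\<^bsub>S\<^esub> ?B i k = ?B i k \<otimes>\<^bsub>S\<^esub> \<zero>\<^bsub>S\<^esub>"
    using arg_cong[OF MB, of "\<lambda>A. A j k"] closed ij k by (simp add: entry M0 B0)
  then have "?M j i = \<zero>\<^bsub>S\<^esub>" by (rule S.red.R.Unit_cancel_comm[OF BU, rotated 2]) simp_all
  moreover have "?M i i \<otimes>\<^bsub>S\<^esub> ?B i k = ?B i k \<otimes>\<^bsub>S\<^esub> ?M k k"
    using arg_cong[OF MB, of "\<lambda>A. A i k"] closed ij k by (simp add: entry M0 B0)
  then have "?M i i = ?M k k" by (rule S.red.R.Unit_cancel_comm[OF BU, rotated 2]) simp_all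
  moreover have "?M k k \<otimes>\<^bsub>S\<^esub> ?C k j = ?C k j \<otimes>\<^bsub>S\<^esub> ?M j j"
    using arg_cong[OF MC, of "\<lambda>A. A k j"] closed ij k by (simp add: entry M0 C0)
  then have "?M k k = ?M j j" by (rule S.red.R.Unit_cancel_comm[OF CU, rotated 2]) simp_all
  ultimately show ?thesis using M0 by (intro elem_shapeI[OF k(4)]) simp_all
qed

text \<open>\<open>Y\<close> and \<open>Z\<close> are components of one weight under a torus of order three, for which the three roots
  \<open>(i,k)\<close>, \<open>(k,j)\<close>, \<open>(j,i)\<close> have equal weight.\<close>
lemma commute_imp_elem_shape:
  assumes M: "M \<in> mat_carrier S 3" and Y: "Y \<in> mat_carrier S 3" and Z: "Z \<in> mat_carrier S 3"
    and ijk: "i < 3" "j < 3" "k < 3" "i \<noteq> j" "i \<noteq> k" "j \<noteq> k"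
    and Y0: "\<And>a b. a < 3 \<Longrightarrow> b < 3 \<Longrightarrow> (a, b) \<notin> {(i, k), (k, j), (j, i)} \<Longrightarrow> Y a b = \<zero>\<^bsub>S\<^esub>"
    and Z0: "\<And>a b. a < 3 \<Longrightarrow> b < 3 \<Longrightarrow> (a, b) \<notin> {(i, k), (k, j), (j, i)} \<Longrightarrow> Z a b = \<zero>\<^bsub>S\<^esub>"
    and U: "Y i k \<in> Units S" "Z k j \<in> Units S" "\<sigma> (Z i k) = \<zero>\<^bsub>K\<^esub>"
    and MY: "M \<star>\<^sub>S Y = Y \<star>\<^sub>S M" and MZ: "M \<star>\<^sub>S Z = Z \<star>\<^sub>S M"
  shows "elem_shape S i j M"
proof -
  have I: "{..<3} = {i, j, k}" using ijk by (auto; linarith)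
  note entry = S.red.R.mat_mult_entry_gen[OF _ _ _ _ I ijk(4-6)]
  note [simp] = M[THEN S.red.R.mat_entry_closed] Y[THEN S.red.R.mat_entry_closed] Z[THEN S.red.R.mat_entry_closed]
  have Y0': "Y i i = \<zero>\<^bsub>S\<^esub>" "Y j j = \<zero>\<^bsub>S\<^esub>" "Y k k = \<zero>\<^bsub>S\<^esub>" "Y i j = \<zero>\<^bsub>S\<^esub>" "Y j k = \<zero>\<^bsub>S\<^esub>" "Y k i = \<zero>\<^bsub>S\<^esub>"
    and Z0': "Z i i = \<zero>\<^bsub>S\<^esub>" "Z j j = \<zero>\<^bsub>S\<^esub>" "Z k k = \<zero>\<^bsub>S\<^esub>" "Z i j = \<zero>\<^bsub>S\<^esub>" "Z j k = \<zero>\<^bsub>S\<^esub>" "Z k i = \<zero>\<^bsub>S\<^esub>"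
    using ijk by (auto intro!: Y0 Z0)
  have eqY: "(M \<star>\<^sub>S Y) a b = (Y \<star>\<^sub>S M) a b" and eqZ: "(M \<star>\<^sub>S Z) a b = (Z \<star>\<^sub>S M) a b" for a b
    by (simp_all add: MY MZ)
  have Yij: "M i k \<otimes>\<^bsub>S\<^esub> Y k j = Y i k \<otimes>\<^bsub>S\<^esub> M k j" using eqY[of i j] ijk M Y by (simp add: entry Y0')
  have Zij: "M i k \<otimes>\<^bsub>S\<^esub> Z k j = Z i k \<otimes>\<^bsub>S\<^esub> M k j" using eqZ[of i j] ijk M Z by (simp add: entry Z0')
  have Yjk: "M j i \<otimes>\<^bsub>S\<^esub> Y i k = Y j i \<otimes>\<^bsub>S\<^esub> M i k" using eqY[of j k] ijk M Y by (simp add: entry Y0')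
  have Ykk: "M k i \<otimes>\<^bsub>S\<^esub> Y i k = Y k j \<otimes>\<^bsub>S\<^esub> M j k" using eqY[of k k] ijk M Y by (simp add: entry Y0')
  have Zkk: "M k i \<otimes>\<^bsub>S\<^esub> Z i k = Z k j \<otimes>\<^bsub>S\<^esub> M j k" using eqZ[of k k] ijk M Z by (simp add: entry Z0')
  have Yik: "M i i \<otimes>\<^bsub>S\<^esub> Y i k = Y i k \<otimes>\<^bsub>S\<^esub> M k k" using eqY[of i k] ijk M Y by (simp add: entry Y0')
  have Zkj: "M k k \<otimes>\<^bsub>S\<^esub> Z k j = Z k j \<otimes>\<^bsub>S\<^esub> M j j" using eqZ[of k j] ijk M Z by (simp add: entry Z0')
  \<comment> \<open>The (i,j) entries of the two commutation relations form a homogeneous 2 by 2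
    system for \<open>M i k\<close> and \<open>M k j\<close>. \<open>\<Delta>\<close> is its
    determinant up to sign, and it is a unit because \<open>Z i k\<close> vanishes
    residually.\<close>
  define \<Delta> where "\<Delta> = Y i k \<otimes>\<^bsub>S\<^esub> Z k j \<ominus>\<^bsub>S\<^esub> Z i k \<otimes>\<^bsub>S\<^esub> Y k j"
  have "\<Delta> \<in> carrier S" by (simp add: \<Delta>_def)
  moreover have "\<sigma> \<Delta> = \<sigma> (Y i k) \<otimes>\<^bsub>K\<^esub> \<sigma> (Z k j)"
    unfolding \<Delta>_def using U(3) by (simp add: S.red.R.minus_eq)
  ultimately have \<Delta>: "\<Delta> \<in> Units S"
    using U(1,2) R.K.integral[of "\<sigma> (Y i k)" "\<sigma> (Z k j)"] by (auto simp: S.Units_iff)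
  have det_zero: "\<Delta> \<otimes>\<^bsub>S\<^esub> x = \<zero>\<^bsub>S\<^esub>"
    if "x \<otimes>\<^bsub>S\<^esub> Y k j = Y i k \<otimes>\<^bsub>S\<^esub> y" "x \<otimes>\<^bsub>S\<^esub> Z k j = Z i k \<otimes>\<^bsub>S\<^esub> y" "x \<in> carrier S" "y \<in> carrier S" for x y
  proof -
    have "(a \<otimes>\<^bsub>S\<^esub> c' \<ominus>\<^bsub>S\<^esub> a' \<otimes>\<^bsub>S\<^esub> c) \<otimes>\<^bsub>S\<^esub> x = a \<otimes>\<^bsub>S\<^esub> (x \<otimes>\<^bsub>S\<^esub> c') \<ominus>\<^bsub>S\<^esub> a' \<otimes>\<^bsub>S\<^esub> (x \<otimes>\<^bsub>S\<^esub> c)"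
      "a \<otimes>\<^bsub>S\<^esub> (a' \<otimes>\<^bsub>S\<^esub> y) \<ominus>\<^bsub>S\<^esub> a' \<otimes>\<^bsub>S\<^esub> (a \<otimes>\<^bsub>S\<^esub> y) = \<zero>\<^bsub>S\<^esub>"
      if "a \<in> carrier S" "a' \<in> carrier S" "c \<in> carrier S" "c' \<in> carrier S" for a a' c c'
      using that \<open>x \<in> carrier S\<close> \<open>y \<in> carrier S\<close> by algebra+
    from this[of "Y i k" "Z i k" "Y k j" "Z k j"] show ?thesis
      unfolding \<Delta>_def using that(1,2) by simp
  qed
  have ik: "M i k = \<zero>\<^bsub>S\<^esub>"
    by (rule S.red.R.Unit_mult_zeroD[OF \<Delta> _ det_zero[OF Yij Zij]]) simp_all
  have kj: "M k j = \<zero>\<^bsub>S\<^esub>"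
    by (rule S.red.R.Unit_mult_zeroD[OF U(1)]) (use Yij ik in simp_all)
  have ji: "M j i = \<zero>\<^bsub>S\<^esub>"
    by (rule S.red.R.Unit_mult_zeroD[OF U(1)]) (use Yjk ik in \<open>simp_all add: S.red.R.m_comm\<close>)
  \<comment> \<open>The (k,k) entries give the same system, now for \<open>M j k\<close> and
    \<open>M k i\<close>.\<close>
  have jk: "M j k = \<zero>\<^bsub>S\<^esub>"
    by (rule S.red.R.Unit_mult_zeroD[OF \<Delta> _ det_zero[of _ "M k i"]]) (use Ykk Zkk in \<open>simp_all add: S.red.R.m_comm\<close>)
  have ki: "M k i = \<zero>\<^bsub>S\<^esub>"
    by (rule S.red.R.Unit_mult_zeroD[OF U(1)]) (use Ykk jk in \<open>simp_all add: S.red.R.m_comm\<close>)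
  have "M i i = M k k" "M k k = M j j"
    by (rule S.red.R.Unit_cancel_comm[OF U(1) _ _ Yik] S.red.R.Unit_cancel_comm[OF U(2) _ _ Zkj]; simp)+
  then show ?thesis using ik kj ji jk ki by (intro elem_shapeI[OF I]) simp_all
qed

end

section \<open>Weights of a torus element of order three\<close>

lemma (in cring) pow_mod_3:
  fixes n :: nat
  assumes "x \<in> carrier R" "x [^] (3::nat) = \<one>"
  shows "x [^] n = x [^] (n mod 3)"
proof -
  have "x [^] n = x [^] (3 * (n div 3) + n mod 3)" by simp
  also have "\<dots> = (x [^] (3::nat)) [^] (n div 3) \<otimes> x [^] (n mod 3)"
    using assms(1) by (simp only: nat_pow_mult nat_pow_pow nat_pow_closed)
  finally show ?thesis using assms by simp
qed

text \<open>Orthogonality of characters. From x^3 - 1 = 0 one cancels the unit x - 1 to get 1 + x +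
  x^2 = 0. Then (x - 1)^2 = -3x, so 3 is a unit as well.\<close>

lemma (in cring) cube_root_sum:
  fixes n :: nat
  assumes x: "x \<in> carrier R" "x [^] (3::nat) = \<one>" "x \<ominus> \<one> \<in> Units R"
  shows "\<one> \<oplus> (x [^] n \<oplus> x [^] (2 * n)) = (if 3 dvd n then \<one> \<oplus> (\<one> \<oplus> \<one>) else \<zero>)"
    and "\<one> \<oplus> (\<one> \<oplus> \<one>) \<in> Units R"
proof -
  have cube: "x \<otimes> (x \<otimes> x) = \<one>" using x by (simp add: numeral_3_eq_3 m_assoc)
  have "(x \<ominus> \<one>) \<otimes> (\<one> \<oplus> (x \<oplus> x \<otimes> x)) = x \<otimes> (x \<otimes> x) \<ominus> \<one>" using x(1) by algebra
  also have "\<dots> = \<zero>" by (simp add: cube minus_eq r_neg)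
  finally have sum: "\<one> \<oplus> (x \<oplus> x \<otimes> x) = \<zero>" using Unit_mult_zeroD[OF x(3)] x(1) by simp
  have "n mod 3 = 0 \<or> n mod 3 = 1 \<or> n mod 3 = 2" by linarith
  then show "\<one> \<oplus> (x [^] n \<oplus> x [^] (2 * n)) = (if 3 dvd n then \<one> \<oplus> (\<one> \<oplus> \<one>) else \<zero>)"
  proof (elim disjE)
    assume "n mod 3 = 0"
    moreover from this have "2 * n mod 3 = 0" by presburger
    ultimately show ?thesis using pow_mod_3[OF x(1,2), of n] pow_mod_3[OF x(1,2), of "2 * n"] by auto
  next
    assume "n mod 3 = 1"
    moreover from this have "2 * n mod 3 = 2" "\<not> 3 dvd n" by presburger+
    ultimately show ?thesis
      using pow_mod_3[OF x(1,2), of n] pow_mod_3[OF x(1,2), of "2 * n"] sum x(1)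
      by (simp add: numeral_2_eq_2)
  next
    assume "n mod 3 = 2"
    moreover from this have "2 * n mod 3 = 1" "\<not> 3 dvd n" by presburger+
    ultimately show ?thesis
      using pow_mod_3[OF x(1,2), of n] pow_mod_3[OF x(1,2), of "2 * n"] sum x(1)
      by (simp add: numeral_2_eq_2 a_comm)
  qed
  have "(x \<ominus> \<one>) \<otimes> (x \<ominus> \<one>) = (\<one> \<oplus> (x \<oplus> x \<otimes> x)) \<ominus> x \<otimes> (\<one> \<oplus> (\<one> \<oplus> \<one>))"
    using x(1) by algebra
  also have "\<dots> = (\<one> \<oplus> (\<one> \<oplus> \<one>)) \<otimes> (\<ominus> x)"
    unfolding sum using x(1) by algebra
  finally have "(\<one> \<oplus> (\<one> \<oplus> \<one>)) \<otimes> (\<ominus> x) \<in> Units R"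
    using Units_m_closed[OF x(3,3)] by simp
  then show "\<one> \<oplus> (\<one> \<oplus> \<one>) \<in> Units R"
    using unit_of_mult_unit[of "\<one> \<oplus> (\<one> \<oplus> \<one>)" "\<ominus> x"] x(1) by simp
qed

text \<open>Conjugation by diag(1, b, b^2) with b^3 = 1 scales the entry (a,b) by b^(a-b), and 2
  stands for -1 modulo 3. The offset \<open>k + 2 * i\<close> cancels the weight of (i,k), which
  (k,j) and (j,i) share, since i, j, k is a permutation of 0, 1, 2.\<close>

lemma weight_support:
  assumes "(i::nat) < 3" "j < 3" "k < 3" "i \<noteq> j" "i \<noteq> k" "j \<noteq> k" "a < 3" "b < 3"
  shows "3 dvd k + 2 * i + a + 2 * b \<longleftrightarrow> (a, b) \<in> {(i, k), (k, j), (j, i)}"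
proof -
  have mod_3: "3 dvd m \<longleftrightarrow> m = 0 \<or> m = 3 \<or> m = 6 \<or> m = 9 \<or> m = 12" if "m < 13" for m :: nat
    using that by presburger
  have "k + 2 * i + a + 2 * b < 13" using assms by linarith
  note mod_3 = mod_3[OF this]
  have "(i = 0 \<and> j = 1 \<and> k = 2) \<or> (i = 0 \<and> j = 2 \<and> k = 1) \<or> (i = 1 \<and> j = 0 \<and> k = 2) \<or>
    (i = 1 \<and> j = 2 \<and> k = 0) \<or> (i = 2 \<and> j = 0 \<and> k = 1) \<or> (i = 2 \<and> j = 1 \<and> k = 0)"
    using assms(1-6) by (elim less_3E) simp_all
  moreover have "a = 0 \<or> a = 1 \<or> a = 2" "b = 0 \<or> b = 1 \<or> b = 2"
    using assms(7,8) by (elim less_3E; simp)+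
  ultimately show ?thesis
    unfolding mod_3 by (elim disjE conjE; hypsubst; simp del: One_nat_def)
qed

lemma (in ring) commute_add:
  assumes "x \<in> carrier R" "y \<in> carrier R" "z \<in> carrier R" "z \<otimes> x = x \<otimes> z" "z \<otimes> y = y \<otimes> z"
  shows "z \<otimes> (x \<oplus> y) = (x \<oplus> y) \<otimes> z"
  using assms by (simp add: l_distr r_distr)

context coeff_pair
begin

definition elementary_rep :: "((nat \<Rightarrow> nat \<Rightarrow> 'r) \<Rightarrow> nat \<Rightarrow> nat \<Rightarrow> 's) \<Rightarrow> bool" where
  "elementary_rep \<theta> \<longleftrightarrow> residual_rep \<theta> \<and>
     (\<forall>i<3. \<forall>j<3. \<forall>r\<in>carrier R. i \<noteq> j \<longrightarrow> elem_shape S i j (\<theta> (E i j r)))"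

text \<open>\<open>Y\<close> is three times the projection of the image of \<open>E p q 1\<close> to
  one weight space. Conjugating by the torus element stays inside the image of the root subgroup
  (p,q), all of which commutes with \<open>M\<close>; hence the projection commutes with
  \<open>M\<close>, although \<open>M\<close> need not commute with the torus.\<close>

lemma weight_component:
  fixes n :: nat
  assumes \<theta>: "residual_rep \<theta>"
    and \<alpha>: "\<alpha> \<in> carrier R" "\<alpha> [^]\<^bsub>R\<^esub> (3::nat) = \<one>\<^bsub>R\<^esub>"
    and \<beta>: "\<beta> \<in> carrier S" "\<beta> [^]\<^bsub>S\<^esub> (3::nat) = \<one>\<^bsub>S\<^esub>" "\<beta> \<ominus>\<^bsub>S\<^esub> \<one>\<^bsub>S\<^esub> \<in> Units S"
    and T: "\<theta> (mat_diag R 3 (\<lambda>l. \<alpha> [^]\<^bsub>R\<^esub> l)) = mat_diag S 3 (\<lambda>l. \<beta> [^]\<^bsub>S\<^esub> l)"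
    and pq: "p < 3" "q < 3" "p \<noteq> q"
    and M: "M \<in> mat_carrier S 3" "\<And>s. s \<in> carrier R \<Longrightarrow> M \<star>\<^sub>S \<theta> (E p q s) = \<theta> (E p q s) \<star>\<^sub>S M"
  obtains Y where "Y \<in> mat_carrier S 3" "M \<star>\<^sub>S Y = Y \<star>\<^sub>S M"
    "\<And>a b. a < 3 \<Longrightarrow> b < 3 \<Longrightarrow> Y a b = (if 3 dvd n + a + 2 * b then \<one>\<^bsub>S\<^esub> \<oplus>\<^bsub>S\<^esub> (\<one>\<^bsub>S\<^esub> \<oplus>\<^bsub>S\<^esub> \<one>\<^bsub>S\<^esub>) else \<zero>\<^bsub>S\<^esub>) \<otimes>\<^bsub>S\<^esub> \<theta> (E p q \<one>\<^bsub>R\<^esub>) a b"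
proof -
  let ?t = "mat_diag R 3 (\<lambda>l. \<alpha> [^]\<^bsub>R\<^esub> l)" and ?D = "mat_diag S 3 (\<lambda>l. \<beta> [^]\<^bsub>S\<^esub> l)"
  \<comment> \<open>The scaling factor of the root (p,q), where the inverse of
    \<open>\<alpha>\<close> is written as its square.\<close>
  define s where "s = \<alpha> [^]\<^bsub>R\<^esub> (p + 2 * q)"
  define W where "W m = \<theta> (E p q (s [^]\<^bsub>R\<^esub> m))" for m :: nat
  have s: "s \<in> carrier R" using \<alpha> by (simp add: s_def)
  have t: "?t \<in> SLn R 3"
    using \<alpha> by (intro R.red.R.mat_diag_in_SLn) (simp_all add: numeral_2_eq_2 numeral_3_eq_3 R.red.R.m_assoc)
  have SL: "E p q (s [^]\<^bsub>R\<^esub> m) \<in> SLn R 3" for m :: nat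
    using s pq by (intro E_in_SLn) simp_all
  have Wc: "W m \<in> mat_carrier S 3" for m
    unfolding W_def by (rule rep_closed[OF \<theta> SL])
  note [simp] = Wc[THEN S.red.R.mat_entry_closed]
  have "\<alpha> [^]\<^bsub>R\<^esub> p \<otimes>\<^bsub>R\<^esub> x = s \<otimes>\<^bsub>R\<^esub> x \<otimes>\<^bsub>R\<^esub> \<alpha> [^]\<^bsub>R\<^esub> q" if x: "x \<in> carrier R" for x
  proof -
    have "s \<otimes>\<^bsub>R\<^esub> x \<otimes>\<^bsub>R\<^esub> \<alpha> [^]\<^bsub>R\<^esub> q = s \<otimes>\<^bsub>R\<^esub> \<alpha> [^]\<^bsub>R\<^esub> q \<otimes>\<^bsub>R\<^esub> x"
      using s \<alpha> x by (simp add: R.red.R.m_ac)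
    also have "s \<otimes>\<^bsub>R\<^esub> \<alpha> [^]\<^bsub>R\<^esub> q = \<alpha> [^]\<^bsub>R\<^esub> (p + 2 * q + q)"
      using \<alpha> by (simp add: s_def R.red.R.nat_pow_mult)
    also have "\<dots> = \<alpha> [^]\<^bsub>R\<^esub> (p + 3 * q)" by (simp add: algebra_simps)
    also have "\<dots> = \<alpha> [^]\<^bsub>R\<^esub> p"
      using R.red.R.pow_mod_3[OF \<alpha>, of "p + 3 * q"] R.red.R.pow_mod_3[OF \<alpha>, of p] by simp
    finally show ?thesis by simp
  qed
  then have "\<alpha> [^]\<^bsub>R\<^esub> p \<otimes>\<^bsub>R\<^esub> s [^]\<^bsub>R\<^esub> m = s [^]\<^bsub>R\<^esub> Suc m \<otimes>\<^bsub>R\<^esub> \<alpha> [^]\<^bsub>R\<^esub> q" for m :: nat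
    using s by (simp add: R.red.R.m_comm)
  then have "?t \<star>\<^sub>R E p q (s [^]\<^bsub>R\<^esub> m) = E p q (s [^]\<^bsub>R\<^esub> Suc m) \<star>\<^sub>R ?t" for m :: nat
    using \<alpha> s pq by (intro R.red.R.mat_diag_elem) (simp_all del: R.red.R.nat_pow_Suc)
  then have DW: "?D \<star>\<^sub>S W m = W (Suc m) \<star>\<^sub>S ?D" for m
    unfolding W_def T[symmetric] rep_mult[OF \<theta> t SL, symmetric] rep_mult[OF \<theta> SL t, symmetric]
    by (rule arg_cong)
  have step: "W (Suc m) a b = \<beta> [^]\<^bsub>S\<^esub> (a + 2 * b) \<otimes>\<^bsub>S\<^esub> W m a b" if "a < 3" "b < 3" for m a b
  proof -
    \<comment> \<open>Inserting the third power of the root of unity trades division by its b-th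
      power for multiplication by its 2b-th power.\<close>
    have "W (Suc m) a b = W (Suc m) a b \<otimes>\<^bsub>S\<^esub> \<beta> [^]\<^bsub>S\<^esub> (3 * b)"
      using S.red.R.pow_mod_3[OF \<beta>(1,2), of "3 * b"] by simp
    also have "\<dots> = W (Suc m) a b \<otimes>\<^bsub>S\<^esub> \<beta> [^]\<^bsub>S\<^esub> b \<otimes>\<^bsub>S\<^esub> \<beta> [^]\<^bsub>S\<^esub> (2 * b)"
      using \<beta>(1) by (simp add: S.red.R.m_assoc S.red.R.nat_pow_mult)
    also have "W (Suc m) a b \<otimes>\<^bsub>S\<^esub> \<beta> [^]\<^bsub>S\<^esub> b = \<beta> [^]\<^bsub>S\<^esub> a \<otimes>\<^bsub>S\<^esub> W m a b"
      using arg_cong[OF DW[of m], of "\<lambda>A. A a b"] that \<beta>(1)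
      by (simp add: S.red.R.mat_diag_mult_entry[OF _ Wc])
    also have "\<dots> \<otimes>\<^bsub>S\<^esub> \<beta> [^]\<^bsub>S\<^esub> (2 * b) = \<beta> [^]\<^bsub>S\<^esub> (a + 2 * b) \<otimes>\<^bsub>S\<^esub> W m a b"
      using \<beta>(1) by (simp add: S.red.R.m_ac flip: S.red.R.nat_pow_mult)
    finally show ?thesis .
  qed
  have MW: "M \<star>\<^sub>S W m = W m \<star>\<^sub>S M" for m
    unfolding W_def using M(2) s by simp
  define \<Lambda> where "\<Lambda> x = mat_diag S 3 (\<lambda>_. x)" for x
  have \<Lambda>c: "\<Lambda> x \<in> mat_carrier S 3" if "x \<in> carrier S" for x using that by (auto simp: \<Lambda>_def)
  have scale: "M \<star>\<^sub>S (\<Lambda> x \<star>\<^sub>S W m) = (\<Lambda> x \<star>\<^sub>S W m) \<star>\<^sub>S M" if "x \<in> carrier S" for x m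
  proof -
    have "M \<star>\<^sub>S (\<Lambda> x \<star>\<^sub>S W m) = \<Lambda> x \<star>\<^sub>S M \<star>\<^sub>S W m"
      using S.red.R.mat_diag_const_commute[OF that M(1)] M(1) Wc \<Lambda>c[OF that]
      by (simp add: \<Lambda>_def flip: S.red.R.mat_mult_assoc)
    then show ?thesis
      using M(1) Wc \<Lambda>c[OF that] by (simp add: S.red.R.mat_mult_assoc MW)
  qed
  let ?x = "\<beta> [^]\<^bsub>S\<^esub> n" and ?y = "\<beta> [^]\<^bsub>S\<^esub> (2 * n)"
  have xy: "?x \<in> carrier S" "?y \<in> carrier S" using \<beta> by simp_all
  \<comment> \<open>A Fourier sum over the group of order three: on the entry (a,b) it acts as 1 + w
    + w^2, where w is \<open>\<beta>\<close> to the power n + a + 2b.\<close>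
  define Y where "Y = W 0 \<oplus>\<^bsub>mat_ring S 3\<^esub> (\<Lambda> ?x \<star>\<^sub>S W 1 \<oplus>\<^bsub>mat_ring S 3\<^esub> \<Lambda> ?y \<star>\<^sub>S W 2)"
  note c = Wc \<Lambda>c[OF xy(1)] \<Lambda>c[OF xy(2)] S.red.R.mat_mult_closed
  have Z: "\<Lambda> ?x \<star>\<^sub>S W 1 \<in> carrier (mat_ring S 3)" "\<Lambda> ?y \<star>\<^sub>S W 2 \<in> carrier (mat_ring S 3)"
    "W 0 \<in> carrier (mat_ring S 3)" "M \<in> carrier (mat_ring S 3)"
    using c M(1) by simp_all
  show thesis
  proof (rule that)
    show "Y \<in> mat_carrier S 3"
      using MS.a_closed[OF Z(3) MS.a_closed[OF Z(1,2)]] by (simp add: Y_def)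
    have "M \<otimes>\<^bsub>mat_ring S 3\<^esub> Y = Y \<otimes>\<^bsub>mat_ring S 3\<^esub> M"
      unfolding Y_def using MW[of 0] scale[OF xy(1), of 1] scale[OF xy(2), of 2]
      by (intro MS.commute_add MS.a_closed Z; simp only: mat_ring_simps)
    then show "M \<star>\<^sub>S Y = Y \<star>\<^sub>S M" by simp
    fix a b :: nat assume ab: "a < 3" "b < 3"
    let ?e = "a + 2 * b" and ?w = "\<theta> (E p q \<one>\<^bsub>R\<^esub>) a b"
    have W0: "W 0 a b = ?w" by (simp add: W_def)
    have w: "?w \<in> carrier S" unfolding W0[symmetric] by simp
    have W1: "W 1 a b = \<beta> [^]\<^bsub>S\<^esub> ?e \<otimes>\<^bsub>S\<^esub> ?w" using step[OF ab, of 0] W0 by simp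
    have W2: "W 2 a b = \<beta> [^]\<^bsub>S\<^esub> (2 * ?e) \<otimes>\<^bsub>S\<^esub> ?w"
    proof -
      have "W 2 a b = \<beta> [^]\<^bsub>S\<^esub> ?e \<otimes>\<^bsub>S\<^esub> (\<beta> [^]\<^bsub>S\<^esub> ?e \<otimes>\<^bsub>S\<^esub> ?w)"
        using step[OF ab, of 1] W1 by (simp add: numeral_2_eq_2)
      also have "\<dots> = \<beta> [^]\<^bsub>S\<^esub> (?e + ?e) \<otimes>\<^bsub>S\<^esub> ?w"
        using \<beta>(1) w by (simp only: S.red.R.nat_pow_mult S.red.R.m_assoc[symmetric] S.red.R.nat_pow_closed)
      finally show ?thesis by (simp only: mult_2)
    qed
    have "Y a b = ?w \<oplus>\<^bsub>S\<^esub> (?x \<otimes>\<^bsub>S\<^esub> (\<beta> [^]\<^bsub>S\<^esub> ?e \<otimes>\<^bsub>S\<^esub> ?w) \<oplus>\<^bsub>S\<^esub> ?y \<otimes>\<^bsub>S\<^esub> (\<beta> [^]\<^bsub>S\<^esub> (2 * ?e) \<otimes>\<^bsub>S\<^esub> ?w))"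
      unfolding Y_def mat_ring_simps \<Lambda>_def
      using S.red.R.mat_diag_mult_entry(1)[OF _ Wc ab] xy by (simp only: W0 W1 W2)
    also have "\<dots> = (\<one>\<^bsub>S\<^esub> \<oplus>\<^bsub>S\<^esub> (?x \<otimes>\<^bsub>S\<^esub> \<beta> [^]\<^bsub>S\<^esub> ?e \<oplus>\<^bsub>S\<^esub> ?y \<otimes>\<^bsub>S\<^esub> \<beta> [^]\<^bsub>S\<^esub> (2 * ?e))) \<otimes>\<^bsub>S\<^esub> ?w"
    proof -
      have "w \<oplus>\<^bsub>S\<^esub> (x \<otimes>\<^bsub>S\<^esub> (u \<otimes>\<^bsub>S\<^esub> w) \<oplus>\<^bsub>S\<^esub> y \<otimes>\<^bsub>S\<^esub> (v \<otimes>\<^bsub>S\<^esub> w)) = (\<one>\<^bsub>S\<^esub> \<oplus>\<^bsub>S\<^esub> (x \<otimes>\<^bsub>S\<^esub> u \<oplus>\<^bsub>S\<^esub> y \<otimes>\<^bsub>S\<^esub> v)) \<otimes>\<^bsub>S\<^esub> w"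
        if "w \<in> carrier S" "x \<in> carrier S" "y \<in> carrier S" "u \<in> carrier S" "v \<in> carrier S" for w x y u v
        using that by algebra
      then show ?thesis using w xy \<beta>(1) by simp
    qed
    also have "\<one>\<^bsub>S\<^esub> \<oplus>\<^bsub>S\<^esub> (?x \<otimes>\<^bsub>S\<^esub> \<beta> [^]\<^bsub>S\<^esub> ?e \<oplus>\<^bsub>S\<^esub> ?y \<otimes>\<^bsub>S\<^esub> \<beta> [^]\<^bsub>S\<^esub> (2 * ?e)) =
      \<one>\<^bsub>S\<^esub> \<oplus>\<^bsub>S\<^esub> (\<beta> [^]\<^bsub>S\<^esub> (n + a + 2 * b) \<oplus>\<^bsub>S\<^esub> \<beta> [^]\<^bsub>S\<^esub> (2 * (n + a + 2 * b)))"
      using \<beta>(1) by (simp add: S.red.R.nat_pow_mult algebra_simps)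
    also have "\<dots> = (if 3 dvd n + a + 2 * b then \<one>\<^bsub>S\<^esub> \<oplus>\<^bsub>S\<^esub> (\<one>\<^bsub>S\<^esub> \<oplus>\<^bsub>S\<^esub> \<one>\<^bsub>S\<^esub>) else \<zero>\<^bsub>S\<^esub>)"
      by (rule S.red.R.cube_root_sum(1)[OF \<beta>])
    finally show "Y a b = (if 3 dvd n + a + 2 * b then \<one>\<^bsub>S\<^esub> \<oplus>\<^bsub>S\<^esub> (\<one>\<^bsub>S\<^esub> \<oplus>\<^bsub>S\<^esub> \<one>\<^bsub>S\<^esub>) else \<zero>\<^bsub>S\<^esub>) \<otimes>\<^bsub>S\<^esub> ?w" .
  qed
qed

end

section \<open>Making the root subgroups elementary: the two torus cases\<close>

context coeff_pair
begin

text \<open>For each coordinate a torus element is needed that separates it from the other two. Two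
  commuting diagonalizations suffice, because the product of the elements for coordinates 0 and 1
  separates coordinate 2.\<close>

lemma exists_elementary_rep_noncube:
  assumes \<theta>: "residual_rep \<theta>" and a: "a \<in> carrier K" "a \<noteq> \<zero>\<^bsub>K\<^esub>" "a [^]\<^bsub>K\<^esub> (3::nat) \<noteq> \<one>\<^bsub>K\<^esub>"
  shows "\<exists>\<theta>'. conjugate \<theta> \<theta>' \<and> elementary_rep \<theta>'"
proof -
  have aU: "a \<in> Units K" using a by (simp add: R.K.field_Units)
  define b where "b = inv\<^bsub>K\<^esub> a \<otimes>\<^bsub>K\<^esub> inv\<^bsub>K\<^esub> a"
  have b: "b \<in> carrier K" "a \<otimes>\<^bsub>K\<^esub> (a \<otimes>\<^bsub>K\<^esub> b) = \<one>\<^bsub>K\<^esub>"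
  proof -
    show "b \<in> carrier K" using aU by (simp add: b_def)
    have "a \<otimes>\<^bsub>K\<^esub> (a \<otimes>\<^bsub>K\<^esub> b) = (a \<otimes>\<^bsub>K\<^esub> inv\<^bsub>K\<^esub> a) \<otimes>\<^bsub>K\<^esub> (a \<otimes>\<^bsub>K\<^esub> inv\<^bsub>K\<^esub> a)"
      using a aU unfolding b_def by (simp only: R.K.m_ac R.K.Units_inv_closed R.K.m_closed)
    then show "a \<otimes>\<^bsub>K\<^esub> (a \<otimes>\<^bsub>K\<^esub> b) = \<one>\<^bsub>K\<^esub>" using aU by simp
  qed
  have b0: "b \<noteq> \<zero>\<^bsub>K\<^esub>" using b a by auto
  have ab: "a \<noteq> b"
  proof
    assume "a = b"
    then have "a [^]\<^bsub>K\<^esub> (3::nat) = \<one>\<^bsub>K\<^esub>"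
      using b a by (simp add: numeral_3_eq_3 R.K.m_assoc)
    then show False using a by simp
  qed
  obtain \<alpha> \<alpha>' where \<alpha>: "\<alpha> \<in> carrier R" "\<alpha> [^]\<^bsub>R\<^esub> R.ord_mult = \<one>\<^bsub>R\<^esub>" "\<rho> \<alpha> = a"
    "\<alpha>' \<in> carrier R" "\<alpha>' [^]\<^bsub>R\<^esub> R.ord_mult = \<one>\<^bsub>R\<^esub>" "\<rho> \<alpha>' = b"
    using R.teichmueller_lift a b b0 by metis
  obtain \<beta> \<beta>' where \<beta>: "\<beta> \<in> carrier S" "\<beta> [^]\<^bsub>S\<^esub> R.ord_mult = \<one>\<^bsub>S\<^esub>" "\<sigma> \<beta> = a"
    "\<beta>' \<in> carrier S" "\<beta>' [^]\<^bsub>S\<^esub> R.ord_mult = \<one>\<^bsub>S\<^esub>" "\<sigma> \<beta>' = b"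
    using S.teichmueller_lift a b b0 by metis
  \<comment> \<open>The product is a root of unity reducing to 1, so determinant 1 in
    \<open>K\<close> lifts to determinant 1 in \<open>R\<close>.\<close>
  have prod: "\<alpha> \<otimes>\<^bsub>R\<^esub> (\<alpha> \<otimes>\<^bsub>R\<^esub> \<alpha>') = \<one>\<^bsub>R\<^esub>"
  proof (rule R.root_of_unity_eq_one)
    show "(\<alpha> \<otimes>\<^bsub>R\<^esub> (\<alpha> \<otimes>\<^bsub>R\<^esub> \<alpha>')) [^]\<^bsub>R\<^esub> R.ord_mult = \<one>\<^bsub>R\<^esub>"
      using \<alpha> by (simp add: R.red.R.nat_pow_distrib)
  qed (use \<alpha> b in simp_all)
  \<comment> \<open>\<open>d k\<close> is the lift of the torus element with a^-2 at position
    \<open>k\<close> and a elsewhere, so it centralizes the root subgroups avoiding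
    \<open>k\<close>; \<open>e k\<close> is its counterpart over \<open>S\<close>.\<close>
  define d where "d k = (\<lambda>l. if l = k then \<alpha>' else \<alpha>)" for k :: nat
  define e where "e k = (\<lambda>l. if l = k then \<beta>' else \<beta>)" for k :: nat
  have dc: "d k l \<in> carrier R" "d k l [^]\<^bsub>R\<^esub> R.ord_mult = \<one>\<^bsub>R\<^esub>" "\<sigma> (e k l) = \<rho> (d k l)"
    and ec: "e k l \<in> carrier S" "e k l [^]\<^bsub>S\<^esub> R.ord_mult = \<one>\<^bsub>S\<^esub>" for k l
    using \<alpha> \<beta> by (simp_all add: d_def e_def)
  have dprod: "d k 0 \<otimes>\<^bsub>R\<^esub> (d k 1 \<otimes>\<^bsub>R\<^esub> d k 2) = \<one>\<^bsub>R\<^esub>" if "k < 3" for k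
    using that prod \<alpha>(1,4) by (elim less_3E) (simp_all add: d_def R.red.R.m_ac)
  have one_less_3: "(1::nat) < 3" by simp
  have dSL: "mat_diag R 3 (d k) \<in> SLn R 3" if "k < 3" for k
    using dc dprod[OF that] by (intro R.red.R.mat_diag_in_SLn)
  obtain P where P: "P \<in> mat_carrier S 3" "S.Red P = mat_one K 3"
    "conj_rep P \<theta> (mat_diag R 3 (d 0)) = mat_diag S 3 (e 0)"
    by (rule diagonalize[OF \<theta>, of "d 0" "e 0"]) (use dc dprod[of 0] ec in simp_all)
  define \<theta>1 where "\<theta>1 = conj_rep P \<theta>"
  have \<theta>1: "residual_rep \<theta>1" unfolding \<theta>1_def by (rule conj_rep[OF \<theta> P(1,2)])
  obtain Q where Q: "Q \<in> mat_carrier S 3" "S.Red Q = mat_one K 3"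
    "conj_rep Q \<theta>1 (mat_diag R 3 (d 1)) = mat_diag S 3 (e 1)"
    "\<And>Z. Z \<in> mat_carrier S 3 \<Longrightarrow> Z \<star>\<^sub>S mat_diag S 3 (e 1) = mat_diag S 3 (e 1) \<star>\<^sub>S Z \<Longrightarrow>
      Z \<star>\<^sub>S \<theta>1 (mat_diag R 3 (d 1)) = \<theta>1 (mat_diag R 3 (d 1)) \<star>\<^sub>S Z \<Longrightarrow> Z \<star>\<^sub>S Q = Q \<star>\<^sub>S Z"
    by (rule diagonalize[OF \<theta>1 dc(1) dprod[OF one_less_3] dc(2) ec dc(3)]) blast
  define \<theta>2 where "\<theta>2 = conj_rep Q \<theta>1"
  have \<theta>2: "residual_rep \<theta>2" unfolding \<theta>2_def by (rule conj_rep[OF \<theta>1 Q(1,2)])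
  have conj: "conjugate \<theta> \<theta>2"
    using conjugate_trans[OF conjugate_conj_rep[OF P(1,2)] conjugate_conj_rep[OF Q(1,2)] rep_closed[OF \<theta>]]
    by (simp add: \<theta>1_def \<theta>2_def)
  have De: "mat_diag S 3 (e k) \<in> mat_carrier S 3" for k using ec by blast
  have ee: "mat_diag S 3 (e k) \<star>\<^sub>S mat_diag S 3 (e l) = mat_diag S 3 (e l) \<star>\<^sub>S mat_diag S 3 (e k)" for k l
    using ec by (simp add: S.red.R.mat_diag_mult S.red.R.m_comm)
  have dd: "mat_diag R 3 (d k) \<star>\<^sub>R mat_diag R 3 (d l) = mat_diag R 3 (d l) \<star>\<^sub>R mat_diag R 3 (d k)" for k l
    using dc by (simp add: R.red.R.mat_diag_mult R.red.R.m_comm)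
  have e0: "\<theta>1 (mat_diag R 3 (d 0)) = mat_diag S 3 (e 0)" using P(3) by (simp add: \<theta>1_def)
  \<comment> \<open>The first diagonal image commutes with both matrices averaged in the second
    step, so \<open>Q\<close> commutes with it and conjugation by \<open>Q\<close> leaves it in
    place.\<close>
  have "mat_diag S 3 (e 0) \<star>\<^sub>S Q = Q \<star>\<^sub>S mat_diag S 3 (e 0)"
    using De ee rep_commute[OF \<theta>1 dSL[of 0] dSL[of 1] dd] unfolding e0 by (intro Q(4)) simp_all
  then have t0: "\<theta>2 (mat_diag R 3 (d 0)) = mat_diag S 3 (e 0)"
    unfolding \<theta>2_def using dSL[of 0] De by (intro conj_rep_eq[OF \<theta>1 Q(1,2)]) (simp_all add: e0)
  have t1: "\<theta>2 (mat_diag R 3 (d 1)) = mat_diag S 3 (e 1)" using Q(3) by (simp add: \<theta>2_def)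
  have Ed: "\<theta>2 (E i j r) \<star>\<^sub>S \<theta>2 (mat_diag R 3 (d k)) = \<theta>2 (mat_diag R 3 (d k)) \<star>\<^sub>S \<theta>2 (E i j r)"
    if "k < 3" "i < 3" "j < 3" "i \<noteq> j" "i = k \<longleftrightarrow> j = k" "r \<in> carrier R" for i j k r
  proof -
    have "mat_diag R 3 (d k) \<star>\<^sub>R E i j r = E i j r \<star>\<^sub>R mat_diag R 3 (d k)"
      using that dc by (intro R.red.R.mat_diag_elem) (simp_all add: d_def R.red.R.m_comm)
    then show ?thesis using that by (intro rep_commute[OF \<theta>2] dSL E_in_SLn) simp_all
  qed
  have diff: "x \<ominus>\<^bsub>S\<^esub> y \<in> Units S" if "x \<in> carrier S" "y \<in> carrier S" "\<sigma> x \<noteq> \<sigma> y" for x y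
    using that by (simp add: S.Units_iff S.red.R.minus_eq flip: R.K.minus_eq)
  have "elem_shape S i j (\<theta>2 (E i j r))" if ij: "i < 3" "j < 3" "i \<noteq> j" "r \<in> carrier R" for i j r
  proof (rule block_rep_elem_shape[OF \<theta>2 _ ij])
    fix k :: nat assume "k < 3"
    then consider "k = 0" | "k = 1" | "k = 2" by (rule less_3E)
    then show "\<exists>D. (\<forall>l<3. D l \<in> carrier S) \<and> (\<forall>l<3. l \<noteq> k \<longrightarrow> D l \<ominus>\<^bsub>S\<^esub> D k \<in> Units S \<and> D k \<ominus>\<^bsub>S\<^esub> D l \<in> Units S) \<and>
      (\<forall>i<3. \<forall>j<3. \<forall>r\<in>carrier R. i \<noteq> j \<longrightarrow> i \<noteq> k \<longrightarrow> j \<noteq> k \<longrightarrow>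
        \<theta>2 (E i j r) \<star>\<^sub>S mat_diag S 3 D = mat_diag S 3 D \<star>\<^sub>S \<theta>2 (E i j r))"
    proof cases
      case 1
      have "e 0 l \<ominus>\<^bsub>S\<^esub> e 0 0 \<in> Units S \<and> e 0 0 \<ominus>\<^bsub>S\<^esub> e 0 l \<in> Units S" if "l \<noteq> 0" for l
        using that ec ab \<beta> by (intro conjI diff) (auto simp: e_def)
      then show ?thesis
        unfolding 1 using ec Ed[of 0] by (intro exI[of _ "e 0"]) (simp add: t0)
    next
      case 2
      have "e 1 l \<ominus>\<^bsub>S\<^esub> e 1 1 \<in> Units S \<and> e 1 1 \<ominus>\<^bsub>S\<^esub> e 1 l \<in> Units S" if "l \<noteq> 1" for l
        using that ec ab \<beta> by (intro conjI diff) (auto simp: e_def)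
      then show ?thesis
        unfolding 2 using ec Ed[of 1] t1
        by (intro exI[of _ "e 1"]) simp
    next
      case 3
      \<comment> \<open>Residually the entries are ab, ab, aa, where b = a^-2; they separate
        coordinate 2 because a and b differ.\<close>
      let ?D = "\<lambda>l. e 0 l \<otimes>\<^bsub>S\<^esub> e 1 l"
      have neq: "a \<otimes>\<^bsub>K\<^esub> b \<noteq> a \<otimes>\<^bsub>K\<^esub> a" "b \<otimes>\<^bsub>K\<^esub> a \<noteq> a \<otimes>\<^bsub>K\<^esub> a"
        using R.K.m_lcancel[of a a b] a b ab R.K.m_comm[of a b] by auto
      have D: "?D l \<ominus>\<^bsub>S\<^esub> ?D 2 \<in> Units S \<and> ?D 2 \<ominus>\<^bsub>S\<^esub> ?D l \<in> Units S" if "l < 3" "l \<noteq> 2" for l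
        using that ec \<beta> neq by (intro conjI diff) (auto simp: e_def elim!: less_3E)
      have De01: "mat_diag S 3 ?D = mat_diag S 3 (e 0) \<star>\<^sub>S mat_diag S 3 (e 1)"
        using ec by (simp add: S.red.R.mat_diag_mult)
      have "\<theta>2 (E i j r) \<star>\<^sub>S mat_diag S 3 ?D = mat_diag S 3 ?D \<star>\<^sub>S \<theta>2 (E i j r)"
        if "i < 3" "j < 3" "i \<noteq> j" "i \<noteq> 2" "j \<noteq> 2" "r \<in> carrier R" for i j r
      proof -
        have t: "mat_diag R 3 (d 0) \<star>\<^sub>R mat_diag R 3 (d 1) = mat_diag R 3 (\<lambda>l. d 0 l \<otimes>\<^bsub>R\<^esub> d 1 l)"
          using dc by (simp add: R.red.R.mat_diag_mult)
        have c: "d 0 l \<otimes>\<^bsub>R\<^esub> d 1 l = \<alpha> \<otimes>\<^bsub>R\<^esub> \<alpha>'" if "l < 3" "l \<noteq> 2" for l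
          using that \<alpha> by (elim less_3E) (simp_all add: d_def R.red.R.m_comm)
        have SL: "mat_diag R 3 (d 0) \<star>\<^sub>R mat_diag R 3 (d 1) \<in> SLn R 3"
          using R.loc.SLn_mult_closed dSL by simp
        have "mat_diag R 3 (\<lambda>l. d 0 l \<otimes>\<^bsub>R\<^esub> d 1 l) \<star>\<^sub>R E i j r = E i j r \<star>\<^sub>R mat_diag R 3 (\<lambda>l. d 0 l \<otimes>\<^bsub>R\<^esub> d 1 l)"
          using that dc \<alpha> c by (intro R.red.R.mat_diag_elem) (simp_all add: R.red.R.m_comm)
        then have "\<theta>2 (E i j r) \<star>\<^sub>S \<theta>2 (mat_diag R 3 (d 0) \<star>\<^sub>R mat_diag R 3 (d 1)) =
          \<theta>2 (mat_diag R 3 (d 0) \<star>\<^sub>R mat_diag R 3 (d 1)) \<star>\<^sub>S \<theta>2 (E i j r)"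
          using SL that by (intro rep_commute[OF \<theta>2] E_in_SLn) (simp_all add: t del: One_nat_def)
        then show ?thesis
          using rep_mult[OF \<theta>2 dSL dSL, of 0 1] t0 t1
          by (simp add: De01 del: One_nat_def)
      qed
      then show ?thesis
        unfolding 3 using ec D by (intro exI[of _ ?D]) simp
    qed
  qed
  then have "elementary_rep \<theta>2" using \<theta>2 by (simp add: elementary_rep_def)
  with conj show ?thesis by blast
qed

text \<open>The image of \<open>E i j r\<close> is not known to commute with any residually
  nonscalar torus element, but it commutes with the images of the root subgroups (i,k) and (k,j),
  hence with their weight components. These are supported on three entries, which
  \<open>commute_imp_elem_shape\<close> can exploit.\<close>

lemma exists_elementary_rep_cube:
  assumes \<theta>: "residual_rep \<theta>" and a: "a \<in> carrier K" "a \<noteq> \<zero>\<^bsub>K\<^esub>" "a \<noteq> \<one>\<^bsub>K\<^esub>" "a [^]\<^bsub>K\<^esub> (3::nat) = \<one>\<^bsub>K\<^esub>"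
  shows "\<exists>\<theta>'. conjugate \<theta> \<theta>' \<and> elementary_rep \<theta>'"
proof -
  obtain \<alpha> where \<alpha>: "\<alpha> \<in> carrier R" "\<alpha> [^]\<^bsub>R\<^esub> R.ord_mult = \<one>\<^bsub>R\<^esub>" "\<rho> \<alpha> = a"
    using R.teichmueller_lift a by metis
  obtain \<beta> where \<beta>: "\<beta> \<in> carrier S" "\<beta> [^]\<^bsub>S\<^esub> R.ord_mult = \<one>\<^bsub>S\<^esub>" "\<sigma> \<beta> = a"
    using S.teichmueller_lift a by metis
  have pow_swap_R: "(\<alpha> [^]\<^bsub>R\<^esub> m) [^]\<^bsub>R\<^esub> R.ord_mult = \<one>\<^bsub>R\<^esub>" for m :: nat
  proof -
    have "(\<alpha> [^]\<^bsub>R\<^esub> m) [^]\<^bsub>R\<^esub> R.ord_mult = (\<alpha> [^]\<^bsub>R\<^esub> R.ord_mult) [^]\<^bsub>R\<^esub> m"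
      using \<alpha>(1) by (simp add: R.red.R.nat_pow_pow mult.commute)
    then show ?thesis using \<alpha>(2) by simp
  qed
  have pow_swap_S: "(\<beta> [^]\<^bsub>S\<^esub> m) [^]\<^bsub>S\<^esub> R.ord_mult = \<one>\<^bsub>S\<^esub>" for m :: nat
  proof -
    have "(\<beta> [^]\<^bsub>S\<^esub> m) [^]\<^bsub>S\<^esub> R.ord_mult = (\<beta> [^]\<^bsub>S\<^esub> R.ord_mult) [^]\<^bsub>S\<^esub> m"
      using \<beta>(1) by (simp add: S.red.R.nat_pow_pow mult.commute)
    then show ?thesis using \<beta>(2) by simp
  qed
  \<comment> \<open>The relation a^3 = 1 lifts by uniqueness of roots of unity with given
    reduction.\<close>
  have \<alpha>3: "\<alpha> [^]\<^bsub>R\<^esub> (3::nat) = \<one>\<^bsub>R\<^esub>"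
    by (rule R.root_of_unity_eq_one) (use \<alpha> a pow_swap_R in \<open>simp_all add: R.red_pow del: R.red.R.nat_pow_Suc\<close>)
  have \<beta>3: "\<beta> [^]\<^bsub>S\<^esub> (3::nat) = \<one>\<^bsub>S\<^esub>"
    by (rule S.root_of_unity_eq_one) (use \<beta> a pow_swap_S in \<open>simp_all add: S.red_pow del: S.red.R.nat_pow_Suc\<close>)
  have \<beta>1: "\<beta> \<ominus>\<^bsub>S\<^esub> \<one>\<^bsub>S\<^esub> \<in> Units S"
    using \<beta> a by (simp add: S.Units_iff S.red.R.minus_eq flip: R.K.minus_eq)
  let ?d = "\<lambda>l::nat. \<alpha> [^]\<^bsub>R\<^esub> l" and ?e = "\<lambda>l::nat. \<beta> [^]\<^bsub>S\<^esub> l"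
  have prod: "?d 0 \<otimes>\<^bsub>R\<^esub> (?d 1 \<otimes>\<^bsub>R\<^esub> ?d 2) = \<one>\<^bsub>R\<^esub>"
    using \<alpha>(1) \<alpha>3 by (simp add: numeral_2_eq_2 numeral_3_eq_3 R.red.R.m_assoc)
  obtain P where P: "P \<in> mat_carrier S 3" "S.Red P = mat_one K 3"
    "conj_rep P \<theta> (mat_diag R 3 ?d) = mat_diag S 3 ?e"
    by (rule diagonalize[OF \<theta>, of ?d ?e])
      (use \<alpha> \<beta> prod pow_swap_R pow_swap_S in \<open>simp_all add: R.red_pow S.red_pow\<close>)
  define \<theta>1 where "\<theta>1 = conj_rep P \<theta>"
  have \<theta>1: "residual_rep \<theta>1" unfolding \<theta>1_def by (rule conj_rep[OF \<theta> P(1,2)])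
  have T: "\<theta>1 (mat_diag R 3 ?d) = mat_diag S 3 ?e" using P(3) by (simp add: \<theta>1_def)
  have "elem_shape S i j (\<theta>1 (E i j r))" if ij: "i < 3" "j < 3" "i \<noteq> j" and r: "r \<in> carrier R" for i j r
  proof -
    obtain k where k: "k < 3" "k \<noteq> i" "k \<noteq> j"
      using third_index[OF ij] by blast
    let ?M = "\<theta>1 (E i j r)" and ?three = "\<one>\<^bsub>S\<^esub> \<oplus>\<^bsub>S\<^esub> (\<one>\<^bsub>S\<^esub> \<oplus>\<^bsub>S\<^esub> \<one>\<^bsub>S\<^esub>)"
    have M: "?M \<in> mat_carrier S 3" using ij r by (intro rep_closed[OF \<theta>1] E_in_SLn)
    have MB: "?M \<star>\<^sub>S \<theta>1 (E i k s) = \<theta>1 (E i k s) \<star>\<^sub>S ?M"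
      and MC: "?M \<star>\<^sub>S \<theta>1 (E k j s) = \<theta>1 (E k j s) \<star>\<^sub>S ?M" if "s \<in> carrier R" for s
      using that ij k r by (auto intro!: rep_commute[OF \<theta>1] E_in_SLn R.red.R.mat_elem_commute)
    note weight = weight_component[OF \<theta>1 \<alpha>(1) \<alpha>3 \<beta>(1) \<beta>3 \<beta>1 T _ _ _ M]
    \<comment> \<open>\<open>Y\<close> and \<open>Z\<close> are taken in the same weight, that of
      (i,k), which is also that of (k,j); the unit entries 1 of both elementary matrices survive the
      projection.\<close>
    obtain Y where Y: "Y \<in> mat_carrier S 3" "?M \<star>\<^sub>S Y = Y \<star>\<^sub>S ?M"
      "\<And>a b. a < 3 \<Longrightarrow> b < 3 \<Longrightarrow> Y a b = (if 3 dvd (k + 2 * i) + a + 2 * b then ?three else \<zero>\<^bsub>S\<^esub>) \<otimes>\<^bsub>S\<^esub> \<theta>1 (E i k \<one>\<^bsub>R\<^esub>) a b"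
      by (rule weight[of i k "k + 2 * i"]) (use ij k MB in auto)
    obtain Z where Z: "Z \<in> mat_carrier S 3" "?M \<star>\<^sub>S Z = Z \<star>\<^sub>S ?M"
      "\<And>a b. a < 3 \<Longrightarrow> b < 3 \<Longrightarrow> Z a b = (if 3 dvd (k + 2 * i) + a + 2 * b then ?three else \<zero>\<^bsub>S\<^esub>) \<otimes>\<^bsub>S\<^esub> \<theta>1 (E k j \<one>\<^bsub>R\<^esub>) a b"
      by (rule weight[of k j "k + 2 * i"]) (use ij k MC in auto)
    note supp = weight_support[OF ij(1,2) k(1) ij(3) k(2)[symmetric] k(3)[symmetric]]
    have cl: "\<theta>1 (E p q \<one>\<^bsub>R\<^esub>) a b \<in> carrier S" if "p < 3" "q < 3" "p \<noteq> q" for p q a b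
      using that by (intro rep_entry_closed[OF \<theta>1] E_in_SLn) simp_all
    have three: "?three \<in> Units S" by (rule S.red.R.cube_root_sum(2)[OF \<beta>(1) \<beta>3 \<beta>1])
    have unit: "\<theta>1 (E p q \<one>\<^bsub>R\<^esub>) p q \<in> Units S" if "p < 3" "q < 3" "p \<noteq> q" for p q
      using that cl by (simp add: S.Units_iff rep_elem_red[OF \<theta>1])
    show ?thesis
    proof (rule commute_imp_elem_shape[OF M Y(1) Z(1) ij(1,2) k(1) ij(3) k(2)[symmetric] k(3)[symmetric] _ _ _ _ _ Y(2) Z(2)])
      fix a b :: nat assume ab: "a < 3" "b < 3" "(a, b) \<notin> {(i, k), (k, j), (j, i)}"
      then have "\<not> 3 dvd (k + 2 * i) + a + 2 * b" using supp[OF ab(1,2)] by blast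
      then show "Y a b = \<zero>\<^bsub>S\<^esub>" "Z a b = \<zero>\<^bsub>S\<^esub>"
        using Y(3)[OF ab(1,2)] Z(3)[OF ab(1,2)] cl[of i k] cl[of k j] ij k by simp_all
    next
      have "Y i k = ?three \<otimes>\<^bsub>S\<^esub> \<theta>1 (E i k \<one>\<^bsub>R\<^esub>) i k"
        using supp[OF ij(1) k(1)] Y(3)[OF ij(1) k(1)] by simp
      then show "Y i k \<in> Units S" using unit[of i k] ij k three by simp
      have "Z k j = ?three \<otimes>\<^bsub>S\<^esub> \<theta>1 (E k j \<one>\<^bsub>R\<^esub>) k j"
        using supp[OF k(1) ij(2)] Z(3)[OF k(1) ij(2)] by simp
      then show "Z k j \<in> Units S" using unit[of k j] ij k three by simp
      have "Z i k = ?three \<otimes>\<^bsub>S\<^esub> \<theta>1 (E k j \<one>\<^bsub>R\<^esub>) i k"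
        using supp[OF ij(1) k(1)] Z(3)[OF ij(1) k(1)] by simp
      then show "\<sigma> (Z i k) = \<zero>\<^bsub>K\<^esub>"
        using cl[of k j i k] ij k by (simp add: rep_elem_red[OF \<theta>1])
    qed
  qed
  then have "elementary_rep \<theta>1" using \<theta>1 by (simp add: elementary_rep_def)
  moreover have "conjugate \<theta> \<theta>1" unfolding \<theta>1_def by (rule conjugate_conj_rep[OF P(1,2)])
  ultimately show ?thesis by blast
qed

lemma exists_elementary_rep:
  assumes "residual_rep \<theta>" "card (carrier K) \<noteq> 2"
  shows "\<exists>\<theta>'. conjugate \<theta> \<theta>' \<and> elementary_rep \<theta>'"
proof -
  have "\<not> carrier K \<subseteq> {\<zero>\<^bsub>K\<^esub>, \<one>\<^bsub>K\<^esub>}"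
  proof
    assume "carrier K \<subseteq> {\<zero>\<^bsub>K\<^esub>, \<one>\<^bsub>K\<^esub>}"
    then have "carrier K = {\<zero>\<^bsub>K\<^esub>, \<one>\<^bsub>K\<^esub>}" by auto
    then show False using assms(2) by simp
  qed
  \<comment> \<open>The case distinction is on this chosen element, so the second case may also
    occur over larger fields; all it needs is a primitive cube root of unity.\<close>
  then obtain a where "a \<in> carrier K" "a \<noteq> \<zero>\<^bsub>K\<^esub>" "a \<noteq> \<one>\<^bsub>K\<^esub>" by blast
  then show ?thesis
    using exists_elementary_rep_noncube[OF assms(1)] exists_elementary_rep_cube[OF assms(1)]
    by (cases "a [^]\<^bsub>K\<^esub> (3::nat) = \<one>\<^bsub>K\<^esub>") blast+
qed

end

section \<open>From root subgroups to a ring homomorphism\<close>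

lemma mat_elem_same: "a < n \<Longrightarrow> mat_elem R n i j r a a = \<one>\<^bsub>R\<^esub>"
  by (simp add: mat_elem_def)

context coeff_pair
begin

text \<open>The images of \<open>E i k r\<close> and \<open>E k j s\<close> contribute their scalars
  to both sides of the commutator relation. At (k,k) these are the only other factors, and being
  units they cancel; at (i,j) they remain until they are known to be 1.\<close>

lemma elementary_rep_commutator:
  assumes \<theta>: "elementary_rep \<theta>" and ij: "i < 3" "j < 3" "i \<noteq> j"
    and k: "k < 3" "k \<noteq> i" "k \<noteq> j" and r: "r \<in> carrier R" and s: "s \<in> carrier R"
  shows "\<theta> (E i j (r \<otimes>\<^bsub>R\<^esub> s)) i i = \<one>\<^bsub>S\<^esub>"
    and "\<theta> (E i j (r \<otimes>\<^bsub>R\<^esub> s)) i j \<otimes>\<^bsub>S\<^esub> (\<theta> (E k j s) k k \<otimes>\<^bsub>S\<^esub> \<theta> (E i k r) i i) =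
        \<theta> (E i k r) i k \<otimes>\<^bsub>S\<^esub> \<theta> (E k j s) k j"
proof -
  have rep: "residual_rep \<theta>" using \<theta> by (simp add: elementary_rep_def)
  have shape: "elem_shape S p q (\<theta> (E p q s))" if "p < 3" "q < 3" "p \<noteq> q" "s \<in> carrier R" for p q s
    using \<theta> that by (simp add: elementary_rep_def)
  have diag: "\<theta> (E p q s) a a = \<theta> (E p q s) p p"
    if "p < 3" "q < 3" "p \<noteq> q" "s \<in> carrier R" "a < 3" for p q s a
    using shape[OF that(1-4)] that(5) unfolding elem_shape_def by blast
  have off: "\<theta> (E p q s) a b = \<zero>\<^bsub>S\<^esub>"
    if "p < 3" "q < 3" "p \<noteq> q" "s \<in> carrier R" "a < 3" "b < 3" "a \<noteq> b" "a \<noteq> p \<or> b \<noteq> q" for p q s a b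
    using shape[OF that(1-4)] that(5-) unfolding elem_shape_def by blast
  have I: "{..<3} = {i, j, k}" using ij k by (auto; linarith)
  note entry = S.red.R.mat_mult_entry_gen[OF _ _ _ _ I ij(3) k(2)[symmetric] k(3)[symmetric]]
  let ?g = "\<theta> (E i k r)" and ?h = "\<theta> (E k j s)" and ?m = "\<theta> (E i j (r \<otimes>\<^bsub>R\<^esub> s))"
  have SL: "E i k r \<in> SLn R 3" "E k j s \<in> SLn R 3" "E i j (r \<otimes>\<^bsub>R\<^esub> s) \<in> SLn R 3"
    using ij k r s by (auto intro: E_in_SLn)
  note closed = SL[THEN rep_closed[OF rep]]
  note [simp] = closed[THEN S.red.R.mat_entry_closed]
  have hg: "?h \<star>\<^sub>S ?g \<in> mat_carrier S 3" using closed by blast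
  have SL': "E k j s \<star>\<^sub>R E i k r \<in> SLn R 3" using SL R.loc.SLn_mult_closed by blast
  have eq: "?g \<star>\<^sub>S ?h = ?m \<star>\<^sub>S (?h \<star>\<^sub>S ?g)"
    using R.red.R.mat_elem_commutator[OF r s ij(1,2) k(1) ij(3) k(2)[symmetric] k(3)[symmetric]]
      rep_mult[OF rep SL(1,2)] rep_mult[OF rep SL(2,1)] rep_mult[OF rep SL(3) SL'] by simp
  have g0: "?g i j = \<zero>\<^bsub>S\<^esub>" "?g j i = \<zero>\<^bsub>S\<^esub>" "?g j k = \<zero>\<^bsub>S\<^esub>" "?g k i = \<zero>\<^bsub>S\<^esub>" "?g k j = \<zero>\<^bsub>S\<^esub>"
    by (rule off; use ij k r s in simp)+
  have gd: "?g j j = ?g i i" "?g k k = ?g i i"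
    by (rule diag; use ij k r s in simp)+
  have h0: "?h i j = \<zero>\<^bsub>S\<^esub>" "?h i k = \<zero>\<^bsub>S\<^esub>" "?h j i = \<zero>\<^bsub>S\<^esub>" "?h j k = \<zero>\<^bsub>S\<^esub>" "?h k i = \<zero>\<^bsub>S\<^esub>"
    by (rule off; use ij k r s in simp)+
  have hd: "?h i i = ?h k k" "?h j j = ?h k k"
    by (rule diag; use ij k r s in simp)+
  have m0: "?m i k = \<zero>\<^bsub>S\<^esub>" "?m j i = \<zero>\<^bsub>S\<^esub>" "?m j k = \<zero>\<^bsub>S\<^esub>" "?m k i = \<zero>\<^bsub>S\<^esub>" "?m k j = \<zero>\<^bsub>S\<^esub>"
    by (rule off; use ij k r s in simp)+
  have md: "?m j j = ?m i i" "?m k k = ?m i i"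
    by (rule diag; use ij k r s in simp)+
  have U: "?h k k \<otimes>\<^bsub>S\<^esub> ?g i i \<in> Units S"
    using ij k r s by (simp add: S.Units_iff rep_elem_red[OF rep])
  have "?g i i \<otimes>\<^bsub>S\<^esub> ?h k k = ?m i i \<otimes>\<^bsub>S\<^esub> (?h k k \<otimes>\<^bsub>S\<^esub> ?g i i)"
    using arg_cong[OF eq, of "\<lambda>A. A k k"] ij k closed hg
    by (simp add: entry g0 h0 m0 gd hd md)
  then have "?m i i \<otimes>\<^bsub>S\<^esub> (?h k k \<otimes>\<^bsub>S\<^esub> ?g i i) = (?h k k \<otimes>\<^bsub>S\<^esub> ?g i i) \<otimes>\<^bsub>S\<^esub> \<one>\<^bsub>S\<^esub>"
    by (simp add: S.red.R.m_comm)
  then show "?m i i = \<one>\<^bsub>S\<^esub>"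
    by (rule S.red.R.Unit_cancel_comm[OF U, rotated 2]) simp_all
  show "?m i j \<otimes>\<^bsub>S\<^esub> (?h k k \<otimes>\<^bsub>S\<^esub> ?g i i) = ?g i k \<otimes>\<^bsub>S\<^esub> ?h k j"
    using arg_cong[OF eq, of "\<lambda>A. A i j"] ij k closed hg
    by (simp add: entry g0 h0 m0 gd hd md)
qed

text \<open>Writing r as r times 1 exhibits every \<open>E i j r\<close> as a commutator, so every
  scalar is 1.\<close>

lemma elementary_rep_elem:
  assumes \<theta>: "elementary_rep \<theta>" and ij: "i < 3" "j < 3" "i \<noteq> j" and r: "r \<in> carrier R"
  shows "\<theta> (E i j r) = mat_elem S 3 i j (\<theta> (E i j r) i j)"
proof -
  have rep: "residual_rep \<theta>" using \<theta> by (simp add: elementary_rep_def)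
  have shape: "elem_shape S i j (\<theta> (E i j r))"
    using \<theta> ij r by (simp add: elementary_rep_def)
  obtain k where k: "k < 3" "k \<noteq> i" "k \<noteq> j" using third_index[OF ij] by blast
  have "\<theta> (E i j r) i i = \<one>\<^bsub>S\<^esub>"
    using elementary_rep_commutator(1)[OF \<theta> ij k r R.red.R.one_closed] r by simp
  moreover have M: "\<theta> (E i j r) \<in> mat_carrier S 3" using ij r by (intro rep_closed[OF rep] E_in_SLn)
  ultimately show ?thesis
    using shape ij unfolding elem_shape_def
    by (intro mat_eqI[OF M S.red.R.mat_elem_closed[OF S.red.R.mat_entry_closed[OF M]]])
      (auto simp: mat_elem_def)
qed

lemma elementary_rep_mult:
  assumes \<theta>: "elementary_rep \<theta>" and ij: "i < 3" "j < 3" "i \<noteq> j"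
    and k: "k < 3" "k \<noteq> i" "k \<noteq> j" and r: "r \<in> carrier R" and s: "s \<in> carrier R"
  shows "\<theta> (E i j (r \<otimes>\<^bsub>R\<^esub> s)) i j = \<theta> (E i k r) i k \<otimes>\<^bsub>S\<^esub> \<theta> (E k j s) k j"
proof -
  have rep: "residual_rep \<theta>" using \<theta> by (simp add: elementary_rep_def)
  have "\<theta> (E k j s) k k = \<one>\<^bsub>S\<^esub>" "\<theta> (E i k r) i i = \<one>\<^bsub>S\<^esub>"
    using arg_cong[OF elementary_rep_elem[OF \<theta> k(1) ij(2) k(3) s], of "\<lambda>A. A k k"]
      arg_cong[OF elementary_rep_elem[OF \<theta> ij(1) k(1) k(2)[symmetric] r], of "\<lambda>A. A i i"] ij k
    by (simp_all add: mat_elem_same)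
  then show ?thesis
    using elementary_rep_commutator(2)[OF \<theta> ij k r s] rep_entry_closed[OF rep E_in_SLn[OF _ ij]] r s
    by simp
qed

text \<open>The values f i j 1 form a multiplicative cocycle, f i j = f i k f k j. It is trivialized
  by q i = f 0 i 1, and conjugation by the diagonal matrix of the \<open>q i\<close> makes all of
  them 1. These diagonal entries reduce to 1, so the conjugation is strict.\<close>

lemma elementary_rep_normalize:
  assumes \<theta>: "elementary_rep \<theta>"
  obtains \<theta>' where "conjugate \<theta> \<theta>'" "elementary_rep \<theta>'"
    "\<And>i j. i < 3 \<Longrightarrow> j < 3 \<Longrightarrow> i \<noteq> j \<Longrightarrow> \<theta>' (E i j \<one>\<^bsub>R\<^esub>) = mat_elem S 3 i j \<one>\<^bsub>S\<^esub>"
proof -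
  have rep: "residual_rep \<theta>" using \<theta> by (simp add: elementary_rep_def)
  define f where "f i j r = \<theta> (E i j r) i j" for i j r
  have fc: "f i j r \<in> carrier S" if "i < 3" "j < 3" "i \<noteq> j" "r \<in> carrier R" for i j r
    unfolding f_def using that by (intro rep_entry_closed[OF rep] E_in_SLn)
  have f_elem: "\<theta> (E i j r) = mat_elem S 3 i j (f i j r)" if "i < 3" "j < 3" "i \<noteq> j" "r \<in> carrier R" for i j r
    unfolding f_def using elementary_rep_elem[OF \<theta> that] .
  have f1: "f i j \<one>\<^bsub>R\<^esub> = f i k \<one>\<^bsub>R\<^esub> \<otimes>\<^bsub>S\<^esub> f k j \<one>\<^bsub>R\<^esub>"
    if "i < 3" "j < 3" "i \<noteq> j" "k < 3" "k \<noteq> i" "k \<noteq> j" for i j k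
    unfolding f_def using elementary_rep_mult[OF \<theta> that R.red.R.one_closed R.red.R.one_closed] by simp
  have fred: "\<sigma> (f i j \<one>\<^bsub>R\<^esub>) = \<one>\<^bsub>K\<^esub>" if "i < 3" "j < 3" "i \<noteq> j" for i j
    unfolding f_def using that by (simp add: rep_elem_red[OF rep])
  have fU: "f i j \<one>\<^bsub>R\<^esub> \<in> Units S" if "i < 3" "j < 3" "i \<noteq> j" for i j
    using fc[OF that] fred[OF that] by (simp add: S.Units_iff)
  \<comment> \<open>The cocycle rule is available only for distinct indices, so this degenerate case
    goes through the third index: f k i = f k 0 f 0 i = f k i f i 0 f 0 i, and f k i is a
    unit.\<close>
  have finv: "f 0 i \<one>\<^bsub>R\<^esub> \<otimes>\<^bsub>S\<^esub> f i 0 \<one>\<^bsub>R\<^esub> = \<one>\<^bsub>S\<^esub>" if i: "i < 3" "i \<noteq> 0" for i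
  proof -
    obtain k where k: "k < 3" "k \<noteq> 0" "k \<noteq> i"
      using third_index[of 0 i] i by (metis zero_less_numeral)
    have c: "f k i \<one>\<^bsub>R\<^esub> \<in> carrier S" "f i 0 \<one>\<^bsub>R\<^esub> \<in> carrier S" "f 0 i \<one>\<^bsub>R\<^esub> \<in> carrier S"
      using i k by (auto intro: fc)
    have "f k i \<one>\<^bsub>R\<^esub> = f k 0 \<one>\<^bsub>R\<^esub> \<otimes>\<^bsub>S\<^esub> f 0 i \<one>\<^bsub>R\<^esub>" "f k 0 \<one>\<^bsub>R\<^esub> = f k i \<one>\<^bsub>R\<^esub> \<otimes>\<^bsub>S\<^esub> f i 0 \<one>\<^bsub>R\<^esub>"
      using i k by (auto intro!: f1)
    then have "f k i \<one>\<^bsub>R\<^esub> \<otimes>\<^bsub>S\<^esub> \<one>\<^bsub>S\<^esub> = f k i \<one>\<^bsub>R\<^esub> \<otimes>\<^bsub>S\<^esub> (f 0 i \<one>\<^bsub>R\<^esub> \<otimes>\<^bsub>S\<^esub> f i 0 \<one>\<^bsub>R\<^esub>)"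
      using c by (metis S.red.R.m_assoc S.red.R.m_comm S.red.R.r_one)
    then have "\<one>\<^bsub>S\<^esub> = f 0 i \<one>\<^bsub>R\<^esub> \<otimes>\<^bsub>S\<^esub> f i 0 \<one>\<^bsub>R\<^esub>"
      by (rule iffD1[OF S.red.R.Units_l_cancel[OF fU[OF k(1) i(1) k(3)]], rotated 2]) (use c in simp_all)
    then show ?thesis by simp
  qed
  define q where "q i = (if i = 0 then \<one>\<^bsub>S\<^esub> else f 0 i \<one>\<^bsub>R\<^esub>)" for i :: nat
  have qc: "q i \<in> carrier S" and qred: "\<sigma> (q i) = \<one>\<^bsub>K\<^esub>" if "i < 3" for i
    using that fc[of 0 i] fred[of 0 i] by (auto simp: q_def)
  have qf: "q i \<otimes>\<^bsub>S\<^esub> f i j \<one>\<^bsub>R\<^esub> = q j" if "i < 3" "j < 3" "i \<noteq> j" for i j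
    using that finv[of i] f1[of 0 j i] fc[of i j] by (auto simp: q_def)
  let ?Q = "mat_diag S 3 q"
  have Qc: "?Q \<in> mat_carrier S 3" using qc by blast
  have Qred: "S.Red ?Q = mat_one K 3"
    unfolding S.red.mat_map_diag R.K.mat_one_eq_diag using qred by (intro R.K.mat_diag_cong)
  have rep': "residual_rep (conj_rep ?Q \<theta>)" by (rule conj_rep[OF rep Qc Qred])
  have qinv: "q i \<in> Units S" if "i < 3" for i using qc[OF that] qred[OF that] by (simp add: S.Units_iff)
  have conj: "conj_rep ?Q \<theta> (E i j r) = mat_elem S 3 i j y"
    if "i < 3" "j < 3" "i \<noteq> j" "r \<in> carrier R" "y \<in> carrier S" "q i \<otimes>\<^bsub>S\<^esub> f i j r = y \<otimes>\<^bsub>S\<^esub> q j" for i j r y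
    using that qc fc[OF that(1-4)]
    by (intro conj_rep_eq[OF rep Qc Qred E_in_SLn] S.red.R.mat_elem_closed)
      (simp_all add: f_elem S.red.R.mat_diag_elem)
  have "elem_shape S i j (conj_rep ?Q \<theta> (E i j r))" if ij: "i < 3" "j < 3" "i \<noteq> j" and r: "r \<in> carrier R" for i j r
  proof -
    have "conj_rep ?Q \<theta> (E i j r) = mat_elem S 3 i j (q i \<otimes>\<^bsub>S\<^esub> f i j r \<otimes>\<^bsub>S\<^esub> inv\<^bsub>S\<^esub> q j)"
      using ij r qinv[of j] qc fc[OF ij r] by (intro conj) (simp_all add: S.red.R.m_assoc)
    then show ?thesis using ij by (auto simp: elem_shape_def mat_elem_def)
  qed
  then have "elementary_rep (conj_rep ?Q \<theta>)" using rep' by (simp add: elementary_rep_def)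
  moreover have "conj_rep ?Q \<theta> (E i j \<one>\<^bsub>R\<^esub>) = mat_elem S 3 i j \<one>\<^bsub>S\<^esub>" if "i < 3" "j < 3" "i \<noteq> j" for i j
    using that qf[OF that] qc by (intro conj) simp_all
  ultimately show thesis
    using that conjugate_conj_rep[OF Qc Qred] by blast
qed

text \<open>Setting one argument of the commutator relation to 1 moves either index of f, so all six
  functions coincide and the relation itself becomes multiplicativity. Additivity comes from the
  root subgroup, and agreement on elementary matrices extends to the whole group by
  \<open>SL3_induct\<close>.\<close>

lemma normalized_rep_eq_mat_map:
  assumes \<theta>: "elementary_rep \<theta>"
    and one: "\<And>i j. i < 3 \<Longrightarrow> j < 3 \<Longrightarrow> i \<noteq> j \<Longrightarrow> \<theta> (E i j \<one>\<^bsub>R\<^esub>) = mat_elem S 3 i j \<one>\<^bsub>S\<^esub>"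
  obtains \<phi> where "\<phi> \<in> CHom K R \<rho> S \<sigma>" "\<And>g. g \<in> SLn R 3 \<Longrightarrow> \<theta> g = mat_map S 3 \<phi> g"
proof -
  have rep: "residual_rep \<theta>" using \<theta> by (simp add: elementary_rep_def)
  define f where "f i j r = \<theta> (E i j r) i j" for i j r
  have fc: "f i j r \<in> carrier S" if "i < 3" "j < 3" "i \<noteq> j" "r \<in> carrier R" for i j r
    unfolding f_def using that by (intro rep_entry_closed[OF rep] E_in_SLn)
  have f_elem: "\<theta> (E i j r) = mat_elem S 3 i j (f i j r)" if "i < 3" "j < 3" "i \<noteq> j" "r \<in> carrier R" for i j r
    unfolding f_def using elementary_rep_elem[OF \<theta> that] .
  have f1: "f i j \<one>\<^bsub>R\<^esub> = \<one>\<^bsub>S\<^esub>" if "i < 3" "j < 3" "i \<noteq> j" for i j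
    unfolding f_def one[OF that] using that by (simp add: mat_elem_def)
  have fmult: "f i j (r \<otimes>\<^bsub>R\<^esub> s) = f i k r \<otimes>\<^bsub>S\<^esub> f k j s"
    if "i < 3" "j < 3" "i \<noteq> j" "k < 3" "k \<noteq> i" "k \<noteq> j" "r \<in> carrier R" "s \<in> carrier R" for i j k r s
    unfolding f_def using elementary_rep_mult[OF \<theta> that] .
  have row: "f i j r = f i k r" and col: "f i j r = f k j r"
    if "i < 3" "j < 3" "i \<noteq> j" "k < 3" "k \<noteq> i" "k \<noteq> j" "r \<in> carrier R" for i j k r
    using fmult[OF that R.red.R.one_closed] fmult[OF that(1-6) R.red.R.one_closed that(7)]
      f1[of i k] f1[of k j] fc[of i k r] fc[of k j r] that by simp_all
  \<comment> \<open>The restriction is there because members of \<open>CHom\<close> are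
    extensional.\<close>
  define \<phi> where "\<phi> = restrict (f 0 1) (carrier R)"
  have f_eq: "f i j r = \<phi> r" if "i < 3" "j < 3" "i \<noteq> j" "r \<in> carrier R" for i j r
  proof -
    \<comment> \<open>A chain through all six roots in which neighbours share a row or a
      column.\<close>
    have "f 0 2 r = f 0 1 r" "f 1 2 r = f 0 2 r" "f 1 0 r = f 1 2 r" "f 2 0 r = f 1 0 r" "f 2 1 r = f 2 0 r"
      using that(4) by (intro row col; simp)+
    then show ?thesis using that by (elim less_3E) (simp_all add: \<phi>_def)
  qed
  have \<phi>: "\<phi> \<in> ring_hom R S"
  proof (rule ring_hom_memI)
    fix r assume r: "r \<in> carrier R"
    show "\<phi> r \<in> carrier S" using fc[of 0 1 r] r by (simp add: \<phi>_def)
    fix s assume s: "s \<in> carrier R"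
    show "\<phi> (r \<otimes>\<^bsub>R\<^esub> s) = \<phi> r \<otimes>\<^bsub>S\<^esub> \<phi> s"
      using fmult[of 0 1 2 r s] r s f_eq by simp
    have "mat_elem S 3 0 1 (f 0 1 (r \<oplus>\<^bsub>R\<^esub> s)) = mat_elem S 3 0 1 (f 0 1 r \<oplus>\<^bsub>S\<^esub> f 0 1 s)"
    proof -
      have "\<theta> (E 0 1 r \<star>\<^sub>R E 0 1 s) = \<theta> (E 0 1 r) \<star>\<^sub>S \<theta> (E 0 1 s)"
        using r s by (intro rep_mult[OF rep] E_in_SLn) simp_all
      then show ?thesis
        using r s fc[of 0 1] by (simp add: f_elem R.red.R.mat_elem_add S.red.R.mat_elem_add)
    qed
    from arg_cong[OF this, of "\<lambda>A. A 0 1"]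
    have "f 0 1 (r \<oplus>\<^bsub>R\<^esub> s) = f 0 1 r \<oplus>\<^bsub>S\<^esub> f 0 1 s"
      by (simp add: mat_elem_def)
    then show "\<phi> (r \<oplus>\<^bsub>R\<^esub> s) = \<phi> r \<oplus>\<^bsub>S\<^esub> \<phi> s" using r s by (simp add: \<phi>_def)
  qed (simp add: \<phi>_def f1)
  have \<phi>red: "\<sigma> (\<phi> r) = \<rho> r" if "r \<in> carrier R" for r
    using that rep_elem_red[OF rep that, of 0 1 0 1] by (simp add: \<phi>_def f_def)
  have "\<phi> \<in> CHom K R \<rho> S \<sigma>"
    unfolding CHom_def R.maxid_eq S.maxid_eq using \<phi> \<phi>red ring_hom_closed[OF \<phi>]
    by (auto simp: \<phi>_def)
  moreover interpret h: ring_hom_cring R S \<phi>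
    by (intro ring_hom_cring.intro ring_hom_cring_axioms.intro R.red.R.is_cring S.red.R.is_cring \<phi>)
  have "\<theta> g = mat_map S 3 \<phi> g" if "g \<in> SLn R 3" for g
    using that
  proof (induct rule: R.loc.SL3_induct)
    case one show ?case by (simp add: rep_one[OF rep] h.mat_map_one)
  next
    case (elem g r i j)
    then show ?case
      using rep_mult[OF rep E_in_SLn[of r i j] elem(1)] R.red.R.SLn_closed[OF elem(1)]
      by (simp add: h.mat_map_mult h.mat_map_elem f_elem f_eq)
  qed
  ultimately show thesis using that by blast
qed

end

section \<open>Lifts, strict equivalence and deformations\<close>

context coeff_pair
begin

lemma lifts_imp_residual_rep: "\<theta> \<in> lifts K R \<rho> 3 S \<sigma> \<Longrightarrow> residual_rep \<theta>"
  unfolding lifts_def residual_rep_def by (auto simp: S.red.R.GLn_eq_Units)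

lemma CHom_ring_hom_cring:
  assumes "f \<in> CHom K R \<rho> S \<sigma>"
  shows "ring_hom_cring R S f"
  using assms R.red.R.is_cring S.red.R.is_cring
  by (intro ring_hom_cring.intro ring_hom_cring_axioms.intro) (auto simp: CHom_def)

text \<open>Generators of an ideal power are products of elements of the maximal ideal, which a
  local homomorphism preserves. This is the source of the continuity of
  \<open>map_lift f\<close>.\<close>

lemma CHom_maps_ideal_pow:
  assumes f: "f \<in> CHom K R \<rho> S \<sigma>" and x: "x \<in> ideal_pow R (a_kernel R K \<rho>) j"
  shows "f x \<in> ideal_pow S (a_kernel S K \<sigma>) j"
  using x
proof (induct j arbitrary: x)
  case 0
  then show ?case using f ring_hom_closed[of f R S] by (auto simp: CHom_def)
next
  case (Suc j)
  interpret h: ring_hom_cring R S f by (rule CHom_ring_hom_cring[OF f])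
  have "x \<in> ideal_prod R (a_kernel R K \<rho>) (ideal_pow R (a_kernel R K \<rho>) j)" using Suc.prems by simp
  then show ?case
  proof (induct rule: ideal_prod.induct)
    case (prod y z)
    then have "f y \<in> a_kernel S K \<sigma>" "f z \<in> ideal_pow S (a_kernel S K \<sigma>) j"
      using f Suc.hyps by (auto simp: CHom_def)
    moreover have "y \<in> carrier R" "z \<in> carrier R"
      using prod R.maxid_eq R.ideal_pow_closed by auto
    ultimately show ?case using S.ideal_pow_SucI by simp
  next
    case (sum y z)
    have "y \<in> ideal_pow R (a_kernel R K \<rho>) (Suc j)" "z \<in> ideal_pow R (a_kernel R K \<rho>) (Suc j)"
      using sum by simp_all
    then have "y \<in> carrier R" "z \<in> carrier R" using R.ideal_pow_closed by blast+
    then show ?case using S.ideal_pow_add[OF sum(2,4)] by simp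
  qed
qed

definition map_lift :: "('r \<Rightarrow> 's) \<Rightarrow> (nat \<Rightarrow> nat \<Rightarrow> 'r) \<Rightarrow> nat \<Rightarrow> nat \<Rightarrow> 's" where
  "map_lift f = (\<lambda>g\<in>SLn R 3. mat_map S 3 f g)"

lemma map_lift_in_lifts:
  assumes f: "f \<in> CHom K R \<rho> S \<sigma>"
  shows "map_lift f \<in> lifts K R \<rho> 3 S \<sigma>"
proof -
  interpret h: ring_hom_cring R S f by (rule CHom_ring_hom_cring[OF f])
  \<comment> \<open>Congruence to order j already implies congruence of the images to order j, so
    \<open>i = j\<close> serves in the continuity condition.\<close>
  have "mat_cong S 3 (ideal_pow S (a_kernel S K \<sigma>) j) (map_lift f g') (map_lift f g)"
    if g: "g \<in> SLn R 3" "g' \<in> SLn R 3" and c: "mat_cong R 3 (ideal_pow R (a_kernel R K \<rho>) j) g' g" for g g' j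
    unfolding mat_cong_def
  proof (intro allI impI)
    fix a b :: nat assume ab: "a < 3" "b < 3"
    have "g a b \<in> carrier R" "g' a b \<in> carrier R"
      using g R.red.R.mat_entry_closed[OF R.red.R.SLn_closed] by blast+
    moreover have "f (g' a b \<ominus>\<^bsub>R\<^esub> g a b) \<in> ideal_pow S (a_kernel S K \<sigma>) j"
      using c ab by (intro CHom_maps_ideal_pow[OF f]) (simp add: mat_cong_def)
    ultimately show "map_lift f g' a b \<ominus>\<^bsub>S\<^esub> map_lift f g a b \<in> ideal_pow S (a_kernel S K \<sigma>) j"
      using g ab by (simp add: map_lift_def h.mat_map_entry R.red.R.minus_eq S.red.R.minus_eq)
  qed
  then have "lift_continuous K R \<rho> 3 S \<sigma> (map_lift f)"
    unfolding lift_continuous_def by blast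
  moreover have "mat_map S 3 f g \<in> GLn S 3" if "g \<in> SLn R 3" for g
    using h.mat_map_SLn[OF that] S.red.R.SLn_subset_Units S.red.R.GLn_eq_Units by blast
  moreover have "mat_map K 3 \<sigma> (mat_map S 3 f g) = mat_map K 3 \<rho> g" if "g \<in> SLn R 3" for g
    using f R.red.R.mat_entry_closed[OF R.red.R.SLn_closed[OF that]]
    by (auto simp: mat_map_def CHom_def fun_eq_iff)
  ultimately show ?thesis
    using R.loc.SLn_mult_closed h.mat_map_mult[OF R.red.R.SLn_closed R.red.R.SLn_closed]
    by (simp add: lifts_def map_lift_def)
qed

lemma Red_eq_one_iff_mat_cong:
  assumes "P \<in> mat_carrier S 3"
  shows "S.Red P = mat_one K 3 \<longleftrightarrow> mat_cong S 3 (a_kernel S K \<sigma>) P (mat_one S 3)"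
proof -
  note c = S.red.R.mat_entry_closed[OF assms] S.red.R.mat_entry_closed[OF S.red.R.mat_one_closed]
  have "S.Red P = mat_one K 3 \<longleftrightarrow> (\<forall>i<3. \<forall>j<3. \<sigma> (P i j) = mat_one K 3 i j)"
    by (auto simp: fun_eq_iff mat_map_def mat_one_def)
  also have "\<dots> \<longleftrightarrow> (\<forall>i<3. \<forall>j<3. \<sigma> (P i j) = \<sigma> (mat_one S 3 i j))"
    by (simp add: mat_one_def)
  also have "\<dots> \<longleftrightarrow> mat_cong S 3 (a_kernel S K \<sigma>) P (mat_one S 3)"
    using c by (simp add: mat_cong_def S.maxid_eq S.red.R.minus_eq flip: R.K.minus_eq)
  finally show ?thesis .
qed

lemma strict_equiv_iff:
  "(\<theta>, \<theta>') \<in> strict_equiv K R \<rho> 3 S \<sigma> \<longleftrightarrow>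
    \<theta> \<in> lifts K R \<rho> 3 S \<sigma> \<and> \<theta>' \<in> lifts K R \<rho> 3 S \<sigma> \<and> conjugate \<theta> \<theta>'"
  unfolding strict_equiv_def conjugate_def using Red_eq_one_iff_mat_cong by blast

lemma equiv_strict_equiv: "equiv (lifts K R \<rho> 3 S \<sigma>) (strict_equiv K R \<rho> 3 S \<sigma>)"
proof (rule equivI)
  have closed: "\<theta> g \<in> mat_carrier S 3" if "\<theta> \<in> lifts K R \<rho> 3 S \<sigma>" "g \<in> SLn R 3" for \<theta> g
    using rep_closed lifts_imp_residual_rep that by blast
  show "strict_equiv K R \<rho> 3 S \<sigma> \<subseteq> lifts K R \<rho> 3 S \<sigma> \<times> lifts K R \<rho> 3 S \<sigma>"
    by (auto simp: strict_equiv_iff)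
  show "refl_on (lifts K R \<rho> 3 S \<sigma>) (strict_equiv K R \<rho> 3 S \<sigma>)"
  proof (rule refl_onI)
    fix \<theta> assume \<theta>: "\<theta> \<in> lifts K R \<rho> 3 S \<sigma>"
    have "\<theta> g = mat_one S 3 \<star>\<^sub>S \<theta> g \<star>\<^sub>S mat_one S 3" if "g \<in> SLn R 3" for g
      using closed[OF \<theta> that] MS.l_one[of "\<theta> g"] MS.r_one[of "\<theta> g"] by simp
    then have "conjugate \<theta> \<theta>"
      unfolding conjugate_def using MS.l_one[of "mat_one S 3"]
      by (intro bexI[of _ "mat_one S 3"]) (simp_all add: S.red.mat_map_one)
    then show "(\<theta>, \<theta>) \<in> strict_equiv K R \<rho> 3 S \<sigma>" using \<theta> by (simp add: strict_equiv_iff)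
  qed
  show "sym (strict_equiv K R \<rho> 3 S \<sigma>)"
    using conjugate_sym closed by (intro symI) (auto simp: strict_equiv_iff)
  show "trans (strict_equiv K R \<rho> 3 S \<sigma>)"
    using conjugate_trans closed by (intro transI) (auto simp: strict_equiv_iff)
qed

text \<open>The conjugating matrix \<open>P\<close> intertwines
  \<open>mat_elem S 3 0 1 (f r)\<close> and \<open>mat_elem S 3 0 1 (g r)\<close>. The (0,1) entry
  gives g r P11 = P00 f r; for r = 1 this is P11 = P00, a unit because \<open>P\<close> reduces to
  1, and it cancels.\<close>

lemma conjugate_map_lift_imp_eq:
  assumes f: "f \<in> CHom K R \<rho> S \<sigma>" and g: "g \<in> CHom K R \<rho> S \<sigma>" and "conjugate (map_lift f) (map_lift g)"
  shows "f = g"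
proof -
  interpret f: ring_hom_cring R S f by (rule CHom_ring_hom_cring[OF f])
  interpret g: ring_hom_cring R S g by (rule CHom_ring_hom_cring[OF g])
  obtain P Q where P: "P \<in> mat_carrier S 3" "Q \<in> mat_carrier S 3" "S.Red P = mat_one K 3"
    "Q \<star>\<^sub>S P = mat_one S 3"
    and eq: "\<And>x. x \<in> SLn R 3 \<Longrightarrow> map_lift g x = P \<star>\<^sub>S map_lift f x \<star>\<^sub>S Q"
    using assms(3) unfolding conjugate_def by blast
  note [simp] = S.red.R.mat_entry_closed[OF P(1)]
  have "mat_elem S 3 i j (g r) \<star>\<^sub>S P = P \<star>\<^sub>S mat_elem S 3 i j (f r)"
    if "i < 3" "j < 3" "i \<noteq> j" "r \<in> carrier R" for i j r
  proof -
    have "mat_elem S 3 i j (g r) \<star>\<^sub>S P = P \<star>\<^sub>S mat_elem S 3 i j (f r) \<star>\<^sub>S (Q \<star>\<^sub>S P)"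
      using eq[OF E_in_SLn[OF that(4,1,2,3)]] P(1,2) that E_in_SLn[OF that(4,1,2,3)]
      by (simp add: map_lift_def f.mat_map_elem g.mat_map_elem S.red.R.mat_mult_assoc)
    then show ?thesis
      using P that MS.r_one[of "P \<star>\<^sub>S mat_elem S 3 i j (f r)"] by simp
  qed
  then have entry: "(if a = i then P a b \<oplus>\<^bsub>S\<^esub> g r \<otimes>\<^bsub>S\<^esub> P j b else P a b) =
      (if b = j then P a b \<oplus>\<^bsub>S\<^esub> P a i \<otimes>\<^bsub>S\<^esub> f r else P a b)"
    if "i < 3" "j < 3" "i \<noteq> j" "r \<in> carrier R" "a < 3" "b < 3" for i j r a b
    using that P(1) S.red.R.mat_elem_mult_entry[of "g r" P a b i j] S.red.R.mat_elem_mult_entry[of "f r" P a b i j]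
    by simp
  have cancel: "x = y" if "z \<oplus>\<^bsub>S\<^esub> x = z \<oplus>\<^bsub>S\<^esub> y" "x \<in> carrier S" "y \<in> carrier S" "z \<in> carrier S" for x y z
    using that S.red.R.add.l_cancel by blast
  have gf: "g r \<otimes>\<^bsub>S\<^esub> P 1 1 = P 0 0 \<otimes>\<^bsub>S\<^esub> f r" if "r \<in> carrier R" for r
    by (rule cancel[of "P 0 1"]) (use entry[of 0 1 r 0 1] that in simp_all)
  have P11: "P 1 1 = P 0 0" using gf[of "\<one>\<^bsub>R\<^esub>"] by simp
  have U: "P 0 0 \<in> Units S"
    using arg_cong[OF P(3), of "\<lambda>A. A 0 0"] by (simp add: S.Units_iff mat_map_def mat_one_def)
  have "g r = f r" if "r \<in> carrier R" for r
    by (rule S.red.R.Unit_cancel_comm[OF U]) (use gf[OF that] that P11 in simp_all)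
  then show "f = g"
    using f g by (intro extensionalityI[of f "carrier R" g]) (auto simp: CHom_def)
qed

lemma exists_conjugate_map_lift:
  assumes \<theta>: "\<theta> \<in> lifts K R \<rho> 3 S \<sigma>" and "card (carrier K) \<noteq> 2"
  shows "\<exists>f\<in>CHom K R \<rho> S \<sigma>. conjugate \<theta> (map_lift f)"
proof -
  have rep: "residual_rep \<theta>" using \<theta> by (rule lifts_imp_residual_rep)
  obtain \<theta>1 where 1: "conjugate \<theta> \<theta>1" "elementary_rep \<theta>1"
    using exists_elementary_rep[OF rep assms(2)] by blast
  obtain \<theta>2 where 2: "conjugate \<theta>1 \<theta>2" "elementary_rep \<theta>2"
    "\<And>i j. i < 3 \<Longrightarrow> j < 3 \<Longrightarrow> i \<noteq> j \<Longrightarrow> \<theta>2 (E i j \<one>\<^bsub>R\<^esub>) = mat_elem S 3 i j \<one>\<^bsub>S\<^esub>"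
    using elementary_rep_normalize[OF 1(2)] by blast
  obtain f where f: "f \<in> CHom K R \<rho> S \<sigma>" "\<And>g. g \<in> SLn R 3 \<Longrightarrow> \<theta>2 g = mat_map S 3 f g"
    using normalized_rep_eq_mat_map[OF 2(2,3)] by blast
  have "conjugate \<theta> \<theta>2"
    using conjugate_trans[OF 1(1) 2(1)] rep_closed[OF rep] by blast
  \<comment> \<open>\<open>conjugate\<close> sees the target only on \<open>SLn R 3\<close>, so the
    restricted \<open>map_lift f\<close> can take the place of \<open>\<theta>2\<close>.\<close>
  then have "conjugate \<theta> (map_lift f)"
    using f(2) unfolding conjugate_def map_lift_def by (simp cong: ball_cong)
  then show ?thesis using f(1) by blast
qed

lemma bij_betw_Def:
  assumes "card (carrier K) \<noteq> 2"
  shows "bij_betw (\<lambda>f. strict_equiv K R \<rho> 3 S \<sigma> `` {map_lift f}) (CHom K R \<rho> S \<sigma>) (Def K R \<rho> 3 S \<sigma>)"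
proof (rule bij_betw_imageI)
  note equiv = equiv_strict_equiv
  show "inj_on (\<lambda>f. strict_equiv K R \<rho> 3 S \<sigma> `` {map_lift f}) (CHom K R \<rho> S \<sigma>)"
  proof (rule inj_onI)
    fix f g assume fg: "f \<in> CHom K R \<rho> S \<sigma>" "g \<in> CHom K R \<rho> S \<sigma>"
      "strict_equiv K R \<rho> 3 S \<sigma> `` {map_lift f} = strict_equiv K R \<rho> 3 S \<sigma> `` {map_lift g}"
    then have "(map_lift f, map_lift g) \<in> strict_equiv K R \<rho> 3 S \<sigma>"
      using eq_equiv_class[OF fg(3) equiv] map_lift_in_lifts by blast
    then show "f = g" using conjugate_map_lift_imp_eq fg by (simp add: strict_equiv_iff)
  qed
  have "\<exists>f\<in>CHom K R \<rho> S \<sigma>. c = strict_equiv K R \<rho> 3 S \<sigma> `` {map_lift f}" if c: "c \<in> Def K R \<rho> 3 S \<sigma>" for c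
  proof -
    obtain \<theta> where \<theta>: "\<theta> \<in> lifts K R \<rho> 3 S \<sigma>" "c = strict_equiv K R \<rho> 3 S \<sigma> `` {\<theta>}"
      using c unfolding Def_def by (rule quotientE)
    obtain f where f: "f \<in> CHom K R \<rho> S \<sigma>" "conjugate \<theta> (map_lift f)"
      using exists_conjugate_map_lift[OF \<theta>(1) assms] by blast
    then have "(\<theta>, map_lift f) \<in> strict_equiv K R \<rho> 3 S \<sigma>"
      using \<theta>(1) map_lift_in_lifts by (simp add: strict_equiv_iff)
    then show ?thesis using equiv_class_eq[OF equiv] f(1) \<theta>(2) by blast
  qed
  then show "(\<lambda>f. strict_equiv K R \<rho> 3 S \<sigma> `` {map_lift f}) ` CHom K R \<rho> S \<sigma> = Def K R \<rho> 3 S \<sigma>"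
    using map_lift_in_lifts unfolding Def_def by (auto intro: quotientI)
qed

end

theorem mainTheorem5:
  fixes K :: "'k ring" and R :: "'r ring" and piR :: "'r \<Rightarrow> 'k"
    and S :: "'s ring" and piS :: "'s \<Rightarrow> 'k"
  assumes "field K" and "finite (carrier K)" and "card (carrier K) \<noteq> 2"
    and "CObj K R piR"
    and "CObj K S piS"
  shows "bij_betw
           (\<lambda>f. strict_equiv K R piR 3 S piS `` {\<lambda>g\<in>SLn R 3. mat_map S 3 f g})
           (CHom K R piR S piS) (Def K R piR 3 S piS)"
proof -
  interpret coeff_pair K R piR S piS
    using assms by (intro coeff_pair.intro coeff_ring.intro)
  show ?thesis using bij_betw_Def[OF assms(3)] by (simp add: map_lift_def)
qed

end
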